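(* Let $G$ be a finite nilpotent group of nilpotency class $c>1$ and set $n=\left\lceil \log_3\left(\frac{c+1}{2}\right)\right\rceil$. If $\exp(G)$ is odd, then $\exp(G\wedge G)\mid (\exp(G))^n$. In particular, $\exp(M(G))\mid (\exp(G))^n$.
   Context: $\exp(X)$ denotes the exponent of a group $X$. Write ${}^g h=ghg^{-1}$. The nonabelian tensor square $G\otimes G$ is the group generated by symbols $g\otimes h$ ($g,h\in G$) subject to the relations $gg'\otimes h=({}^g g'\otimes {}^g h)(g\otimes h)$ and $g\otimes hh'=(g\otimes h)({}^h g\otimes {}^h h')$ for all $g,g',h,h'\in G$. The (nonabelian) exterior square is $G\wedge G=(G\otimes G)/\nabla(G)$, where $\nabla(G)$ is the subgroup generated by all $x\otimes x$, $x\in G$. The Schur multiplier is $M(G)=H_2(G,\mathbb{Z})$; it is isomorphic to the kernel of the homomorphism $G\wedge G\to [G,G]$, $g\wedge h\mapsto [g,h]=ghg^{-1}h^{-1}$. *)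

theory Defs
  imports Complex_Main "HOL-Algebra.Free_Abelian_Groups"
begin

section \<open>Exponent and nilpotency class\<close>

text \<open>The exponent of a group without a positive exponent is set to 0. As 0 divides only 0, this
  convention never makes a statement of the form ``the exponent divides \<open>m\<close>'', \<open>m > 0\<close>, true by
  default.\<close>

definition group_exponent :: "('a, 'b) monoid_scheme \<Rightarrow> nat" where
  "group_exponent G =
     (if \<exists>n::nat. n > 0 \<and> (\<forall>x\<in>carrier G. x [^]\<^bsub>G\<^esub> n = \<one>\<^bsub>G\<^esub>)
      then (LEAST n::nat. n > 0 \<and> (\<forall>x\<in>carrier G. x [^]\<^bsub>G\<^esub> n = \<one>\<^bsub>G\<^esub>))
      else 0)"

definition conj_by :: "('a, 'b) monoid_scheme \<Rightarrow> 'a \<Rightarrow> 'a \<Rightarrow> 'a" where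
  "conj_by G g h = g \<otimes>\<^bsub>G\<^esub> h \<otimes>\<^bsub>G\<^esub> inv\<^bsub>G\<^esub> g"

text \<open>The index is shifted by one from the customary one: \<open>lower_central G i\<close> is
  $\gamma_{i+1}(G)$, so the class of a nilpotent group is the least \<open>c\<close> for which
  \<open>lower_central G c\<close> is trivial.\<close>

primrec lower_central :: "('a, 'b) monoid_scheme \<Rightarrow> nat \<Rightarrow> 'a set" where
  "lower_central G 0 = carrier G"
| "lower_central G (Suc i) =
     generate G {x \<otimes>\<^bsub>G\<^esub> g \<otimes>\<^bsub>G\<^esub> inv\<^bsub>G\<^esub> x \<otimes>\<^bsub>G\<^esub> inv\<^bsub>G\<^esub> g | x g. x \<in> lower_central G i \<and> g \<in> carrier G}"

definition nilpotent :: "('a, 'b) monoid_scheme \<Rightarrow> bool" where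
  "nilpotent G \<longleftrightarrow> (\<exists>c. lower_central G c = {\<one>\<^bsub>G\<^esub>})"

definition nilpotency_class :: "('a, 'b) monoid_scheme \<Rightarrow> nat" where
  "nilpotency_class G = (LEAST c. lower_central G c = {\<one>\<^bsub>G\<^esub>})"

section \<open>Groups given by generators and relations\<close>

text \<open>A letter \<open>(True, s)\<close> stands for the generator \<open>s\<close>, and \<open>(False, s)\<close> for its formal inverse.
  A pair \<open>(u, v)\<close> in the set of relations stands for the relation $u = v$. The group presented by
  \<open>S\<close> and \<open>R\<close> consists of the words over \<open>S\<close> modulo the smallest congruence containing \<open>R\<close>
  for which \<open>s\<close> and its formal inverse cancel.\<close>

type_synonym 's word = "(bool \<times> 's) list"

abbreviation words :: "'s set \<Rightarrow> 's word set" where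
  "words S \<equiv> lists (UNIV \<times> S)"

inductive word_eq :: "'s set \<Rightarrow> ('s word \<times> 's word) set \<Rightarrow> 's word \<Rightarrow> 's word \<Rightarrow> bool"
  for S R where
  refl: "w \<in> words S \<Longrightarrow> word_eq S R w w"
| sym: "word_eq S R u v \<Longrightarrow> word_eq S R v u"
| trans: "word_eq S R u v \<Longrightarrow> word_eq S R v w \<Longrightarrow> word_eq S R u w"
| append: "word_eq S R u u' \<Longrightarrow> word_eq S R v v' \<Longrightarrow> word_eq S R (u @ v) (u' @ v')"
| cancel: "s \<in> S \<Longrightarrow> word_eq S R [(b, s), (\<not> b, s)] []"
| rel: "(u, v) \<in> R \<Longrightarrow> u \<in> words S \<Longrightarrow> v \<in> words S \<Longrightarrow> word_eq S R u v"

definition word_class :: "'s set \<Rightarrow> ('s word \<times> 's word) set \<Rightarrow> 's word \<Rightarrow> 's word set" where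
  "word_class S R u = {v. word_eq S R u v}"

definition presented_group ::
    "'s set \<Rightarrow> ('s word \<times> 's word) set \<Rightarrow> 's word set monoid" where
  "presented_group S R =
     \<lparr>carrier = word_class S R ` words S,
      mult = (\<lambda>X Y. \<Union>u\<in>X. \<Union>v\<in>Y. word_class S R (u @ v)),
      one = word_class S R []\<rparr>"

lemma word_eq_words: "word_eq S R u v \<Longrightarrow> u \<in> words S \<and> v \<in> words S"
  by (induction rule: word_eq.induct) auto

lemma word_class_eq_iff:
  "u \<in> words S \<Longrightarrow> word_class S R u = word_class S R v \<longleftrightarrow> word_eq S R u v"
  unfolding word_class_def by (auto intro: word_eq.intros)

lemma mult_word_class:
  assumes "u \<in> words S" "v \<in> words S"
  shows "word_class S R u \<otimes>\<^bsub>presented_group S R\<^esub> word_class S R v = word_class S R (u @ v)"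
proof -
  have eq: "word_class S R (u' @ v') = word_class S R (u @ v)"
    if "u' \<in> word_class S R u" "v' \<in> word_class S R v" for u' v'
  proof -
    have "word_eq S R (u' @ v') (u @ v)"
      using that by (auto simp: word_class_def intro: word_eq.sym word_eq.append)
    thus ?thesis using word_class_eq_iff word_eq_words by metis
  qed
  have mem: "u \<in> word_class S R u" "v \<in> word_class S R v"
    using assms by (auto simp: word_class_def intro: word_eq.refl)
  have "(\<Union>u'\<in>word_class S R u. \<Union>v'\<in>word_class S R v. word_class S R (u' @ v')) = word_class S R (u @ v)"
    using mem by (intro equalityI UN_least equalityD1[OF eq] subsetI UN_I)
  thus ?thesis
    by (simp add: presented_group_def)
qed

lemma carrier_presented_group: "carrier (presented_group S R) = word_class S R ` words S"
  and one_presented_group: "\<one>\<^bsub>presented_group S R\<^esub> = word_class S R []"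
  by (simp_all add: presented_group_def)

lemma letter_inverse:
  assumes "s \<in> S"
  shows "word_class S R [(b, s)] \<otimes>\<^bsub>presented_group S R\<^esub> word_class S R [(\<not> b, s)] =
         \<one>\<^bsub>presented_group S R\<^esub>"
  using assms
  by (subst mult_word_class) (auto simp: one_presented_group word_class_eq_iff intro: word_eq.cancel)

lemma group_presented_group: "group (presented_group S R)"
proof (rule groupI)
  let ?P = "presented_group S R"
  have carrierE: "\<exists>u\<in>words S. X = word_class S R u" if "X \<in> carrier ?P" for X
    using that by (auto simp: carrier_presented_group simp del: in_lists_conv_set)
  note [simp] = mult_word_class append_in_lists_conv
  note [simp del] = in_lists_conv_set
  show "\<one>\<^bsub>?P\<^esub> \<in> carrier ?P"
    by (simp add: carrier_presented_group one_presented_group)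
  fix X assume "X \<in> carrier ?P"
  then obtain u where u: "u \<in> words S" "X = word_class S R u"
    using carrierE by blast
  show "\<one>\<^bsub>?P\<^esub> \<otimes>\<^bsub>?P\<^esub> X = X"
    using u by (simp add: one_presented_group)
  fix Y assume "Y \<in> carrier ?P"
  then obtain v where v: "v \<in> words S" "Y = word_class S R v"
    using carrierE by blast
  show "X \<otimes>\<^bsub>?P\<^esub> Y \<in> carrier ?P"
    using u v by (simp add: carrier_presented_group)
  fix Z assume "Z \<in> carrier ?P"
  then obtain w where w: "w \<in> words S" "Z = word_class S R w"
    using carrierE by blast
  show "X \<otimes>\<^bsub>?P\<^esub> Y \<otimes>\<^bsub>?P\<^esub> Z = X \<otimes>\<^bsub>?P\<^esub> (Y \<otimes>\<^bsub>?P\<^esub> Z)"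
    using u v w by simp
next
  let ?P = "presented_group S R"
  fix X assume "X \<in> carrier ?P"
  then obtain u where u: "u \<in> words S" "X = word_class S R u"
    by (auto simp: carrier_presented_group)
  define inv_word :: "'a word \<Rightarrow> 'a word" where "inv_word w = rev (map (\<lambda>(b, s). (\<not> b, s)) w)" for w
  have "inv_word w \<in> words S \<and> word_eq S R (inv_word w @ w) []" if "w \<in> words S" for w
    using that
  proof (induction w)
    case Nil
    then show ?case by (auto simp: inv_word_def intro: word_eq.refl)
  next
    case (Cons a w)
    obtain b s where a: "a = (b, s)" by (cases a)
    with Cons have s: "s \<in> S" and w: "w \<in> words S" "inv_word w \<in> words S"
        "word_eq S R (inv_word w @ w) []"
      by auto
    have "word_eq S R ([(\<not> b, s), (b, s)] @ w) w"
      using word_eq.append[OF word_eq.cancel[OF s, of R "\<not> b"] word_eq.refl[OF w(1)]] by simp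
    from word_eq.append[OF word_eq.refl[OF w(2)] this]
    have "word_eq S R (inv_word w @ ([(\<not> b, s), (b, s)] @ w)) []"
      by (rule word_eq.trans[OF _ w(3)])
    then show ?case using a s w by (simp add: inv_word_def)
  qed
  hence iu: "inv_word u \<in> words S" "word_eq S R (inv_word u @ u) []" using u by auto
  have iuu: "inv_word u @ u \<in> words S" using iu(1) u(1) by simp
  have inv: "word_class S R (inv_word u) \<otimes>\<^bsub>?P\<^esub> X = \<one>\<^bsub>?P\<^esub>"
    unfolding u(2) one_presented_group mult_word_class[OF iu(1) u(1)] word_class_eq_iff[OF iuu]
    by (rule iu(2))
  have mem: "word_class S R (inv_word u) \<in> carrier ?P"
    unfolding carrier_presented_group by (rule imageI[OF iu(1)])
  show "\<exists>Y\<in>carrier ?P. Y \<otimes>\<^bsub>?P\<^esub> X = \<one>\<^bsub>?P\<^esub>"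
    using inv mem by (rule bexI[where x = "word_class S R (inv_word u)"])
qed

section \<open>Nonabelian tensor and exterior square\<close>

definition tensor_relations :: "('a, 'b) monoid_scheme \<Rightarrow> (('a \<times> 'a) word \<times> ('a \<times> 'a) word) set" where
  "tensor_relations G =
     {([(True, (g \<otimes>\<^bsub>G\<^esub> g', h))], [(True, (conj_by G g g', conj_by G g h)), (True, (g, h))]) | g g' h.
        g \<in> carrier G \<and> g' \<in> carrier G \<and> h \<in> carrier G} \<union>
     {([(True, (g, h \<otimes>\<^bsub>G\<^esub> h'))], [(True, (g, h)), (True, (conj_by G h g, conj_by G h h'))]) | g h h'.
        g \<in> carrier G \<and> h \<in> carrier G \<and> h' \<in> carrier G}"

definition tensor_square :: "('a, 'b) monoid_scheme \<Rightarrow> ('a \<times> 'a) word set monoid" where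
  "tensor_square G = presented_group (carrier G \<times> carrier G) (tensor_relations G)"

definition tensor :: "('a, 'b) monoid_scheme \<Rightarrow> 'a \<Rightarrow> 'a \<Rightarrow> ('a \<times> 'a) word set" where
  "tensor G g h = word_class (carrier G \<times> carrier G) (tensor_relations G) [(True, (g, h))]"

definition nabla :: "('a, 'b) monoid_scheme \<Rightarrow> ('a \<times> 'a) word set set" where
  "nabla G = generate (tensor_square G) {tensor G x x | x. x \<in> carrier G}"

definition exterior_square :: "('a, 'b) monoid_scheme \<Rightarrow> ('a \<times> 'a) word set set monoid" where
  "exterior_square G = tensor_square G Mod nabla G"

lemma group_tensor_square: "group (tensor_square G)"
  unfolding tensor_square_def by (rule group_presented_group)

lemma tensor_closed:
  "g \<in> carrier G \<Longrightarrow> h \<in> carrier G \<Longrightarrow> tensor G g h \<in> carrier (tensor_square G)"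
  by (auto simp: tensor_def tensor_square_def carrier_presented_group)

context group
begin

lemma conj_by_closed [simp]:
  "g \<in> carrier G \<Longrightarrow> h \<in> carrier G \<Longrightarrow> conj_by G g h \<in> carrier G"
  by (simp add: conj_by_def)

lemma conj_by_mult:
  assumes "g \<in> carrier G" "x \<in> carrier G" "y \<in> carrier G"
  shows "conj_by G g (x \<otimes> y) = conj_by G g x \<otimes> conj_by G g y"
proof -
  have "inv g \<otimes> (g \<otimes> (y \<otimes> inv g)) = y \<otimes> inv g"
    using assms by (simp add: m_assoc[symmetric])
  thus ?thesis using assms by (simp add: conj_by_def m_assoc)
qed

lemma conj_by_conj_by:
  assumes "g \<in> carrier G" "h \<in> carrier G" "x \<in> carrier G"
  shows "conj_by G g (conj_by G h x) = conj_by G (g \<otimes> h) x"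
  using assms by (simp add: conj_by_def m_assoc inv_mult_group)

lemma conj_by_one: "x \<in> carrier G \<Longrightarrow> conj_by G \<one> x = x"
  by (simp add: conj_by_def)

lemma tensor_mult_left:
  assumes "g \<in> carrier G" "g' \<in> carrier G" "h \<in> carrier G"
  shows "tensor G (g \<otimes> g') h =
         tensor G (conj_by G g g') (conj_by G g h) \<otimes>\<^bsub>tensor_square G\<^esub> tensor G g h"
proof -
  let ?S = "carrier G \<times> carrier G"
  have "([(True, (g \<otimes> g', h))], [(True, (conj_by G g g', conj_by G g h))] @ [(True, (g, h))]) \<in> tensor_relations G"
    unfolding tensor_relations_def using assms by simp blast
  moreover have w: "[(True, (g \<otimes> g', h))] \<in> words ?S" "[(True, (conj_by G g g', conj_by G g h))] \<in> words ?S" "[(True, (g, h))] \<in> words ?S"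
    using assms by simp_all
  moreover have "[(True, (conj_by G g g', conj_by G g h))] @ [(True, (g, h))] \<in> words ?S"
    using assms by simp
  ultimately have "word_eq ?S (tensor_relations G) [(True, (g \<otimes> g', h))] ([(True, (conj_by G g g', conj_by G g h))] @ [(True, (g, h))])"
    by (intro word_eq.rel)
  thus ?thesis
    unfolding tensor_def tensor_square_def mult_word_class[OF w(2,3)] word_class_eq_iff[OF w(1)] .
qed

lemma tensor_mult_right:
  assumes "g \<in> carrier G" "h \<in> carrier G" "h' \<in> carrier G"
  shows "tensor G g (h \<otimes> h') =
         tensor G g h \<otimes>\<^bsub>tensor_square G\<^esub> tensor G (conj_by G h g) (conj_by G h h')"
proof -
  let ?S = "carrier G \<times> carrier G"
  have "([(True, (g, h \<otimes> h'))], [(True, (g, h))] @ [(True, (conj_by G h g, conj_by G h h'))]) \<in> tensor_relations G"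
    unfolding tensor_relations_def using assms by simp blast
  moreover have w: "[(True, (g, h \<otimes> h'))] \<in> words ?S" "[(True, (g, h))] \<in> words ?S" "[(True, (conj_by G h g, conj_by G h h'))] \<in> words ?S"
    using assms by simp_all
  moreover have "[(True, (g, h))] @ [(True, (conj_by G h g, conj_by G h h'))] \<in> words ?S"
    using assms by simp
  ultimately have "word_eq ?S (tensor_relations G) [(True, (g, h \<otimes> h'))] ([(True, (g, h))] @ [(True, (conj_by G h g, conj_by G h h'))])"
    by (intro word_eq.rel)
  thus ?thesis
    unfolding tensor_def tensor_square_def mult_word_class[OF w(2,3)] word_class_eq_iff[OF w(1)] .
qed

lemma tensor_commute:
  assumes [simp]: "g \<in> carrier G" "h \<in> carrier G" "a \<in> carrier G" "b \<in> carrier G"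
  shows "tensor G (conj_by G (g \<otimes> h) a) (conj_by G (g \<otimes> h) b) \<otimes>\<^bsub>tensor_square G\<^esub> tensor G g h =
         tensor G g h \<otimes>\<^bsub>tensor_square G\<^esub> tensor G (conj_by G (h \<otimes> g) a) (conj_by G (h \<otimes> g) b)"
    (is "?gh \<otimes>\<^bsub>?T\<^esub> ?t = ?t \<otimes>\<^bsub>?T\<^esub> ?hg")
proof -
  interpret T: group ?T by (rule group_tensor_square)
  note [simp] = tensor_closed
  let ?l = "tensor G (conj_by G g a) (conj_by G g h)"
  let ?r = "tensor G (conj_by G h g) (conj_by G h b)"
  have gh: "conj_by G (conj_by G g h) (conj_by G g x) = conj_by G (g \<otimes> h) x"
    if "x \<in> carrier G" for x
    using that by (simp add: conj_by_conj_by) (simp add: conj_by_def m_assoc)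
  have hg: "conj_by G (conj_by G h g) (conj_by G h x) = conj_by G (h \<otimes> g) x"
    if "x \<in> carrier G" for x
    using that by (simp add: conj_by_conj_by) (simp add: conj_by_def m_assoc)
  have "tensor G (g \<otimes> a) (h \<otimes> b) = (?l \<otimes>\<^bsub>?T\<^esub> ?gh) \<otimes>\<^bsub>?T\<^esub> (?t \<otimes>\<^bsub>?T\<^esub> ?r)"
    by (subst tensor_mult_left) (simp_all add: tensor_mult_right conj_by_mult gh)
  moreover have "tensor G (g \<otimes> a) (h \<otimes> b) = (?l \<otimes>\<^bsub>?T\<^esub> ?t) \<otimes>\<^bsub>?T\<^esub> (?hg \<otimes>\<^bsub>?T\<^esub> ?r)"
    by (subst tensor_mult_right) (simp_all add: tensor_mult_left conj_by_mult hg)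
  ultimately show ?thesis
    by (simp add: T.m_assoc[symmetric]) (simp add: T.m_assoc)
qed

lemma nabla_normal: "nabla G \<lhd> tensor_square G"
  unfolding nabla_def
proof (rule group.normal_generateI[OF group_tensor_square])
  let ?T = "tensor_square G"
  let ?S = "carrier G \<times> carrier G"
  let ?R = "tensor_relations G"
  let ?D = "{tensor G x x | x. x \<in> carrier G}"
  interpret T: group ?T by (rule group_tensor_square)
  note [simp] = tensor_closed
  show "?D \<subseteq> carrier ?T" by auto
  have letter: "word_class ?S ?R [(b, s)] \<otimes>\<^bsub>?T\<^esub> d \<otimes>\<^bsub>?T\<^esub> inv\<^bsub>?T\<^esub> word_class ?S ?R [(b, s)] \<in> ?D"
    if d: "d \<in> ?D" and s: "s \<in> ?S" for b s d
  proof -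
    obtain x where x [simp]: "x \<in> carrier G" "d = tensor G x x" using d by auto
    obtain g h where gh [simp]: "s = (g, h)" "g \<in> carrier G" "h \<in> carrier G" using s by auto
    have pos: "word_class ?S ?R [(True, s)] = tensor G g h" by (simp add: tensor_def)
    have "word_class ?S ?R [(False, s)] \<in> carrier ?T"
      using s by (auto simp: tensor_square_def carrier_presented_group)
    moreover have "word_class ?S ?R [(False, s)] \<otimes>\<^bsub>?T\<^esub> tensor G g h = \<one>\<^bsub>?T\<^esub>"
      using letter_inverse[OF s, of ?R False] pos by (simp add: tensor_square_def)
    ultimately have neg: "word_class ?S ?R [(False, s)] = inv\<^bsub>?T\<^esub> tensor G g h"
      by (simp add: T.inv_equality)
    let ?y = "conj_by G (inv (h \<otimes> g)) x"
    let ?z = "conj_by G (inv (g \<otimes> h)) x"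
    have "tensor G g h \<otimes>\<^bsub>?T\<^esub> d = tensor G (conj_by G (g \<otimes> h) ?y) (conj_by G (g \<otimes> h) ?y) \<otimes>\<^bsub>?T\<^esub> tensor G g h"
      using tensor_commute[of g h ?y ?y] by (simp add: conj_by_conj_by[of "h \<otimes> g" "inv (h \<otimes> g)"] conj_by_one)
    hence p: "tensor G g h \<otimes>\<^bsub>?T\<^esub> d \<otimes>\<^bsub>?T\<^esub> inv\<^bsub>?T\<^esub> tensor G g h \<in> ?D"
      by (auto simp: T.m_assoc)
    have "d \<otimes>\<^bsub>?T\<^esub> tensor G g h = tensor G g h \<otimes>\<^bsub>?T\<^esub> tensor G (conj_by G (h \<otimes> g) ?z) (conj_by G (h \<otimes> g) ?z)"
      using tensor_commute[of g h ?z ?z] by (simp add: conj_by_conj_by[of "g \<otimes> h" "inv (g \<otimes> h)"] conj_by_one)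
    hence n: "inv\<^bsub>?T\<^esub> tensor G g h \<otimes>\<^bsub>?T\<^esub> d \<otimes>\<^bsub>?T\<^esub> tensor G g h \<in> ?D"
      by (auto simp: T.m_assoc) (simp add: T.m_assoc[symmetric], auto)
    show ?thesis using p n pos neg by (cases b) simp_all
  qed
  have "word_class ?S ?R w \<otimes>\<^bsub>?T\<^esub> d \<otimes>\<^bsub>?T\<^esub> inv\<^bsub>?T\<^esub> word_class ?S ?R w \<in> ?D"
    if "w \<in> words ?S" "d \<in> ?D" for w d
    using that
  proof (induction w rule: list.induct)
    case Nil
    have "word_class ?S ?R [] = \<one>\<^bsub>?T\<^esub>" by (simp add: tensor_square_def one_presented_group)
    then show ?case using Nil by auto
  next
    case (Cons l w)
    obtain b s where l [simp]: "l = (b, s)" by (cases l)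
    let ?l = "word_class ?S ?R [(b, s)]" and ?w = "word_class ?S ?R w"
    have s: "s \<in> ?S" and w: "w \<in> words ?S"
      using Cons.prems(1) by (simp_all add: mem_Times_iff del: in_lists_conv_set)
    have ls: "[(b, s)] \<in> words ?S" using s by simp
    hence "?l \<in> carrier ?T" "?w \<in> carrier ?T"
      using w unfolding tensor_square_def carrier_presented_group by blast+
    moreover have "d \<in> carrier ?T" using Cons.prems(2) by auto
    ultimately have c: "?l \<in> carrier ?T" "?w \<in> carrier ?T" "d \<in> carrier ?T" .
    have "word_class ?S ?R (l # w) = ?l \<otimes>\<^bsub>?T\<^esub> ?w"
      using mult_word_class[OF ls w, of ?R] by (simp add: tensor_square_def)
    moreover have "?l \<otimes>\<^bsub>?T\<^esub> (?w \<otimes>\<^bsub>?T\<^esub> d \<otimes>\<^bsub>?T\<^esub> inv\<^bsub>?T\<^esub> ?w) \<otimes>\<^bsub>?T\<^esub> inv\<^bsub>?T\<^esub> ?l \<in> ?D"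
      by (rule letter[OF Cons.IH[OF w Cons.prems(2)] s])
    ultimately show ?case using c by (simp add: T.m_assoc T.inv_mult_group)
  qed
  thus "x \<otimes>\<^bsub>?T\<^esub> d \<otimes>\<^bsub>?T\<^esub> inv\<^bsub>?T\<^esub> x \<in> ?D" if "d \<in> ?D" "x \<in> carrier ?T" for d x
    using that unfolding tensor_square_def carrier_presented_group by blast
qed

lemma group_exterior_square: "group (exterior_square G)"
  unfolding exterior_square_def by (rule normal.factorgroup_is_group[OF nabla_normal])

end

section \<open>Schur multiplier\<close>

text \<open>$H_2(G, \mathbb{Z})$ with trivial action, as the homology in degree 2 of the (unnormalised,
  inhomogeneous) bar complex $\mathbb{Z}[G^3] \to \mathbb{Z}[G^2] \to \mathbb{Z}[G]$.\<close>

definition bar_boundary2 :: "('a, 'b) monoid_scheme \<Rightarrow> ('a \<times> 'a \<Rightarrow>\<^sub>0 int) \<Rightarrow> ('a \<Rightarrow>\<^sub>0 int)" where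
  "bar_boundary2 G =
     frag_extend (\<lambda>(g, h). frag_of h - frag_of (g \<otimes>\<^bsub>G\<^esub> h) + frag_of g)"

definition bar_boundary3 ::
    "('a, 'b) monoid_scheme \<Rightarrow> ('a \<times> 'a \<times> 'a \<Rightarrow>\<^sub>0 int) \<Rightarrow> ('a \<times> 'a \<Rightarrow>\<^sub>0 int)" where
  "bar_boundary3 G =
     frag_extend (\<lambda>(g, h, k). frag_of (h, k) - frag_of (g \<otimes>\<^bsub>G\<^esub> h, k)
                              + frag_of (g, h \<otimes>\<^bsub>G\<^esub> k) - frag_of (g, h))"

definition bar_cycles2 :: "('a, 'b) monoid_scheme \<Rightarrow> ('a \<times> 'a \<Rightarrow>\<^sub>0 int) set" where
  "bar_cycles2 G = kernel (free_Abelian_group (carrier G \<times> carrier G))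
                          (free_Abelian_group (carrier G)) (bar_boundary2 G)"

definition bar_boundaries2 :: "('a, 'b) monoid_scheme \<Rightarrow> ('a \<times> 'a \<Rightarrow>\<^sub>0 int) set" where
  "bar_boundaries2 G =
     bar_boundary3 G ` carrier (free_Abelian_group (carrier G \<times> carrier G \<times> carrier G))"

definition schur_multiplier :: "('a, 'b) monoid_scheme \<Rightarrow> ('a \<times> 'a \<Rightarrow>\<^sub>0 int) set monoid" where
  "schur_multiplier G =
     (free_Abelian_group (carrier G \<times> carrier G))\<lparr>carrier := bar_cycles2 G\<rparr> Mod bar_boundaries2 G"

context group
begin

lemma bar_boundary2_hom:
  "bar_boundary2 G \<in> hom (free_Abelian_group (carrier G \<times> carrier G)) (free_Abelian_group (carrier G))"
proof (rule homI)
  fix x assume x: "x \<in> carrier (free_Abelian_group (carrier G \<times> carrier G))"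
  have k: "Poly_Mapping.keys (case p of (g, h) \<Rightarrow> frag_of h - frag_of (g \<otimes> h) + frag_of g) \<subseteq> carrier G"
    if p: "p \<in> carrier G \<times> carrier G" for p
  proof -
    obtain g h where [simp]: "p = (g, h)" "g \<in> carrier G" "h \<in> carrier G"
      using p by auto
    have "Poly_Mapping.keys (frag_of h - frag_of (g \<otimes> h) + frag_of g) \<subseteq>
        Poly_Mapping.keys (frag_of h) \<union> Poly_Mapping.keys (frag_of (g \<otimes> h)) \<union> Poly_Mapping.keys (frag_of g)"
      using Poly_Mapping.keys_add[of "frag_of h - frag_of (g \<otimes> h)" "frag_of g"]
        keys_diff[of "frag_of h" "frag_of (g \<otimes> h)"] by blast
    thus ?thesis by auto
  qed
  have "Poly_Mapping.keys x \<subseteq> carrier G \<times> carrier G"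
    using x by (simp add: free_Abelian_group_def)
  hence "Poly_Mapping.keys (bar_boundary2 G x) \<subseteq> carrier G"
    unfolding bar_boundary2_def
    by (intro subset_trans[OF keys_frag_extend UN_least] k) (rule subsetD)
  thus "bar_boundary2 G x \<in> carrier (free_Abelian_group (carrier G))"
    by (simp add: free_Abelian_group_def)
qed (simp add: bar_boundary2_def frag_extend_add)

lemma bar_boundary3_hom:
  "bar_boundary3 G \<in> hom (free_Abelian_group (carrier G \<times> carrier G \<times> carrier G))
                         (free_Abelian_group (carrier G \<times> carrier G))"
proof (rule homI)
  fix x assume x: "x \<in> carrier (free_Abelian_group (carrier G \<times> carrier G \<times> carrier G))"
  have k: "Poly_Mapping.keys (case p of (g, h, k) \<Rightarrow> frag_of (h, k) - frag_of (g \<otimes> h, k)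
          + frag_of (g, h \<otimes> k) - frag_of (g, h)) \<subseteq> carrier G \<times> carrier G"
    if p: "p \<in> carrier G \<times> carrier G \<times> carrier G" for p
  proof -
    obtain g h k where [simp]: "p = (g, h, k)" "g \<in> carrier G" "h \<in> carrier G" "k \<in> carrier G"
      using p by auto
    let ?A = "frag_of (h, k)" and ?B = "frag_of (g \<otimes> h, k)"
      and ?C = "frag_of (g, h \<otimes> k)" and ?D = "frag_of (g, h)"
    have "Poly_Mapping.keys (?A - ?B + ?C - ?D) \<subseteq>
        Poly_Mapping.keys ?A \<union> Poly_Mapping.keys ?B \<union> Poly_Mapping.keys ?C \<union> Poly_Mapping.keys ?D"
      using keys_diff[of "?A - ?B + ?C" ?D] Poly_Mapping.keys_add[of "?A - ?B" ?C] keys_diff[of ?A ?B] by blast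
    thus ?thesis by auto
  qed
  have "Poly_Mapping.keys x \<subseteq> carrier G \<times> carrier G \<times> carrier G"
    using x by (simp add: free_Abelian_group_def)
  hence "Poly_Mapping.keys (bar_boundary3 G x) \<subseteq> carrier G \<times> carrier G"
    unfolding bar_boundary3_def
    by (intro subset_trans[OF keys_frag_extend UN_least] k) (rule subsetD)
  thus "bar_boundary3 G x \<in> carrier (free_Abelian_group (carrier G \<times> carrier G))"
    by (simp add: free_Abelian_group_def)
qed (simp add: bar_boundary3_def frag_extend_add)

lemma bar_boundary2_boundary3:
  assumes "x \<in> carrier (free_Abelian_group (carrier G \<times> carrier G \<times> carrier G))"
  shows "bar_boundary2 G (bar_boundary3 G x) = 0"
proof -
  have "Poly_Mapping.keys x \<subseteq> carrier G \<times> carrier G \<times> carrier G"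
    using assms by (simp add: free_Abelian_group_def)
  thus ?thesis
  proof (induction x rule: frag_induction)
    case (one p)
    then show ?case
      by (auto simp: bar_boundary2_def bar_boundary3_def frag_extend_add frag_extend_diff m_assoc)
  qed (simp_all add: bar_boundary2_def bar_boundary3_def frag_extend_diff)
qed

lemma group_schur_multiplier: "group (schur_multiplier G)"
proof -
  let ?C1 = "free_Abelian_group (carrier G)"
  let ?C2 = "free_Abelian_group (carrier G \<times> carrier G)"
  let ?C3 = "free_Abelian_group (carrier G \<times> carrier G \<times> carrier G)"
  interpret d2: group_hom ?C2 ?C1 "bar_boundary2 G"
    by (simp add: group_hom_def group_hom_axioms_def bar_boundary2_hom)
  interpret d3: group_hom ?C3 ?C2 "bar_boundary3 G"
    by (simp add: group_hom_def group_hom_axioms_def bar_boundary3_hom)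
  have Z: "subgroup (bar_cycles2 G) ?C2"
    unfolding bar_cycles2_def by (rule d2.subgroup_kernel)
  have B: "subgroup (bar_boundaries2 G) ?C2"
    unfolding bar_boundaries2_def by (rule d3.img_is_subgroup)
  have "bar_boundaries2 G \<subseteq> bar_cycles2 G"
    unfolding bar_boundaries2_def bar_cycles2_def kernel_def
    using bar_boundary2_boundary3 d3.hom_closed by (auto simp del: carrier_free_Abelian_group_iff)
  hence "subgroup (bar_boundaries2 G) (?C2\<lparr>carrier := bar_cycles2 G\<rparr>)"
    by (rule group.subgroup_incl[OF group_free_Abelian_group B Z])
  moreover have "comm_group (?C2\<lparr>carrier := bar_cycles2 G\<rparr>)"
    using subgroup.subset[OF Z]
    by (intro group.group_comm_groupI subgroup.subgroup_is_group[OF Z])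
       (auto intro: add.commute)
  ultimately have "bar_boundaries2 G \<lhd> ?C2\<lparr>carrier := bar_cycles2 G\<rparr>"
    by (intro comm_group.subgroup_imp_normal)
  thus ?thesis
    unfolding schur_multiplier_def by (rule normal.factorgroup_is_group)
qed

end

end

(*
  Let H be a central extension of G, so that e-th powers are central in H, where e = exp G is odd.
  Collecting (u x^-1)^e for u = [y, x] gives an identity between u^e and the powers
  [u, x, x]^C(e,3) and [u, x, x, x, x]^C(e,5) modulo gamma_7(H). Since [y, x y^k] is conjugate to u,
  and u^e is central, these powers do not change when x is replaced by x y^k; comparing the terms of
  top degree in k kills them (the prime 5 in degree 4, the prime 3 in degree 2). So every commutator
  has trivial e-th power modulo gamma_7(H). For products of commutators one needs in addition that
  C(e,3)-th powers of weight 6 commutators vanish, which comes from Heineken's theorem that 3-Engel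
  groups without elements of order 2 and 5 have class at most 4. This gives
  gamma_2(H)^e <= gamma_7(H); the inclusions gamma_{m+1}(H)^e <= gamma_{3m+1}(H) are elementary, and
  together gamma_2(H)^(e^n) <= gamma_{1 + 2 * 3^n}(H), which is trivial as soon as c + 1 <= 2 * 3^n.

  Both groups in question embed in the derived subgroup of such an H. For the exterior square, H is
  generated by lifts of the elements of G with [lift g, lift h] = g /\ h, acting on normal forms. For
  the Schur multiplier, H is the extension by 2-chains modulo boundaries with the tautological cocycle.
*)
theory Submission
  imports Defs
begin

section \<open>Commutator calculus\<close>

text \<open>The elementary inclusion alone, started at m = 1, gives gamma_2(H)^e <= gamma_4(H) and
  after n rounds only gamma_{3^n + 1}(H). Reaching gamma_7(H) in the first round is what produces
  the factor 2 in (c + 1)/2, and is the reason for all the work in class 6. The obstacle there is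
  that the identities control v^q with q = C(e,3) and not v itself, and only up to a factor
  [u, x, u]^q of weight 5. As 3q is a multiple of e, the q-th powers of gamma_4 have order dividing
  3. So those v in gamma_4 are divided out for which v^q is also a q-th power from a deeper term. In
  the quotient gamma_4 has exponent 3, the unwanted factor disappears, and invariance under x -> x y
  becomes exact. This forces class at most 3 for two generators, hence [y, x, x, x]^q = 1 throughout
  H, and then Heineken's theorem applies. Each conclusion moves q-th powers one weight deeper;
  taking commutators with H repeats this until gamma_7(H) = 1. No homomorphism from H to G is
  constructed: a relation compatible with products and inverses suffices to bound the class of H and
  to make e-th powers central.\<close>

class mult_group = monoid_mult +
  fixes iv :: "'a \<Rightarrow> 'a"
  assumes iv_left [simp]: "iv a * a = 1"
begin

lemma iv_left_assoc [simp]: "iv a * (a * b) = b"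
  by (simp add: mult.assoc[symmetric])

lemma iv_right [simp]: "a * iv a = 1"
  by (metis iv_left iv_left_assoc mult_1_right)

lemma iv_right_assoc [simp]: "a * (iv a * b) = b"
  by (simp add: mult.assoc[symmetric])

lemma iv_unique: "a * b = 1 \<Longrightarrow> iv a = b"
  by (metis iv_left_assoc mult_1_right)

lemma iv_iv [simp]: "iv (iv a) = a"
  by (rule iv_unique) simp

lemma iv_one [simp]: "iv 1 = 1"
  by (rule iv_unique) simp

lemma iv_mult [simp]: "iv (a * b) = iv b * iv a"
  by (rule iv_unique) (simp add: mult.assoc)

lemma mult_left_cancel [simp]: "a * b = a * c \<longleftrightarrow> b = c"
  by (metis iv_left_assoc)

lemma mult_right_cancel [simp]: "b * a = c * a \<longleftrightarrow> b = c"
  by (metis iv_right mult.assoc mult_1_right)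

lemma iv_eq_one_iff [simp]: "iv a = 1 \<longleftrightarrow> a = 1"
  by (metis iv_iv iv_one)

lemma eq_iff_iv_mult: "a = b \<longleftrightarrow> iv a * b = 1"
  by (metis iv_left iv_right_assoc mult_1_right)

definition cm :: "'a \<Rightarrow> 'a \<Rightarrow> 'a" where
  "cm x y = iv x * iv y * x * y"

definition cj :: "'a \<Rightarrow> 'a \<Rightarrow> 'a" where
  "cj x y = iv y * x * y"

lemma cm_eq_one_iff: "cm x y = 1 \<longleftrightarrow> x * y = y * x"
proof -
  have "cm x y = iv (y * x) * (x * y)" by (simp add: cm_def mult.assoc)
  thus ?thesis by (metis eq_iff_iv_mult)
qed

lemma cm_one_left [simp]: "cm 1 x = 1" and cm_one_right [simp]: "cm x 1 = 1" and cm_self [simp]: "cm x x = 1"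
  by (simp_all add: cm_def mult.assoc)

lemma cj_one [simp]: "cj 1 x = 1" "cj x 1 = x" "cj x x = x"
  by (simp_all add: cj_def)

lemma cj_mult: "cj (a * b) x = cj a x * cj b x"
  by (simp add: cj_def mult.assoc)

lemma cj_cj: "cj (cj a x) y = cj a (x * y)"
  by (simp add: cj_def mult.assoc)

lemma cj_eq_mult_cm: "cj a x = a * cm a x"
  by (simp add: cj_def cm_def mult.assoc)

lemma cj_eq_self_iff: "cj a x = a \<longleftrightarrow> a * x = x * a"
  by (metis cj_eq_mult_cm cm_eq_one_iff mult_1_right mult_left_cancel)

lemma cm_mult_left_cj: "cm (a * b) c = cj (cm a c) b * cm b c"
  by (simp add: cj_def cm_def mult.assoc)

lemma cm_mult_right_cj: "cm a (b * c) = cm a c * cj (cm a b) c"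
  by (simp add: cj_def cm_def mult.assoc)

lemma iv_cm: "iv (cm a b) = cm b a"
  by (simp add: cm_def mult.assoc)

lemma cm_iv_right_cj: "cm a (iv b) = cj (iv (cm a b)) (iv b)"
  by (simp add: cj_def cm_def mult.assoc)

lemma cm_mult_left: "cm a c * b = b * cm a c \<Longrightarrow> cm (a * b) c = cm a c * cm b c"
  by (simp add: cm_mult_left_cj cj_eq_self_iff)

lemma commute_iv_right:
  assumes "a * b = b * a" shows "a * iv b = iv b * a"
proof -
  have "iv b * (a * b) * iv b = iv b * (b * a) * iv b" using assms by simp
  thus ?thesis by (simp add: mult.assoc)
qed

lemma commute_iv_left: "a * b = b * a \<Longrightarrow> iv a * b = b * iv a"
  using commute_iv_right[of b a] by simp

lemma commute_power: "a * b = b * a \<Longrightarrow> a ^ n * b = b * a ^ n"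
proof (induction n)
  case (Suc n)
  have "a * a ^ n * b = a * (a ^ n * b)" by (simp add: mult.assoc)
  also have "\<dots> = a * (b * a ^ n)" using Suc by simp
  also have "\<dots> = a * b * a ^ n" by (simp add: mult.assoc)
  also have "\<dots> = b * a * a ^ n" using Suc.prems by simp
  also have "\<dots> = b * (a * a ^ n)" by (simp add: mult.assoc)
  finally show ?case by simp
qed simp

lemma iv_power: "iv (a ^ n) = iv a ^ n"
  by (induction n) (simp_all add: power_commutes)

lemma power_mult_commute: "a * b = b * a \<Longrightarrow> (a * b) ^ n = a ^ n * b ^ n"
proof (induction n)
  case (Suc n)
  have c: "b * a ^ n = a ^ n * b" using commute_power[OF Suc.prems] by simp
  have "a * b * (a ^ n * b ^ n) = a * (b * a ^ n) * b ^ n" by (simp add: mult.assoc)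
  also have "\<dots> = a * a ^ n * (b * b ^ n)" unfolding c by (simp add: mult.assoc)
  finally show ?case using Suc by simp
qed simp

lemma cj_power: "cj (a ^ n) x = cj a x ^ n"
  by (induction n) (simp_all add: cj_mult)

lemma cm_power_left: "cm a c * a = a * cm a c \<Longrightarrow> cm (a ^ n) c = cm a c ^ n"
proof (induction n)
  case (Suc n)
  have "cm (a * a ^ n) c = cm a c * cm (a ^ n) c"
    using commute_power[of a "cm a c" n] Suc.prems by (intro cm_mult_left) simp
  thus ?case using Suc by simp
qed simp

lemma hall_witt:
  "cj (cm (cm x (iv y)) z) y * cj (cm (cm y (iv z)) x) z * cj (cm (cm z (iv x)) y) x = 1"
  by (simp add: cj_def cm_def mult.assoc)

inductive_set gen :: "'a set \<Rightarrow> 'a set" for S where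
  gen_one [intro, simp]: "1 \<in> gen S"
| gen_base [intro]: "x \<in> S \<Longrightarrow> x \<in> gen S"
| gen_mult [intro]: "x \<in> gen S \<Longrightarrow> y \<in> gen S \<Longrightarrow> x * y \<in> gen S"
| gen_iv [intro]: "x \<in> gen S \<Longrightarrow> iv x \<in> gen S"

text \<open>The ambient group fills its type, so that the commutator identities hold for all
  elements without carrier conditions. The groups of interest are subsets of it, and only membership
  has to be tracked.\<close>

definition subgrp :: "'a set \<Rightarrow> bool" where
  "subgrp H \<longleftrightarrow> 1 \<in> H \<and> (\<forall>x\<in>H. \<forall>y\<in>H. x * y \<in> H) \<and> (\<forall>x\<in>H. iv x \<in> H)"

lemma subgrpD:
  assumes "subgrp H"
  shows "1 \<in> H" "x \<in> H \<Longrightarrow> y \<in> H \<Longrightarrow> x * y \<in> H" "x \<in> H \<Longrightarrow> iv x \<in> H"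
  using assms by (auto simp: subgrp_def)

lemma subgrp_power: "subgrp H \<Longrightarrow> x \<in> H \<Longrightarrow> x ^ n \<in> H"
  by (induction n) (auto intro: subgrpD)

lemma subgrp_gen: "subgrp (gen S)"
  by (auto simp: subgrp_def)

lemma gen_least: "subgrp H \<Longrightarrow> S \<subseteq> H \<Longrightarrow> gen S \<subseteq> H"
proof
  fix x assume "subgrp H" "S \<subseteq> H" "x \<in> gen S"
  show "x \<in> H" using \<open>x \<in> gen S\<close>
    by induction (use \<open>S \<subseteq> H\<close> subgrpD[OF \<open>subgrp H\<close>] in auto)
qed

lemma gen_mono: "S \<subseteq> T \<Longrightarrow> gen S \<subseteq> gen T"
  by (rule gen_least[OF subgrp_gen]) auto

end

section \<open>The lower central series of a subgroup\<close>

primrec lc :: "'a::mult_group set \<Rightarrow> nat \<Rightarrow> 'a set" where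
  "lc H 0 = H"
| "lc H (Suc i) = gen {cm x g | x g. x \<in> lc H i \<and> g \<in> H}"

declare lc.simps(2) [simp del]

text \<open>The lower central series in its customary indexing, $\gamma_1(H) = H$, extended by
  \<open>gam H 0 = H\<close>.\<close>

definition gam :: "'a::mult_group set \<Rightarrow> nat \<Rightarrow> 'a set" where
  "gam H i = lc H (i - 1)"

lemma gam_Suc: "i \<ge> 1 \<Longrightarrow> gam H (Suc i) = gen {cm x g | x g. x \<in> gam H i \<and> g \<in> H}"
  by (cases i) (simp_all add: gam_def lc.simps)

lemma gam_simps [simp]: "gam H 0 = H" "gam H 1 = H" "gam H (Suc 0) = H"
  by (simp_all add: gam_def)

lemma subgrp_cj: "subgrp H \<Longrightarrow> a \<in> H \<Longrightarrow> x \<in> H \<Longrightarrow> cj a x \<in> H"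
  unfolding cj_def by (blast intro: subgrpD)

lemma subgrp_cm: "subgrp H \<Longrightarrow> a \<in> H \<Longrightarrow> x \<in> H \<Longrightarrow> cm a x \<in> H"
  unfolding cm_def by (blast intro: subgrpD)

lemma lc_sub: "subgrp H \<Longrightarrow> subgrp (lc H i) \<and> lc H i \<subseteq> H"
proof (induction i)
  case (Suc i)
  have "gen {cm x g | x g. x \<in> lc H i \<and> g \<in> H} \<subseteq> H"
    using Suc by (intro gen_least) (auto intro: subgrp_cm)
  thus ?case by (simp add: subgrp_gen lc.simps)
qed simp

lemma lc_cm: "x \<in> lc H i \<Longrightarrow> g \<in> H \<Longrightarrow> cm x g \<in> lc H (Suc i)"
  by (auto simp: lc.simps)

lemma lc_normal_step:
  assumes "subgrp H"
  shows "lc H (Suc i) \<subseteq> lc H i \<and> (\<forall>a\<in>lc H i. \<forall>x\<in>H. cj a x \<in> lc H i)"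
proof (induction i)
  case 0
  show ?case using lc_sub[OF assms, of 1] assms by (auto intro: subgrp_cj)
next
  case (Suc i)
  have "{cm x g | x g. x \<in> lc H (Suc i) \<and> g \<in> H} \<subseteq> lc H (Suc i)"
    using Suc.IH lc_cm by blast
  hence sub: "lc H (Suc (Suc i)) \<subseteq> lc H (Suc i)"
    unfolding lc.simps(2)[of H "Suc i"] using lc_sub[OF assms, of "Suc i"] by (intro gen_least) auto
  have "cj a x \<in> lc H (Suc i)" if "a \<in> lc H (Suc i)" "x \<in> H" for a x
  proof -
    have "a * cm a x \<in> lc H (Suc i)"
      using that sub lc_cm[OF that] lc_sub[OF assms, of "Suc i"] by (meson subgrpD(2) subsetD)
    thus ?thesis by (simp add: cj_eq_mult_cm)
  qed
  thus ?case using sub by blast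
qed

lemma subgrp_gam [simp]: "subgrp H \<Longrightarrow> subgrp (gam H i)"
  by (simp add: gam_def lc_sub)

lemma gam_sub: "subgrp H \<Longrightarrow> x \<in> gam H i \<Longrightarrow> x \<in> H"
  using lc_sub by (auto simp: gam_def)

lemma gam_antimono:
  assumes "subgrp H" "i \<le> j" "x \<in> gam H j" shows "x \<in> gam H i"
proof -
  have "lc H (i + k) \<subseteq> lc H i" for i k
    by (induction k) (use lc_normal_step[OF assms(1)] in auto)
  moreover have "j - 1 = i - 1 + (j - i)" if "i \<ge> 1" using that assms by simp
  moreover have "lc H (j - 1) \<subseteq> lc H 0" using lc_sub[OF assms(1)] by simp
  ultimately have "lc H (j - 1) \<subseteq> lc H (i - 1)" by (cases "i \<ge> 1") (metis, simp)
  thus ?thesis using assms by (auto simp: gam_def)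
qed

lemma gam_cj: "subgrp H \<Longrightarrow> a \<in> gam H i \<Longrightarrow> x \<in> H \<Longrightarrow> cj a x \<in> gam H i"
  using lc_normal_step unfolding gam_def by blast

lemma gam_cm_H: "subgrp H \<Longrightarrow> a \<in> gam H i \<Longrightarrow> x \<in> H \<Longrightarrow> cm a x \<in> gam H (Suc i)"
proof (cases i)
  case 0
  assume "subgrp H" "a \<in> gam H i" "x \<in> H"
  thus ?thesis using 0 subgrp_cm by auto
qed (auto simp: gam_def lc.simps)

text \<open>For fixed \<open>w\<close> the elements whose commutator with \<open>w\<close> lies in
  \<open>N\<close> form a subgroup, since [w, bc] = [w, c] [w, b]^c and \<open>N\<close> is
  invariant under conjugation.\<close>

lemma gen_cm_right:
  assumes N: "subgrp N" "\<And>n x. n \<in> N \<Longrightarrow> x \<in> H \<Longrightarrow> cj n x \<in> N" and H: "subgrp H"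
    and S: "S \<subseteq> H" "\<And>s. s \<in> S \<Longrightarrow> cm w s \<in> N" and a: "a \<in> gen S"
  shows "cm w a \<in> N"
  using a
proof induction
  case (gen_mult x y)
  have "y \<in> H" using gen_least[OF H S(1)] gen_mult by blast
  thus ?case using gen_mult N by (auto simp: cm_mult_right_cj intro: subgrpD)
next
  case (gen_iv x)
  have "x \<in> H" using gen_least[OF H S(1)] gen_iv by blast
  thus ?case using gen_iv N H by (auto simp: cm_iv_right_cj intro: subgrpD)
qed (use S N in \<open>auto intro: subgrpD\<close>)

text \<open>The three subgroups argument. For a generator [x, g] of gamma_{j+1}, the Hall-Witt
  identity expresses a conjugate of [x, g, w] by two commutators that lie in gamma_{i+j+1} by the
  induction hypothesis for \<open>j\<close>.\<close>

lemma gam_cm_aux: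
  assumes H: "subgrp H"
  shows "\<lbrakk>i \<ge> 1; j \<ge> 1; w \<in> gam H i; a \<in> gam H j\<rbrakk> \<Longrightarrow> cm w a \<in> gam H (i + j)"
proof (induction j arbitrary: i w a)
  case (Suc j)
  show ?case
  proof (cases "j = 0")
    case True
    thus ?thesis using Suc.prems H gam_cm_H by auto
  next
    case False
    hence a: "a \<in> gen {cm x g | x g. x \<in> gam H j \<and> g \<in> H}"
      using Suc.prems by (simp add: gam_Suc)
    show ?thesis
    proof (rule gen_cm_right[OF _ _ H _ _ a])
      show "{cm x g | x g. x \<in> gam H j \<and> g \<in> H} \<subseteq> H"
        using H gam_sub by (auto intro!: subgrp_cm)
      fix s assume "s \<in> {cm x g | x g. x \<in> gam H j \<and> g \<in> H}"
      then obtain x g where s: "s = cm x g" "x \<in> gam H j" "g \<in> H" by auto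
      have wH: "w \<in> H" and xH: "x \<in> H" using Suc.prems s H gam_sub by auto
      have G: "subgrp (gam H k)" for k using H by simp
      have "cm (iv g) (iv w) \<in> gam H (Suc i)"
        using gam_cm_H[OF H subgrpD(3)[OF G Suc.prems(3)] subgrpD(3)[OF H s(3)]] subgrpD(3)[OF G] iv_cm by metis
      hence 1: "cm (cm (iv g) (iv w)) x \<in> gam H (Suc i + j)"
        using False s by (intro Suc.IH) auto
      have "cm w (iv x) \<in> gam H (i + j)"
        using False s Suc.prems subgrpD(3)[OF G] by (intro Suc.IH) auto
      hence 2: "cm (cm w (iv x)) (iv g) \<in> gam H (Suc (i + j))"
        using gam_cm_H[OF H] subgrpD(3)[OF H] s by blast
      let ?A = "cj (cm (cm x g) w) (iv g)" and ?B = "cj (cm (cm (iv g) (iv w)) x) w * cj (cm (cm w (iv x)) (iv g)) x"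
      have "?A * ?B = 1" using hall_witt[of x "iv g" w] by (simp add: mult.assoc)
      moreover have "?B \<in> gam H (i + Suc j)"
        using 1 2 gam_cj[OF H] wH xH G by (auto intro!: subgrpD(2))
      ultimately have "?A \<in> gam H (i + Suc j)"
        using subgrpD(3)[OF G] by (metis iv_unique iv_iv)
      hence "cj ?A g \<in> gam H (i + Suc j)" using gam_cj[OF H] s by blast
      hence "cm s w \<in> gam H (i + Suc j)" by (simp add: cj_cj s)
      thus "cm w s \<in> gam H (i + Suc j)" using subgrpD(3)[OF G] iv_cm by metis
    qed (use H gam_cj in auto)
  qed
qed simp

lemma gam_cm:
  assumes H: "subgrp H" and "w \<in> gam H i" "a \<in> gam H j" "k \<le> i + j"
  shows "cm w a \<in> gam H k"
proof -
  \<comment> \<open>Index 0 is a second name for index 1, so it can be raised to 1 before the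
    inductive version applies.\<close>
  have "gam H i = gam H (max 1 i)" for i by (simp add: gam_def max_def)
  hence "cm w a \<in> gam H (max 1 i + max 1 j)"
    using assms by (intro gam_cm_aux) auto
  thus ?thesis by (rule gam_antimono[OF H, rotated]) (use assms in auto)
qed

lemma gam_mono: "subgrp H0 \<Longrightarrow> H0 \<subseteq> H \<Longrightarrow> gam H0 i \<subseteq> gam H i"
proof -
  assume "subgrp H0" "H0 \<subseteq> H"
  have "lc H0 i \<subseteq> lc H i" for i
  proof (induction i)
    case (Suc i)
    have "{cm x g | x g. x \<in> lc H0 i \<and> g \<in> H0} \<subseteq> {cm x g | x g. x \<in> lc H i \<and> g \<in> H}"
      using Suc \<open>H0 \<subseteq> H\<close> by blast
    thus ?case unfolding lc.simps by (rule gen_mono)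
  qed (simp add: \<open>H0 \<subseteq> H\<close>)
  thus ?thesis by (simp add: gam_def)
qed

section \<open>Collection of powers and the elementary power inclusion\<close>

lemma choose_Suc_numerals:
  "Suc n choose 2 = n + (n choose 2)" "Suc n choose 3 = (n choose 2) + (n choose 3)"
  "Suc n choose 4 = (n choose 3) + (n choose 4)" "Suc n choose 5 = (n choose 4) + (n choose 5)"
  by (simp_all add: numeral_eq_Suc)

text \<open>The left side telescopes to the product of the conjugates of \<open>u\<close> by x^i for
  i < n, and such a conjugate is u d1^i d2^C(i,2) d3^C(i,3) d4^C(i,4). Collecting every
  \<open>u\<close> on the left creates \<open>f\<close> and \<open>g\<close>, and Pascal's rule adds
  up the exponents. The commutation hypotheses are those that hold for \<open>u\<close> in gamma_2
  when gamma_7 is trivial.\<close>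

lemma power_product_formula:
  fixes u x d1 d2 d3 d4 f g :: "'a::mult_group"
  assumes x: "cj u x = u * d1" "cj d1 x = d1 * d2" "cj d2 x = d2 * d3" "cj d3 x = d3 * d4" "cj d4 x = d4"
    and d: "d1 * d2 = d2 * d1" "d1 * d3 = d3 * d1" "d1 * d4 = d4 * d1" "d2 * d3 = d3 * d2"
      "d2 * d4 = d4 * d2" "d3 * d4 = d4 * d3"
    and f: "d1 * f = f * d1" "d2 * f = f * d2" "d3 * f = f * d3" "d4 * f = f * d4" "u * f = f * u"
    and g: "d1 * g = g * d1" "d2 * g = g * d2" "d3 * g = g * d3" "d4 * g = g * d4" "u * g = g * u" "f * g = g * f"
    and u: "cm d1 u = f" "cm d2 u = g" "d3 * u = u * d3" "d4 * u = u * d4"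
  shows "(u * iv x) ^ n * x ^ n =
    u ^ n * d1 ^ (n choose 2) * d2 ^ (n choose 3) * d3 ^ (n choose 4) * d4 ^ (n choose 5)
      * f ^ (n choose 3) * g ^ (n choose 4)"
proof -
  have sw: "b ^ j * (a ^ i * z) = a ^ i * (b ^ j * z)" "b ^ j * a ^ i = a ^ i * b ^ j"
    if "a * b = b * a" for a b z :: 'a and i j
  proof -
    show "b ^ j * a ^ i = a ^ i * b ^ j"
      using commute_power[of b "a ^ i" j] commute_power[of a b i] that by simp
    thus "b ^ j * (a ^ i * z) = a ^ i * (b ^ j * z)"
      by (simp add: mult.assoc[symmetric])
  qed
  have sw1: "b ^ j * (u * z) = u * (b ^ j * z)" "b ^ j * u = u * b ^ j" if "u * b = b * u" for b z j
    using sw[where a = u and b = b and i = 1] that by simp_all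
  have su: "b ^ j * u = u * (b ^ j * c ^ j)" "b ^ j * (u * z) = u * (b ^ j * (c ^ j * z))"
    if "cm b u = c" "b * c = c * b" for b c j z
  proof -
    have "cm (b ^ j) u = c ^ j" using that cm_power_left[of b u j] by simp
    moreover have "b ^ j * u = u * (b ^ j * cm (b ^ j) u)" by (simp add: cm_def mult.assoc)
    ultimately show 1: "b ^ j * u = u * (b ^ j * c ^ j)" by simp
    have "b ^ j * (u * z) = (b ^ j * u) * z" by (simp add: mult.assoc)
    thus "b ^ j * (u * z) = u * (b ^ j * (c ^ j * z))" unfolding 1 by (simp add: mult.assoc)
  qed
  have merge: "b ^ i * b ^ j = b ^ (i + j)" "b ^ i * (b ^ j * z) = b ^ (i + j) * z" for b z :: 'a and i j
    by (simp_all add: power_add mult.assoc)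
  \<comment> \<open>As rewrite rules these sort a product into the order \<open>u\<close>,
    \<open>d1\<close>, ..., \<open>d4\<close>, \<open>f\<close>, \<open>g\<close> and merge powers
    of equal base.\<close>
  note S = sw[OF d(1)] sw[OF d(2)] sw[OF d(3)] sw[OF d(4)] sw[OF d(5)] sw[OF d(6)]
    sw[OF f(1)] sw[OF f(2)] sw[OF f(3)] sw[OF f(4)] sw1[OF f(5)]
    sw[OF g(1)] sw[OF g(2)] sw[OF g(3)] sw[OF g(4)] sw1[OF g(5)] sw[OF g(6)]
    su[OF u(1) f(1)] su[OF u(2) g(2)] sw1[OF u(3)[symmetric]] sw1[OF u(4)[symmetric]] merge mult.assoc
  have xn: "cj u (x ^ n) = u * d1 ^ n * d2 ^ (n choose 2) * d3 ^ (n choose 3) * d4 ^ (n choose 4)" for n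
  proof (induction n)
    case (Suc n)
    have "cj u (x ^ Suc n) = cj (cj u (x ^ n)) x" by (simp add: cj_cj power_commutes)
    \<comment> \<open>The factor is written \<open>d1 ^ 1\<close> because the merging rules only
      recognise powers.\<close>
    also have "\<dots> = u * d1 ^ 1 * (d1 ^ n * d2 ^ n) * (d2 ^ (n choose 2) * d3 ^ (n choose 2)) *
        (d3 ^ (n choose 3) * d4 ^ (n choose 3)) * d4 ^ (n choose 4)"
      by (simp add: Suc cj_mult cj_power x power_mult_commute[OF d(1)] power_mult_commute[OF d(4)] power_mult_commute[OF d(6)])
    also have "\<dots> = u * d1 ^ (1 + n) * d2 ^ (n + (n choose 2)) * d3 ^ ((n choose 2) + (n choose 3))
        * d4 ^ ((n choose 3) + (n choose 4))"
      by (simp only: S)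
    finally show ?case by (simp only: choose_Suc_numerals plus_1_eq_Suc)
  qed (simp add: binomial_eq_0)
  show ?thesis
  proof (induction n)
    case (Suc n)
    have "(u * iv x) ^ Suc n * x ^ Suc n = (u * iv x) ^ n * (u * iv x) * (x * x ^ n)"
      by (simp only: power_Suc2[of "u * iv x"] power_Suc[of x])
    also have "\<dots> = ((u * iv x) ^ n * x ^ n) * cj u (x ^ n)"
      by (simp add: cj_def mult.assoc)
    also have "\<dots> = u ^ n * d1 ^ (n choose 2) * d2 ^ (n choose 3) * d3 ^ (n choose 4) * d4 ^ (n choose 5)
      * f ^ (n choose 3) * g ^ (n choose 4) * (u * d1 ^ n * d2 ^ (n choose 2) * d3 ^ (n choose 3) * d4 ^ (n choose 4))"
      unfolding Suc xn ..
    also have "\<dots> = u ^ n * u * d1 ^ ((n choose 2) + n) * d2 ^ ((n choose 3) + (n choose 2)) * d3 ^ ((n choose 4) + (n choose 3))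
       * d4 ^ ((n choose 5) + (n choose 4)) * f ^ ((n choose 2) + (n choose 3)) * g ^ ((n choose 3) + (n choose 4))"
      by (simp only: S)
    finally show ?case by (simp only: choose_Suc_numerals power_Suc2 ac_simps)
  qed (simp add: binomial_eq_0)
qed

text \<open>Oddness enters here: \<open>e\<close> divides C(e,2) and C(e,4), so that of the
  correction factors in the collection formula only those with exponents C(e,3) and C(e,5) can
  survive.\<close>

lemma dvd_choose_2: "odd (e::nat) \<Longrightarrow> e dvd e choose 2"
proof -
  assume "odd e"
  then obtain k where "e = 2 * k + 1" by (elim oddE)
  hence "e choose 2 = e * k" by (simp add: choose_two algebra_simps)
  thus ?thesis by simp
qed

lemma dvd_choose_4:
  assumes "odd (e::nat)" shows "e dvd e choose 4"
proof -
  have "e dvd 4 * (e choose 4)" using binomial_absorption[of 3 e] by simp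
  moreover have "coprime e (2 * 2)"
    using assms by (simp only: coprime_mult_right_iff coprime_right_2_iff_odd simp_thms)
  hence "coprime e 4" by simp
  ultimately show ?thesis by (simp add: coprime_dvd_mult_right_iff)
qed

lemma power_dvd_one: "a ^ e = 1 \<Longrightarrow> e dvd k \<Longrightarrow> a ^ k = (1::'a::monoid_mult)"
  by (auto simp: power_mult elim!: dvdE)

lemma gam_commute:
  assumes "subgrp H" "gam H n = {1}" "a \<in> gam H i" "b \<in> gam H j" "n \<le> i + j"
  shows "a * b = b * a"
  using gam_cm[OF assms(1,3,4,5)] assms(2) by (simp add: cm_eq_one_iff)

text \<open>For v = [u, a] with \<open>u\<close> in gamma_m the commutator d = [v, u^-1] has weight
  2m + 1 and commutes with both \<open>u\<close> and \<open>v\<close>. The collection formula then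
  leaves v^e d^C(e,2), and d^e = [v^e, u^-1] = 1 because v^e is central. The same formula makes the
  e-th power multiplicative on gamma_{m+1}.\<close>

lemma gam_power_eq_one:
  fixes H :: "'a::mult_group set"
  assumes H: "subgrp H" and central: "\<And>x y. x \<in> H \<Longrightarrow> y \<in> H \<Longrightarrow> x ^ e * y = y * x ^ e"
    and e: "odd e" and m: "m \<ge> 1" and triv: "gam H (3 * m + 1) = {1}" and v: "v \<in> gam H (m + 1)"
  shows "v ^ e = 1"
proof -
  note C = gam_commute[OF H triv]
  \<comment> \<open>The collection formula when \<open>u\<close> and \<open>v\<close> generate a
    group of class at most 2.\<close>
  have formula: "(v * iv u) ^ n * u ^ n = v ^ n * cm v u ^ (n choose 2)"
    if "cm v u * u = u * cm v u" "cm v u * v = v * cm v u" for u v :: 'a and n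
    using power_product_formula[of v u "cm v u" 1 1 1 1 1 n] that
    by (simp add: cj_eq_mult_cm cm_eq_one_iff[THEN iffD2])
  have "v \<in> gen {cm x g | x g. x \<in> gam H m \<and> g \<in> H}" using v m by (simp add: gam_Suc)
  hence "v \<in> gam H (m + 1) \<and> v ^ e = 1"
  proof induction
    case (gen_base v)
    then obtain u a where ua: "v = cm u a" "u \<in> gam H m" "a \<in> H" by auto
    have uH: "u \<in> H" using H gam_sub ua by blast
    have v: "v \<in> gam H (m + 1)" using H ua gam_cm_H by auto
    have iu: "iv u \<in> gam H m" using H ua subgrpD(3) subgrp_gam by blast
    let ?d = "cm v (iv u)"
    have d: "?d \<in> gam H (2 * m + 1)" by (rule gam_cm[OF H v iu]) simp
    have "(v * iv (iv u)) ^ e * iv u ^ e = v ^ e * ?d ^ (e choose 2)"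
      using C[OF d iu] C[OF d v] by (intro formula) auto
    \<comment> \<open>As v u is a conjugate of u and u^e is central, both have the same e-th
      power.\<close>
    moreover have "v * u = cj u (a * u)" by (simp add: ua cm_def cj_def mult.assoc)
    hence "(v * u) ^ e = cj (u ^ e) (a * u)" by (simp add: cj_power)
    hence "(v * u) ^ e = u ^ e"
      using central[OF uH subgrpD(2)[OF H ua(3) uH]] by (simp add: cj_eq_self_iff)
    ultimately have eq: "v ^ e * ?d ^ (e choose 2) = 1" by (simp add: iv_power[symmetric])
    have "?d ^ e = cm (v ^ e) (iv u)" using C[OF d v] by (subst cm_power_left) auto
    also have "\<dots> = 1"
      using central[of v "iv u"] v iu H gam_sub by (auto simp: cm_eq_one_iff)
    finally have "?d ^ (e choose 2) = 1" using dvd_choose_2[OF e] power_dvd_one by blast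
    thus ?case using eq v by simp
  next
    case (gen_mult a b)
    have mem: "a * b \<in> gam H (m + 1)" and ib: "iv b \<in> gam H (m + 1)" and d: "cm a (iv b) \<in> gam H (2 * m + 2)"
      using gen_mult H subgrpD[OF subgrp_gam[OF H]] gam_cm[OF H, of a "m+1" "iv b" "m+1" "2*m+2"] by auto
    let ?d = "cm a (iv b)"
    have c: "?d * a = a * ?d" "?d * iv b = iv b * ?d"
      using C[OF d, of a "m+1"] C[OF d, of "iv b" "m+1"] gen_mult ib by auto
    have "(a * iv (iv b)) ^ e * iv b ^ e = a ^ e * ?d ^ (e choose 2)"
      by (rule formula) (use c in auto)
    moreover have "?d ^ e = cm (a ^ e) (iv b)" using c by (subst cm_power_left) auto
    hence "?d ^ e = 1" using gen_mult by simp
    hence "?d ^ (e choose 2) = 1" using dvd_choose_2[OF e] power_dvd_one by blast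
    ultimately show ?case using gen_mult mem by (simp add: iv_power[symmetric])
  next
    case (gen_iv a)
    thus ?case using subgrpD[OF subgrp_gam[OF H]] by (auto simp: iv_power[symmetric])
  qed (use subgrpD(1)[OF subgrp_gam[OF H]] in auto)
  thus ?thesis by simp
qed

section \<open>Congruences between iterated commutators\<close>

definition eqm :: "'a::mult_group set \<Rightarrow> nat \<Rightarrow> 'a \<Rightarrow> 'a \<Rightarrow> bool" where
  "eqm H k a b \<longleftrightarrow> iv a * b \<in> gam H k"

abbreviation brk :: "'a::mult_group \<Rightarrow> 'a list \<Rightarrow> 'a" where
  "brk \<equiv> foldl cm"

lemma brk_1 [simp]: "brk 1 as = 1"
  by (induction as) auto

lemma eqm_alt: "eqm H k a b \<longleftrightarrow> (\<exists>t\<in>gam H k. b = a * t)"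
  unfolding eqm_def by (metis iv_left_assoc iv_right_assoc)

context
  fixes H :: "'a::mult_group set"
  assumes H: "subgrp H"
begin

lemmas gam_1 = subgrpD(1)[OF subgrp_gam[OF H]]
  and gam_mult = subgrpD(2)[OF subgrp_gam[OF H]]
  and gam_iv = subgrpD(3)[OF subgrp_gam[OF H]]

lemma eqm_refl: "eqm H k a a"
  by (simp add: eqm_def gam_1)

lemma eqm_trans: "eqm H k a b \<Longrightarrow> eqm H k b c \<Longrightarrow> eqm H k a c"
  using gam_mult[of "iv a * b" k "iv b * c"] by (simp add: eqm_def mult.assoc)

lemma eqm_sym: "eqm H k a b \<Longrightarrow> eqm H k b a"
  using gam_iv[of "iv a * b" k] by (simp add: eqm_def)

lemma eqm_antimono: "eqm H k a b \<Longrightarrow> j \<le> k \<Longrightarrow> eqm H j a b"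
  unfolding eqm_def using gam_antimono[OF H] by blast

lemma eqm_mult:
  assumes "eqm H k a b" "eqm H k c d" "c \<in> H"
  shows "eqm H k (a * c) (b * d)"
proof -
  have "iv (a * c) * (b * d) = cj (iv a * b) c * (iv c * d)" by (simp add: cj_def mult.assoc)
  thus ?thesis using assms gam_mult gam_cj[OF H] by (simp add: eqm_def)
qed

lemma brk_mem: "w \<in> gam H i \<Longrightarrow> set as \<subseteq> H \<Longrightarrow> brk w as \<in> gam H (i + length as)"
proof (induction as arbitrary: w i)
  case (Cons a as)
  thus ?case using gam_cm_H[OF H, of w i a] Cons.IH[of "cm w a" "Suc i"] by simp
qed simp

text \<open>Each commutator with an element of \<open>H\<close> sharpens a congruence by one weight,
  because [wt, a] = [w, a] [w, a, t] [t, a].\<close>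

lemma eqm_cm:
  assumes "eqm H k w w'" "w \<in> H" "a \<in> H"
  shows "eqm H (Suc k) (cm w a) (cm w' a)"
proof -
  from assms obtain t where t: "t \<in> gam H k" "w' = w * t" by (auto simp: eqm_alt)
  have "cm w' a = cm w a * (cm (cm w a) t * cm t a)"
    by (simp add: t cm_def mult.assoc)
  moreover have "cm (cm w a) t \<in> gam H (Suc k)"
    using gam_cm[OF H gam_cm[OF H, of w 1 a 1 2] t(1)] assms by auto
  ultimately show ?thesis using gam_mult gam_cm_H[OF H t(1) assms(3)] by (auto simp: eqm_alt)
qed

lemma eqm_brk:
  "eqm H k w w' \<Longrightarrow> w \<in> H \<Longrightarrow> w' \<in> H \<Longrightarrow> set as \<subseteq> H \<Longrightarrow> eqm H (k + length as) (brk w as) (brk w' as)"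
proof (induction as arbitrary: w w' k)
  case (Cons a as)
  thus ?case using eqm_cm[of k w w' a] Cons.IH[of "Suc k" "cm w a" "cm w' a"] subgrp_cm[OF H] by simp
qed simp

lemma eqm_cm_mult_left:
  assumes "v \<in> gam H i" "w \<in> gam H i" "a \<in> H" "i \<ge> 1"
  shows "eqm H (Suc (Suc i)) (cm (v * w) a) (cm v a * cm w a)"
proof -
  have va: "cm v a \<in> gam H (Suc i)" using gam_cm_H[OF H assms(1,3)] .
  have wa: "cm w a \<in> H" using assms gam_sub[OF H] subgrp_cm[OF H] by blast
  have "cm (cm v a) w \<in> gam H (Suc (Suc i))"
    by (rule gam_cm[OF H va assms(2)]) (use assms in simp)
  hence "eqm H (Suc (Suc i)) (cm v a) (cj (cm v a) w)" by (auto simp: eqm_alt cj_eq_mult_cm)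
  from eqm_mult[OF eqm_sym[OF this] eqm_refl wa] show ?thesis by (simp only: cm_mult_left_cj)
qed

lemma eqm_cm_mult_right:
  assumes "v \<in> gam H i" "a \<in> H" "b \<in> H" "i \<ge> 1"
  shows "eqm H (Suc (Suc i)) (cm v (a * b)) (cm v a * cm v b)"
proof -
  have va: "cm v a \<in> gam H (Suc i)" and vb: "cm v b \<in> gam H (Suc i)"
    using gam_cm_H[OF H] assms by auto
  have "cm (cm v a) b \<in> gam H (Suc (Suc i))" using gam_cm_H[OF H va assms(3)] .
  moreover have "cm (cm v b) (cm v a) \<in> gam H (Suc (Suc i))"
    by (rule gam_cm[OF H vb va]) simp
  moreover have "cm v (a * b) = cm v a * cm v b * (cm (cm v b) (cm v a) * cm (cm v a) b)"
    by (simp add: cm_def mult.assoc)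
  ultimately have "eqm H (Suc (Suc i)) (cm v a * cm v b) (cm v (a * b))"
    using gam_mult by (auto simp: eqm_alt)
  thus ?thesis by (rule eqm_sym)
qed

lemma eqm_brk_mult_left:
  "v \<in> gam H i \<Longrightarrow> w \<in> gam H i \<Longrightarrow> i \<ge> 1 \<Longrightarrow> set as \<subseteq> H \<Longrightarrow>
   eqm H (Suc (i + length as)) (brk (v * w) as) (brk v as * brk w as)"
proof (induction as arbitrary: v w i)
  case Nil
  show ?case by (simp add: eqm_refl)
next
  case (Cons a as)
  have va: "cm v a \<in> gam H (Suc i)" and wa: "cm w a \<in> gam H (Suc i)"
    using gam_cm_H[OF H] Cons.prems by auto
  have m: "v \<in> H" "w \<in> H" "a \<in> H" "cm v a \<in> H" "cm w a \<in> H" and as: "set as \<subseteq> H"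
    using Cons.prems gam_sub[OF H] va wa by auto
  have "eqm H (Suc (Suc i) + length as) (brk (cm (v * w) a) as) (brk (cm v a * cm w a) as)"
    by (rule eqm_brk[OF eqm_cm_mult_left[OF Cons.prems(1,2) m(3) Cons.prems(3)]
          subgrp_cm[OF H subgrpD(2)[OF H m(1,2)] m(3)] subgrpD(2)[OF H m(4,5)] as])
  from eqm_trans[OF this, of "brk (cm v a) as * brk (cm w a) as"] Cons.IH[OF va wa _ as]
  show ?case by simp
qed

text \<open>The modulus is one more than the weight \<open>i + length as + 1 + length bs\<close> of
  the bracket: brackets are additive in every entry up to terms of higher weight.\<close>

lemma eqm_brk_mult:
  assumes "v \<in> gam H i" "i \<ge> 1" "set as \<subseteq> H" "set bs \<subseteq> H" "a \<in> H" "b \<in> H"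
  shows "eqm H (Suc (Suc (i + length as + length bs))) (brk v (as @ a * b # bs))
           (brk v (as @ a # bs) * brk v (as @ b # bs))"
proof -
  let ?v = "brk v as" and ?i = "i + length as"
  have v: "?v \<in> gam H ?i" using assms brk_mem by blast
  have vH: "?v \<in> H" using v gam_sub[OF H] by blast
  have i: "1 \<le> ?i" "1 \<le> Suc ?i" using assms by auto
  have ab: "a * b \<in> H" using assms subgrpD(2)[OF H] by blast
  have m: "cm ?v a \<in> H" "cm ?v b \<in> H" using assms vH subgrp_cm[OF H] by blast+
  have "eqm H (Suc (Suc ?i) + length bs) (brk (cm ?v (a * b)) bs) (brk (cm ?v a * cm ?v b) bs)"
    by (rule eqm_brk[OF eqm_cm_mult_right[OF v assms(5,6) i(1)]
          subgrp_cm[OF H vH ab] subgrpD(2)[OF H m] assms(4)])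
  moreover have "eqm H (Suc (Suc ?i + length bs)) (brk (cm ?v a * cm ?v b) bs) (brk (cm ?v a) bs * brk (cm ?v b) bs)"
    by (rule eqm_brk_mult_left[OF gam_cm_H[OF H v assms(5)] gam_cm_H[OF H v assms(6)] i(2) assms(4)])
  ultimately show ?thesis
    using eqm_trans[of "Suc (Suc (?i + length bs))" "brk (cm ?v (a * b)) bs"] by simp
qed

section \<open>Exact multilinearity of brackets of the highest weight\<close>

context
  fixes n :: nat
  assumes triv: "gam H n = {1}"
begin

lemma eqm_top: "eqm H k a b \<Longrightarrow> n \<le> k \<Longrightarrow> a = b"
  using eqm_antimono[of k a b n] triv by (simp add: eqm_def eq_iff_iv_mult[symmetric])

lemma brk_cong:
  assumes "eqm H k w w'" "w \<in> H" "w' \<in> H" "set as \<subseteq> H" "n \<le> k + length as"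
  shows "brk w as = brk w' as"
  using eqm_top[OF eqm_brk[OF assms(1-4)]] assms by simp

lemma brk_mult_left:
  assumes "v \<in> gam H i" "w \<in> gam H i" "set as \<subseteq> H" "i \<ge> 1" "n \<le> Suc (i + length as)"
  shows "brk (v * w) as = brk v as * brk w as"
  using eqm_top[OF eqm_brk_mult_left] assms by blast

lemma brk_iv_left:
  assumes "v \<in> gam H i" "set as \<subseteq> H" "i \<ge> 1" "n \<le> Suc (i + length as)"
  shows "brk (iv v) as = iv (brk v as)"
proof -
  have "brk (v * iv v) as = brk v as * brk (iv v) as"
    by (rule brk_mult_left) (use assms gam_iv in auto)
  hence "brk v as * brk (iv v) as = 1" by simp
  thus ?thesis using iv_unique by metis
qed

lemma brk_mult:
  assumes "v \<in> gam H i" "set as \<subseteq> H" "set bs \<subseteq> H" "a \<in> H" "b \<in> H" "i \<ge> 1"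
    "n \<le> Suc (Suc (i + length as + length bs))"
  shows "brk v (as @ a * b # bs) = brk v (as @ a # bs) * brk v (as @ b # bs)"
  using eqm_top[OF eqm_brk_mult] assms by blast

lemma brk_one: "brk v (as @ 1 # bs) = (1::'a)"
  by simp

lemma brk_iv:
  assumes "v \<in> gam H i" "set as \<subseteq> H" "set bs \<subseteq> H" "a \<in> H" "i \<ge> 1"
    "n \<le> Suc (Suc (i + length as + length bs))"
  shows "brk v (as @ iv a # bs) = iv (brk v (as @ a # bs))"
proof -
  have "brk v (as @ (a * iv a) # bs) = brk v (as @ a # bs) * brk v (as @ iv a # bs)"
    by (rule brk_mult) (use assms subgrpD[OF H] in auto)
  hence "brk v (as @ a # bs) * brk v (as @ iv a # bs) = 1" by (simp only: iv_right brk_one)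
  thus ?thesis using iv_unique by metis
qed

lemma brk_power:
  assumes "v \<in> gam H i" "set as \<subseteq> H" "set bs \<subseteq> H" "a \<in> H" "b \<in> H" "i \<ge> 1"
    "n \<le> Suc (Suc (i + length as + length bs))"
  shows "brk v (as @ (a * b ^ k) # bs) = brk v (as @ a # bs) * brk v (as @ b # bs) ^ k"
proof (induction k)
  case (Suc k)
  have "a * b ^ Suc k = a * b ^ k * b" by (simp only: power_Suc2 mult.assoc)
  moreover have "brk v (as @ (a * b ^ k * b) # bs) = brk v (as @ (a * b ^ k) # bs) * brk v (as @ b # bs)"
    by (rule brk_mult) (use assms subgrpD[OF H] subgrp_power[OF H] in auto)
  ultimately show ?case using Suc by (simp only: power_Suc2 mult.assoc)
qed simp

end

end

text \<open>Polynomial sequences in an abelian group \<open>A\<close>: \<open>poly_seq A d l f\<close> says that the \<open>d\<close>-th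
  difference of \<open>f\<close> is constantly \<open>l\<close>.\<close>

primrec poly_seq :: "'a::mult_group set \<Rightarrow> nat \<Rightarrow> 'a \<Rightarrow> (nat \<Rightarrow> 'a) \<Rightarrow> bool" where
  "poly_seq A 0 l f \<longleftrightarrow> l \<in> A \<and> (\<forall>k. f k = l)"
| "poly_seq A (Suc d) l f \<longleftrightarrow> (\<forall>k. f k \<in> A) \<and> (\<exists>g. poly_seq A d l g \<and> (\<forall>k. f (Suc k) = f k * g k))"

lemma poly_seq_unique: "poly_seq A d l f \<Longrightarrow> poly_seq A d m f \<Longrightarrow> l = m"
proof (induction d arbitrary: f)
  case (Suc d)
  then obtain g h where "poly_seq A d l g" "poly_seq A d m h" "\<And>k. f k * g k = f k * h k"
    by fastforce
  moreover from this have "g = h" by auto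
  ultimately show ?case using Suc.IH by blast
qed auto

context
  fixes A :: "'a::mult_group set"
  assumes A: "subgrp A" and comm: "\<And>a b. a \<in> A \<Longrightarrow> b \<in> A \<Longrightarrow> a * b = b * a"
begin

lemma poly_seq_mem: "poly_seq A d l f \<Longrightarrow> f k \<in> A"
  by (cases d) auto

lemma poly_seq_mult:
  "poly_seq A d l f \<Longrightarrow> poly_seq A d m g \<Longrightarrow> poly_seq A d (l * m) (\<lambda>k. f k * g k)"
proof (induction d arbitrary: f g)
  case (Suc d)
  then obtain f' g' where f': "poly_seq A d l f'" "\<And>k. f (Suc k) = f k * f' k"
    and g': "poly_seq A d m g'" "\<And>k. g (Suc k) = g k * g' k" by auto
  have "f (Suc k) * g (Suc k) = f k * g k * (f' k * g' k)" for k
  proof -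
    have "f (Suc k) * g (Suc k) = f k * (f' k * g k) * g' k" by (simp add: f' g' mult.assoc)
    also have "f' k * g k = g k * f' k" using comm poly_seq_mem[OF f'(1)] Suc.prems(2) by auto
    finally show ?thesis by (simp add: mult.assoc)
  qed
  moreover have "f k * g k \<in> A" for k using Suc.prems subgrpD[OF A] by auto
  ultimately show ?case using Suc.IH[OF f'(1) g'(1)] by auto
qed (auto intro: subgrpD[OF A])

lemma poly_seq_raise: "poly_seq A d l f \<Longrightarrow> poly_seq A (Suc d) 1 f"
proof (induction d arbitrary: f)
  case 0
  have "poly_seq A 0 1 (\<lambda>_. 1)" using subgrpD[OF A] by simp
  thus ?case using 0 by auto
next
  case (Suc d)
  then obtain g where "poly_seq A d l g" "\<And>k. f (Suc k) = f k * g k" by auto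
  thus ?case using Suc.IH[of g] Suc.prems by auto
qed

text \<open>A discrete product rule. Written additively, the difference of k f(k) is f(k) + g(k) + k
  g(k), where g is the difference of f. The first summand has leading difference \<open>l\<close>,
  the last one is covered by induction, and the middle one has smaller degree.\<close>

lemma poly_seq_power: "poly_seq A d l f \<Longrightarrow> poly_seq A (Suc d) (l ^ Suc d) (\<lambda>k. f k ^ k)"
proof (induction d arbitrary: f)
  case 0
  thus ?case using subgrp_power[OF A, of l] by (auto intro!: exI[of _ f] simp: power_commutes)
next
  case (Suc d)
  then obtain g where g: "poly_seq A d l g" "\<And>k. f (Suc k) = f k * g k" by auto
  have p: "poly_seq A (Suc d) (l * (1 * l ^ Suc d)) (\<lambda>k. f k * (g k * g k ^ k))"
    by (rule poly_seq_mult[OF Suc.prems poly_seq_mult[OF poly_seq_raise[OF g(1)] Suc.IH[OF g(1)]]])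
  moreover have "f (Suc k) ^ Suc k = f k ^ k * (f k * (g k * g k ^ k))" for k
  proof -
    have "f k * g k = g k * f k" using comm poly_seq_mem[OF g(1)] Suc.prems by auto
    hence "(f k * g k) ^ Suc k = f k ^ Suc k * g k ^ Suc k" by (rule power_mult_commute)
    thus ?thesis by (simp only: g power_Suc2[of "f k"] power_Suc[of "g k"] mult.assoc)
  qed
  moreover have "f k ^ k \<in> A" for k using Suc.prems subgrp_power[OF A] by auto
  ultimately show ?case
    unfolding poly_seq.simps(2)[of A "Suc d"] power_Suc[of l "Suc d"] using p
    by (intro conjI allI exI[of _ "\<lambda>k. f k * (g k * g k ^ k)"]) (simp_all only: mult_1_left)
qed

lemma poly_seq_step:
  "poly_seq A d m g \<Longrightarrow> poly_seq A d l h \<Longrightarrow> poly_seq A (Suc d) (l ^ Suc d) (\<lambda>k. g k * h k ^ k)"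
  using poly_seq_mult[OF poly_seq_raise poly_seq_power, of d m g l h] by simp

lemma poly_seq_const: "a \<in> A \<Longrightarrow> poly_seq A (Suc d) 1 (\<lambda>_. a)"
proof (induction d arbitrary: a)
  case 0
  thus ?case using subgrpD[OF A] by auto
next
  case (Suc d)
  show ?case unfolding poly_seq.simps(2)[of A "Suc d"]
    using Suc.IH[of 1] Suc.prems subgrpD[OF A] by (intro conjI exI[of _ "\<lambda>_. 1"]) simp_all
qed

text \<open>Each slot is affine in \<open>k\<close> along \<open>z k\<close>, so that filling one
  more slot with \<open>z k\<close> raises the degree by one. The diagonal has degree 4, and its
  fourth difference is the 4!-th power of \<open>F y y y y\<close>; for a constant sequence this
  difference is trivial.\<close>

lemma multilinear4_constant_diagonal:
  fixes F :: "'a \<Rightarrow> 'a \<Rightarrow> 'a \<Rightarrow> 'a \<Rightarrow> 'a"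
  assumes x: "x \<in> H" and y: "y \<in> H" and z: "\<And>k. z k \<in> H"
    and mem: "\<And>a b c d. a \<in> H \<Longrightarrow> b \<in> H \<Longrightarrow> c \<in> H \<Longrightarrow> d \<in> H \<Longrightarrow> F a b c d \<in> A"
    and lin: "\<And>k a b c. a \<in> H \<Longrightarrow> b \<in> H \<Longrightarrow> c \<in> H \<Longrightarrow> F (z k) a b c = F x a b c * F y a b c ^ k"
      "\<And>k a b c. a \<in> H \<Longrightarrow> b \<in> H \<Longrightarrow> c \<in> H \<Longrightarrow> F a (z k) b c = F a x b c * F a y b c ^ k"
      "\<And>k a b c. a \<in> H \<Longrightarrow> b \<in> H \<Longrightarrow> c \<in> H \<Longrightarrow> F a b (z k) c = F a b x c * F a b y c ^ k"
      "\<And>k a b c. a \<in> H \<Longrightarrow> b \<in> H \<Longrightarrow> c \<in> H \<Longrightarrow> F a b c (z k) = F a b c x * F a b c y ^ k"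
    and const: "\<And>k. F (z k) (z k) (z k) (z k) = s"
  shows "F y y y y ^ 24 = 1"
proof -
  have 1: "poly_seq A (Suc 0) (F a b c y ^ Suc 0) (\<lambda>k. F a b c (z k))"
    if m: "a \<in> H" "b \<in> H" "c \<in> H" for a b c
    unfolding lin(4)[OF m] by (rule poly_seq_step[where m = "F a b c x"]) (simp_all add: mem m x y)
  have 2: "poly_seq A (Suc (Suc 0)) ((F a b y y ^ Suc 0) ^ Suc (Suc 0)) (\<lambda>k. F a b (z k) (z k))"
    if m: "a \<in> H" "b \<in> H" for a b
    unfolding lin(3)[OF m z] by (rule poly_seq_step[OF 1 1]) (simp_all add: m x y)
  have 3: "poly_seq A (Suc (Suc (Suc 0))) (((F a y y y ^ Suc 0) ^ Suc (Suc 0)) ^ Suc (Suc (Suc 0)))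
      (\<lambda>k. F a (z k) (z k) (z k))" if m: "a \<in> H" for a
    unfolding lin(2)[OF m z z] by (rule poly_seq_step[OF 2 2]) (simp_all add: m x y)
  have 4: "poly_seq A (Suc (Suc (Suc (Suc 0))))
      ((((F y y y y ^ Suc 0) ^ Suc (Suc 0)) ^ Suc (Suc (Suc 0))) ^ Suc (Suc (Suc (Suc 0))))
      (\<lambda>k. F (z k) (z k) (z k) (z k))"
    unfolding lin(1)[OF z z z] by (rule poly_seq_step[OF 3 3]) (simp_all add: x y)
  have "poly_seq A (Suc (Suc (Suc (Suc 0)))) 1 (\<lambda>k. F (z k) (z k) (z k) (z k))"
    unfolding const by (rule poly_seq_const) (use mem[OF z z z z, of 0 0 0 0] const in simp)
  from poly_seq_unique[OF 4 this] show ?thesis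
    by (simp only: power_mult[symmetric]) (simp add: numeral_eq_Suc)
qed

end

section \<open>Groups of class at most 6 with central powers\<close>

text \<open>The class is chosen with 7 = 3m + 1 for m = 2: the elementary inclusion then makes the
  e-th powers of gamma_3 trivial, and only those of gamma_2 remain.\<close>

locale class_six =
  fixes H :: "'a::mult_group set" and e :: nat
  assumes H: "subgrp H"
    and central: "\<And>x y. x \<in> H \<Longrightarrow> y \<in> H \<Longrightarrow> x ^ e * y = y * x ^ e"
    and e: "odd e"
    and triv: "gam H 7 = {1}"
begin

abbreviation "q \<equiv> e choose 3"
abbreviation "r \<equiv> e choose 5"

lemmas sub = gam_sub[OF H] and cm_H = subgrp_cm[OF H]
  and Hmult = subgrpD(2)[OF H] and Hiv = subgrpD(3)[OF H]
  and commute = gam_commute[OF H triv]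
  and gam1 = gam_1[OF H] and gammult = gam_mult[OF H] and gamiv = gam_iv[OF H]

lemma gam_le: "v \<in> gam H j \<Longrightarrow> i \<le> j \<Longrightarrow> v \<in> gam H i"
  using gam_antimono[OF H] by blast

lemma exponent_gam_3: "v \<in> gam H 3 \<Longrightarrow> v ^ e = 1"
  using gam_power_eq_one[OF H central e, of 2 v] triv by simp

text \<open>This is the source of the primes 3 and 5: 3 C(e,3) = e C(e-1,2) and 5 C(e,5) = e
  C(e-1,4), so on gamma_3 the powers with exponents \<open>q\<close> and \<open>r\<close> have
  orders dividing 3 and 5.\<close>

lemma cube_kills: "v \<in> gam H 3 \<Longrightarrow> v ^ (q * 3) = 1"
  using power_dvd_one[OF exponent_gam_3] binomial_absorption[of 2 e] by (simp add: mult.commute)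

lemma fifth_kills: "v \<in> gam H 3 \<Longrightarrow> v ^ (r * 5) = 1"
  using power_dvd_one[OF exponent_gam_3] binomial_absorption[of 4 e] by (simp add: mult.commute)

lemma power_formula:
  assumes u: "u \<in> gam H 2" and x: "x \<in> H"
  shows "(u * iv x) ^ e * x ^ e =
    u ^ e * brk u [x, x] ^ q * brk u [x, x, x, x] ^ r * cm (cm u x) u ^ q"
proof -
  define d1 where "d1 = cm u x"
  define d2 where "d2 = cm d1 x"
  define d3 where "d3 = cm d2 x"
  define d4 where "d4 = cm d3 x"
  define f where "f = cm d1 u"
  define g where "g = cm d2 u"
  have d1: "d1 \<in> gam H 3" unfolding d1_def by (rule gam_cm[OF H u, of x 1]) (use x in auto)
  have d2: "d2 \<in> gam H 4" unfolding d2_def by (rule gam_cm[OF H d1, of x 1]) (use x in auto)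
  have d3: "d3 \<in> gam H 5" unfolding d3_def by (rule gam_cm[OF H d2, of x 1]) (use x in auto)
  have d4: "d4 \<in> gam H 6" unfolding d4_def by (rule gam_cm[OF H d3, of x 1]) (use x in auto)
  have f: "f \<in> gam H 5" unfolding f_def by (rule gam_cm[OF H d1 u]) simp
  have g: "g \<in> gam H 6" unfolding g_def by (rule gam_cm[OF H d2 u]) simp
  have x1: "x \<in> gam H 1" using x by simp
  have cj: "cj u x = u * d1" "cj d1 x = d1 * d2" "cj d2 x = d2 * d3" "cj d3 x = d3 * d4"
    by (simp_all add: cj_eq_mult_cm d1_def d2_def d3_def d4_def)
  have cj4: "cj d4 x = d4" using commute[OF d4 x1] by (simp add: cj_eq_self_iff)
  have "(u * iv x) ^ e * x ^ e =
    u ^ e * d1 ^ (e choose 2) * d2 ^ q * d3 ^ (e choose 4) * d4 ^ r * f ^ q * g ^ (e choose 4)"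
    by (rule power_product_formula[OF cj cj4])
      (use commute[OF d1 d2] commute[OF d1 d3] commute[OF d1 d4] commute[OF d2 d3] commute[OF d2 d4]
        commute[OF d3 d4] commute[OF d1 f] commute[OF d2 f] commute[OF d3 f] commute[OF d4 f]
        commute[OF u f] commute[OF d1 g] commute[OF d2 g] commute[OF d3 g] commute[OF d4 g]
        commute[OF u g] commute[OF f g] commute[OF d3 u] commute[OF d4 u]
        f_def g_def in simp_all)
  moreover have "d1 ^ (e choose 2) = 1" "d3 ^ (e choose 4) = 1" "g ^ (e choose 4) = 1"
    using power_dvd_one[OF exponent_gam_3] dvd_choose_2[OF e] dvd_choose_4[OF e] d1
      gam_le[OF d3, of 3] gam_le[OF g, of 3] by auto
  ultimately show ?thesis by (simp add: d4_def d3_def d2_def d1_def f_def)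
qed

lemma power_cm:
  assumes x: "x \<in> H" and y: "y \<in> H"
  defines "u \<equiv> cm y x"
  shows "u ^ e * brk u [x, x] ^ q * brk u [x, x, x, x] ^ r * cm (cm u x) u ^ q = 1"
proof -
  have u: "u \<in> gam H 2" unfolding u_def by (rule gam_cm[OF H, of y 1 x 1]) (use x y in auto)
  \<comment> \<open>The element u x^-1 is a conjugate of x^-1, so its e-th power is x^-e and the
    left side of the collection formula is trivial.\<close>
  have "u * iv x = cj (iv x) y * 1"
    by (simp add: u_def cm_def cj_def mult.assoc)
  hence "(u * iv x) ^ e = cj (iv (x ^ e)) y" by (simp add: cj_power iv_power)
  also have "\<dots> = iv (x ^ e)"
    using central[OF x y] by (simp add: cj_eq_self_iff commute_iv_left)
  finally show ?thesis using power_formula[OF u x] by simp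
qed

text \<open>The sixth power of the identity \<open>power_cm\<close> separates the primes: 6 is 0
  modulo 3, which removes the factors with exponent \<open>q\<close>, and 1 modulo 5, which keeps
  the factor with exponent \<open>r\<close>.\<close>

lemma brk_cm_power_r:
  assumes x: "x \<in> H" and y: "y \<in> H"
  shows "brk (cm y x) [x, x, x, x] ^ r = iv (cm y x ^ e) ^ 6"
proof -
  let ?u = "cm y x"
  let ?a = "?u ^ e" and ?b = "brk ?u [x, x] ^ q" and ?c = "brk ?u [x, x, x, x] ^ r" and ?f = "cm (cm ?u x) ?u ^ q"
  have u: "?u \<in> gam H 2" by (rule gam_cm[OF H, of y 1 x 1]) (use x y in auto)
  have m: "brk ?u [x, x] \<in> gam H 4" "brk ?u [x, x, x, x] \<in> gam H 6" "cm ?u x \<in> gam H 3"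
    using brk_mem[OF H u, of "[x, x]"] brk_mem[OF H u, of "[x, x, x, x]"] brk_mem[OF H u, of "[x]"] x by simp_all
  have fm: "cm (cm ?u x) ?u \<in> gam H 5" by (rule gam_cm[OF H m(3) u]) simp
  have mq: "?b \<in> gam H 4" "?c \<in> gam H 6" "?f \<in> gam H 5"
    using m fm subgrp_power[OF subgrp_gam[OF H]] by blast+
  have uH: "?u \<in> H" using u sub by blast
  have c: "?a * ?b = ?b * ?a" "?a * ?b * ?c = ?c * (?a * ?b)" "?a * ?b * ?c * ?f = ?f * (?a * ?b * ?c)"
  proof -
    have a: "?a * z = z * ?a" if "z \<in> gam H i" for z i using central[OF uH] that sub by blast
    show 1: "?a * ?b = ?b * ?a" using a[OF mq(1)] .
    have bc: "?b * ?c = ?c * ?b" and bf: "?b * ?f = ?f * ?b" and cf: "?c * ?f = ?f * ?c"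
      using commute[OF mq(1,2)] commute[OF mq(1,3)] commute[OF mq(2,3)] by simp_all
    have "?a * ?b * ?c = ?a * ?c * ?b" by (simp only: bc mult.assoc)
    thus 2: "?a * ?b * ?c = ?c * (?a * ?b)" by (simp only: a[OF mq(2)] mult.assoc)
    have "?a * ?b * ?c * ?f = ?a * ?b * (?f * ?c)" by (simp only: cf mult.assoc)
    also have "\<dots> = ?a * (?b * ?f) * ?c" by (simp only: mult.assoc)
    also have "\<dots> = (?a * ?f) * ?b * ?c" unfolding bf by (simp only: mult.assoc)
    finally show "?a * ?b * ?c * ?f = ?f * (?a * ?b * ?c)" by (simp only: a[OF mq(3)] mult.assoc)
  qed
  have "(?a * ?b * ?c * ?f) ^ 6 = ?a ^ 6 * ?b ^ 6 * ?c ^ 6 * ?f ^ 6"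
    by (simp only: power_mult_commute[OF c(1)] power_mult_commute[OF c(2)] power_mult_commute[OF c(3)])
  moreover have k6: "(v ^ q) ^ 6 = 1" if "v \<in> gam H i" "3 \<le> i" for v i
  proof -
    have "(v ^ q) ^ 6 = (v ^ (q * 3)) ^ 2" by (simp add: power_mult[symmetric] mult.commute)
    thus ?thesis using cube_kills[OF gam_le[OF that]] by simp
  qed
  have "?b ^ 6 = 1" "?f ^ 6 = 1" using k6[OF m(1)] k6[OF fm] by auto
  moreover have "?c ^ 6 = ?c"
  proof -
    have "?c ^ 6 = ?c ^ 5 * ?c" by (simp add: numeral_eq_Suc mult.assoc)
    also have "?c ^ 5 = brk ?u [x, x, x, x] ^ (r * 5)" by (simp only: power_mult)
    also have "\<dots> = 1" using fifth_kills[OF gam_le[OF m(2)]] by simp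
    finally show ?thesis by simp
  qed
  ultimately have "?a ^ 6 * ?c = 1" using power_cm[OF x y] by simp
  hence "?c = iv (?a ^ 6)" using iv_unique by metis
  thus ?thesis by (simp only: iv_power)
qed

lemma brk_cm_power_r_eq_one:
  assumes x: "x \<in> H" and y: "y \<in> H"
  shows "brk (cm y x) [x, x, x, x] ^ r = 1"
proof -
  have main: "brk (cm y x) [y, y, y, y] ^ r = 1" if x: "x \<in> H" and y: "y \<in> H" for x y
  proof -
    let ?u = "cm y x"
    define F where "F a b c d = brk ?u [a, b, c, d] ^ r" for a b c d
    have u: "?u \<in> gam H 2" by (rule gam_cm[OF H, of y 1 x 1]) (use x y in auto)
    have m: "brk ?u [a, b, c, d] \<in> gam H 6" if "a \<in> H" "b \<in> H" "c \<in> H" "d \<in> H" for a b c d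
      using brk_mem[OF H u, of "[a, b, c, d]"] that by simp
    have comm: "a * b = b * a" if "a \<in> gam H 6" "b \<in> gam H 6" for a b
      using commute[OF that] by simp
    have lin: "(a * b ^ k) ^ r = a ^ r * (b ^ r) ^ k" if "a \<in> gam H 6" "b \<in> gam H 6" for a b k
    proof -
      have "b ^ k \<in> gam H 6" using that subgrp_power[OF subgrp_gam[OF H]] by blast
      hence "(a * b ^ k) ^ r = a ^ r * (b ^ k) ^ r" by (intro power_mult_commute comm that)
      thus ?thesis by (simp only: power_mult[symmetric] mult.commute)
    qed
    let ?z = "\<lambda>k. x * y ^ k"
    have z: "?z k \<in> H" for k using x y Hmult subgrp_power[OF H] by blast
    have "F y y y y ^ 24 = 1"
    proof (rule multilinear4_constant_diagonal[of "gam H 6" x H y ?z F])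
      fix a b c d assume abcd: "a \<in> H" "b \<in> H" "c \<in> H" "d \<in> H"
      show "F a b c d \<in> gam H 6"
        unfolding F_def by (rule subgrp_power[OF subgrp_gam[OF H] m[OF abcd]])
    next
      fix k a b c assume abc: "a \<in> H" "b \<in> H" "c \<in> H"
      note L = brk_power[OF H triv u _ _ x y, of "[]" "[a, b, c]"] brk_power[OF H triv u _ _ x y, of "[a]" "[b, c]"]
        brk_power[OF H triv u _ _ x y, of "[a, b]" "[c]"] brk_power[OF H triv u _ _ x y, of "[a, b, c]" "[]"]
      show "F (?z k) a b c = F x a b c * F y a b c ^ k"
        using L(1)[of k] abc lin[OF m[OF x abc] m[OF y abc]] by (simp add: F_def)
      show "F a (?z k) b c = F a x b c * F a y b c ^ k"
        using L(2)[of k] abc lin[OF m[OF abc(1) x abc(2,3)] m[OF abc(1) y abc(2,3)]] by (simp add: F_def)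
      show "F a b (?z k) c = F a b x c * F a b y c ^ k"
        using L(3)[of k] abc lin[OF m[OF abc(1,2) x abc(3)] m[OF abc(1,2) y abc(3)]] by (simp add: F_def)
      show "F a b c (?z k) = F a b c x * F a b c y ^ k"
        using L(4)[of k] abc lin[OF m[OF abc x] m[OF abc y]] by (simp add: F_def)
    next
      fix k
      have yk: "y ^ k \<in> H" using y subgrp_power[OF H] by blast
      have eq: "cm y (?z k) = cj ?u (y ^ k)"
        using commute_power[of y y k] cm_eq_one_iff[of y "y ^ k"] by (simp add: cm_mult_right_cj)
      \<comment> \<open>The conjugate agrees with \<open>?u\<close> modulo gamma_3, and four more
        entries raise the difference to gamma_7; so the bracket does not see the
        conjugation.\<close>
      have "eqm H 3 ?u (cj ?u (y ^ k))"
        using gam_cm_H[OF H u yk] by (auto simp: eqm_alt cj_eq_mult_cm numeral_eq_Suc)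
      hence "brk ?u [?z k, ?z k, ?z k, ?z k] = brk (cj ?u (y ^ k)) [?z k, ?z k, ?z k, ?z k]"
        using z sub[OF u] yk by (intro brk_cong[OF H triv]) (auto intro: subgrp_cj[OF H])
      hence "F (?z k) (?z k) (?z k) (?z k) = iv (cm y (?z k) ^ e) ^ 6"
        using brk_cm_power_r[OF z[of k] y] by (simp only: F_def eq)
      also have "cm y (?z k) ^ e = ?u ^ e"
        using central[OF sub[OF u] yk] by (simp add: eq cj_power[symmetric] cj_eq_self_iff)
      finally show "F (?z k) (?z k) (?z k) (?z k) = iv (?u ^ e) ^ 6" .
    qed (use H x y z comm in auto)
    moreover have "F y y y y ^ 5 = 1"
      using fifth_kills[OF gam_le[OF m[OF y y y y]]] by (simp add: F_def power_mult[symmetric])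
    \<comment> \<open>The exponent 24 = 4! is prime to 5, so the 24th and the 25th power together
      determine the element.\<close>
    hence "F y y y y ^ 25 = 1" using power_dvd_one[of _ 5 25] by auto
    ultimately have "F y y y y = 1"
      using power_Suc[of "F y y y y" 24] by simp
    thus ?thesis by (simp add: F_def)
  qed
  \<comment> \<open>\<open>main\<close> treats brackets filled with the left entry of the
    commutator. Exchanging the letters and inverting gives those filled with the right
    entry.\<close>
  have "brk (cm x y) [x, x, x, x] ^ r = 1" using main[OF y x] .
  moreover have "cm x y \<in> gam H 2" by (rule gam_cm[OF H, of x 1 y 1]) (use x y in auto)
  hence "brk (iv (cm x y)) [x, x, x, x] = iv (brk (cm x y) [x, x, x, x])"
    by (intro brk_iv_left[OF H triv]) (use x in auto)
  ultimately show ?thesis by (simp only: iv_cm iv_power[symmetric] iv_one)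
qed

lemma power_cm_q:
  assumes x: "x \<in> H" and y: "y \<in> H"
  defines "u \<equiv> cm y x"
  shows "u ^ e * brk u [x, x] ^ q * cm (cm u x) u ^ q = 1"
  using power_cm[OF x y] brk_cm_power_r_eq_one[OF x y] by (simp add: u_def)

end

section \<open>Quotients as permutation groups\<close>

text \<open>This type hosts the quotients and also both central extensions. Given by explicit
  bijections, these inherit the group laws from composition, and only relations between particular
  elements have to be computed.\<close>

typedef 'a bperm = "{f :: 'a \<Rightarrow> 'a. bij f}"
  by (rule exI[of _ id]) simp

setup_lifting type_definition_bperm

instantiation bperm :: (type) mult_group
begin

lift_definition one_bperm :: "'a bperm" is id by simp
lift_definition times_bperm :: "'a bperm \<Rightarrow> 'a bperm \<Rightarrow> 'a bperm" is "(\<circ>)" by (rule bij_comp)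
lift_definition iv_bperm :: "'a bperm \<Rightarrow> 'a bperm" is "inv_into UNIV" by (rule bij_imp_bij_inv)

instance
proof
  fix a b c :: "'a bperm"
  show "a * b * c = a * (b * c)" by transfer (simp add: comp_assoc)
  show "1 * a = a" "a * 1 = a" by (transfer, simp)+
  show "iv a * a = 1" by transfer (simp add: bij_is_inj)
qed

end

lemma perm_apply [simp]: "Rep_bperm 1 x = x" "Rep_bperm (a * b) x = Rep_bperm a (Rep_bperm b x)"
  by (transfer, simp)+

lemma perm_eqI: "(\<And>x. Rep_bperm a x = Rep_bperm b x) \<Longrightarrow> a = b"
  by transfer auto

text \<open>A quotient group must again live in a type of class \<open>mult_group\<close>, so it is realised by
  permutations of cosets.\<close>

lemma quotient_map:
  fixes H K :: "'a::mult_group set"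
  assumes H: "subgrp H" and K: "subgrp K" "K \<subseteq> H" and normal: "\<And>k x. k \<in> K \<Longrightarrow> x \<in> H \<Longrightarrow> cj k x \<in> K"
  obtains \<phi> :: "'a \<Rightarrow> 'a set bperm" where "\<And>x y. x \<in> H \<Longrightarrow> y \<in> H \<Longrightarrow> \<phi> (x * y) = \<phi> x * \<phi> y"
    "\<And>x. x \<in> H \<Longrightarrow> \<phi> x = 1 \<longleftrightarrow> x \<in> K"
proof -
  define C where "C = (\<lambda>x. (*) x ` K) ` H"
  \<comment> \<open>Sets that are not cosets are fixed, which makes \<open>f h\<close> a bijection
    of the whole type.\<close>
  define f where "f h X = (if X \<in> C then (*) h ` X else X)" for h X
  have mC: "(*) h ` X \<in> C" if "h \<in> H" "X \<in> C" for h X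
  proof -
    from that obtain x where "x \<in> H" "X = (*) x ` K" by (auto simp: C_def)
    hence "(*) h ` X = (*) (h * x) ` K" by (simp add: image_image mult.assoc)
    thus ?thesis using \<open>x \<in> H\<close> that subgrpD(2)[OF H] by (auto simp: C_def)
  qed
  have comp: "f (g * h) X = f g (f h X)" if "g \<in> H" "h \<in> H" for g h X
    using mC[OF that(2)] by (auto simp: f_def image_image mult.assoc)
  have one: "f 1 X = X" for X by (simp add: f_def)
  have bij: "bij (f h)" if "h \<in> H" for h
    using comp[of h "iv h"] comp[of "iv h" h] that subgrpD(3)[OF H that] one
    by (intro o_bij[of "f (iv h)"]) auto
  define \<phi> where "\<phi> h = Abs_bperm (f h)" for h
  have Rep: "Rep_bperm (\<phi> h) = f h" if "h \<in> H" for h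
    using bij[OF that] by (simp add: \<phi>_def Abs_bperm_inverse)
  show thesis
  proof
    fix x y assume "x \<in> H" "y \<in> H"
    thus "\<phi> (x * y) = \<phi> x * \<phi> y"
      using comp subgrpD(2)[OF H] by (intro perm_eqI) (simp add: Rep)
  next
    fix x assume x: "x \<in> H"
    show "\<phi> x = 1 \<longleftrightarrow> x \<in> K"
    proof
      assume "\<phi> x = 1"
      hence "f x K = K" using Rep[OF x] by (metis perm_apply(1))
      moreover have "(*) 1 ` K \<in> C" using subgrpD(1)[OF H] unfolding C_def by (rule imageI)
      hence "K \<in> C" by simp
      ultimately have "(*) x ` K = K" by (simp add: f_def)
      thus "x \<in> K" using subgrpD(1)[OF K(1)] by (metis image_eqI mult_1_right)
    next
      assume xK: "x \<in> K"
      have "f x X = X" for X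
      proof (cases "X \<in> C")
        case True
        then obtain y where y: "y \<in> H" "X = (*) y ` K" by (auto simp: C_def)
        have cx: "cj x y \<in> K" using normal[OF xK y(1)] .
        have "(*) x ` X = (*) y ` (*) (cj x y) ` K"
          by (simp add: y image_image cj_def mult.assoc)
        also have "(*) (cj x y) ` K = K"
        proof (intro equalityI subsetI)
          fix k assume "k \<in> K"
          hence "k = cj x y * (iv (cj x y) * k)" "iv (cj x y) * k \<in> K"
            using subgrpD[OF K(1)] cx by simp_all
          thus "k \<in> (*) (cj x y) ` K" by blast
        qed (use subgrpD[OF K(1)] cx in auto)
        finally show ?thesis using True y by (simp add: f_def)
      qed (simp add: f_def)
      thus "\<phi> x = 1" using Rep[OF x] by (intro perm_eqI) simp
    qed
  qed
qed

locale grp_hom =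
  fixes H :: "'a::mult_group set" and \<phi> :: "'a \<Rightarrow> 'b::mult_group"
  assumes H: "subgrp H" and hom: "x \<in> H \<Longrightarrow> y \<in> H \<Longrightarrow> \<phi> (x * y) = \<phi> x * \<phi> y"
begin

lemma hom_one: "\<phi> 1 = 1"
proof -
  have "\<phi> 1 * \<phi> 1 = \<phi> 1 * 1" using hom[of 1 1] subgrpD(1)[OF H] by simp
  thus ?thesis by (simp only: mult_left_cancel)
qed

lemma hom_iv: "x \<in> H \<Longrightarrow> \<phi> (iv x) = iv (\<phi> x)"
  using hom[of x "iv x"] hom_one subgrpD(3)[OF H] by (simp add: iv_unique)

lemma hom_cm: "x \<in> H \<Longrightarrow> y \<in> H \<Longrightarrow> \<phi> (cm x y) = cm (\<phi> x) (\<phi> y)"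
  by (simp add: cm_def hom hom_iv subgrpD[OF H])

lemma hom_brk: "x \<in> H \<Longrightarrow> set as \<subseteq> H \<Longrightarrow> \<phi> (brk x as) = brk (\<phi> x) (map \<phi> as)"
  by (induction as arbitrary: x) (auto simp: hom_cm subgrp_cm[OF H])

lemma hom_power: "x \<in> H \<Longrightarrow> \<phi> (x ^ n) = \<phi> x ^ n"
  by (induction n) (simp_all add: hom_one hom subgrp_power[OF H])

lemma subgrp_image: "subgrp K \<Longrightarrow> K \<subseteq> H \<Longrightarrow> subgrp (\<phi> ` K)"
  unfolding subgrp_def by (auto simp: hom_one[symmetric] hom_iv[symmetric] hom[symmetric] subset_iff)

lemma image_gen:
  assumes "S \<subseteq> H" shows "\<phi> ` gen S = gen (\<phi> ` S)"
proof
  have SH: "gen S \<subseteq> H" using gen_least[OF H assms] .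
  show "gen (\<phi> ` S) \<subseteq> \<phi> ` gen S"
    by (rule gen_least[OF subgrp_image[OF subgrp_gen SH]]) auto
  have "\<phi> x \<in> gen (\<phi> ` S)" if "x \<in> gen S" for x
    using that
  proof induction
    case (gen_mult x y)
    thus ?case using SH by (auto simp: hom subset_iff)
  next
    case (gen_iv x)
    thus ?case using SH by (auto simp: hom_iv subset_iff)
  qed (auto simp: hom_one)
  thus "\<phi> ` gen S \<subseteq> gen (\<phi> ` S)" by auto
qed

lemma image_lc: "\<phi> ` lc H i = lc (\<phi> ` H) i"
proof (induction i)
  case (Suc i)
  have sub: "lc H i \<subseteq> H" using lc_sub[OF H] by blast
  hence S: "{cm x g | x g. x \<in> lc H i \<and> g \<in> H} \<subseteq> H" using subgrp_cm[OF H] by blast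
  have "\<phi> ` {cm x g | x g. x \<in> lc H i \<and> g \<in> H} = {cm x g | x g. x \<in> \<phi> ` lc H i \<and> g \<in> \<phi> ` H}"
  proof (intro equalityI subsetI)
    fix z assume "z \<in> {cm x g | x g. x \<in> \<phi> ` lc H i \<and> g \<in> \<phi> ` H}"
    then obtain x g where "x \<in> lc H i" "g \<in> H" "z = cm (\<phi> x) (\<phi> g)" by auto
    moreover from this have "z = \<phi> (cm x g)" using sub by (simp add: hom_cm subset_iff)
    ultimately show "z \<in> \<phi> ` {cm x g | x g. x \<in> lc H i \<and> g \<in> H}" by blast
  next
    fix z assume "z \<in> \<phi> ` {cm x g | x g. x \<in> lc H i \<and> g \<in> H}"
    then obtain x g where "x \<in> lc H i" "g \<in> H" "z = \<phi> (cm x g)" by auto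
    moreover from this have "z = cm (\<phi> x) (\<phi> g)" using sub by (simp add: hom_cm subset_iff)
    ultimately show "z \<in> {cm x g | x g. x \<in> \<phi> ` lc H i \<and> g \<in> \<phi> ` H}" by blast
  qed
  thus ?case unfolding lc.simps image_gen[OF S] Suc[symmetric] by simp
qed simp

lemma image_gam: "\<phi> ` gam H i = gam (\<phi> ` H) i"
  by (simp add: gam_def image_lc)

end

section \<open>Two theorems on Engel conditions\<close>

lemma commute_left_commute: "a * b = b * a \<Longrightarrow> a * (b * c) = b * (a * c)"
  for a :: "'a::mult_group"
  by (simp add: mult.assoc[symmetric])

lemma iv_product_eq_one: "iv a * (iv b * iv c) = 1 \<Longrightarrow> c * (b * a) = 1"
  for a :: "'a::mult_group"
  using iv_mult[of c "b * a"] iv_mult[of b a] iv_eq_one_iff[of "c * (b * a)"] by (simp only: mult.assoc)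

context
  fixes H :: "'a::mult_group set" and n :: nat
  assumes H: "subgrp H"
begin

lemma eqm_normal_left:
  assumes "t \<in> gam H k" "z \<in> H" shows "eqm H k (t * z) z"
  using gam_cj[OF H gam_iv[OF H assms(1)] assms(2)] by (simp add: eqm_def cj_def mult.assoc)

lemma eqm_absorb_right: "t \<in> gam H k \<Longrightarrow> eqm H k (z * t) z"
  by (simp add: eqm_def gam_iv[OF H] mult.assoc)

text \<open>The Jacobi identity: expand \<open>cm w (x * y)\<close> in two ways, using \<open>x * y = y * x * cm x y\<close>.\<close>

lemma eqm_jacobi:
  assumes w: "w \<in> gam H i" and x: "x \<in> gam H j" and y: "y \<in> gam H k"
    and m: "m \<le> i + j + k + 1" and pos: "i \<ge> 1" "j \<ge> 1" "k \<ge> 1"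
  shows "eqm H m (brk w [x, y]) (cm w (cm x y) * brk w [y, x])"
proof -
  let ?A = "cm w x" and ?B = "cm w y" and ?c = "cm x y"
  let ?p = "cm w ?c" and ?s = "cm (cm w y) x"
  have xy: "x * y \<in> H" "w \<in> H" "x \<in> H" "y \<in> H"
    using assms gam_sub[OF H] subgrpD(2)[OF H] by blast+
  have A: "?A \<in> gam H (i + j)" and B: "?B \<in> gam H (i + k)" and c: "?c \<in> gam H (j + k)"
    using gam_cm[OF H w x] gam_cm[OF H w y] gam_cm[OF H x y] by auto
  have p: "?p \<in> gam H (i + j + k)" using gam_cm[OF H w c] by simp
  have s: "?s \<in> gam H (i + j + k)" using gam_cm[OF H B x] by simp
  \<comment> \<open>The error terms \<open>N\<close>, \<open>N2\<close> and \<open>N3\<close> have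
    weight at least i + j + k + 1, as all three indices are positive.\<close>
  have N: "cm ?A ?B \<in> gam H m" using gam_cm[OF H A B] assms by simp
  have "?A * ?B \<in> gam H 1"
    using A B gam_antimono[OF H, of 1] pos subgrpD(2)[OF subgrp_gam[OF H]] by (metis trans_le_add1)
  hence N2: "cm ?p (?A * ?B) \<in> gam H m" using gam_cm[OF H p, of "?A * ?B" 1] m by simp
  have yx: "cm w (y * x) \<in> gam H (i + 1)" using gam_cm[OF H w, of "y * x" 1] xy subgrpD(2)[OF H] by simp
  have N3: "cm (cm w (y * x)) ?c \<in> gam H m"
    using gam_cm[OF H yx c] m by simp
  have "x * y = y * x * ?c" by (simp add: cm_def mult.assoc)
  hence "?B * ?A * cm ?A y = ?p * (cm w (y * x) * cm (cm w (y * x)) ?c)"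
    by (simp only: cm_mult_right_cj cj_eq_mult_cm mult.assoc)
       (metis cj_eq_mult_cm cm_mult_right_cj mult.assoc)
  moreover have "cm w (y * x) = ?A * ?B * ?s" by (simp add: cm_mult_right_cj cj_eq_mult_cm mult.assoc)
  ultimately have e: "cm ?A y = iv (?B * ?A) * (?p * (?A * ?B * ?s * cm (cm w (y * x)) ?c))"
    by (metis iv_left_assoc)
  have e: "cm ?A y = cm ?A ?B * ((?p * cm ?p (?A * ?B)) * (?s * cm (cm w (y * x)) ?c))"
    unfolding e by (simp add: cm_def mult.assoc)
  have m1: "?p \<in> H" "?s \<in> H" "cm ?p (?A * ?B) \<in> H" "cm (cm w (y * x)) ?c \<in> H"
    using p s N2 N3 gam_sub[OF H] by blast+
  have "eqm H m (cm ?A y) ((?p * cm ?p (?A * ?B)) * (?s * cm (cm w (y * x)) ?c))"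
    unfolding e using m1 subgrpD(2)[OF H] by (intro eqm_normal_left N) blast
  moreover have "eqm H m (?p * cm ?p (?A * ?B)) ?p" "eqm H m (?s * cm (cm w (y * x)) ?c) ?s"
    using N2 N3 by (auto intro: eqm_absorb_right)
  hence "eqm H m ((?p * cm ?p (?A * ?B)) * (?s * cm (cm w (y * x)) ?c)) (?p * ?s)"
    using m1 subgrpD(2)[OF H] by (intro eqm_mult[OF H]) blast+
  ultimately have "eqm H m (cm ?A y) (?p * ?s)" by (rule eqm_trans[OF H])
  thus ?thesis by simp
qed

context
  assumes triv: "gam H n = {1}"
begin

lemma jacobi_top:
  assumes "w \<in> gam H i" "x \<in> gam H j" "y \<in> gam H k" "n \<le> i + j + k + 1" "i \<ge> 1" "j \<ge> 1" "k \<ge> 1"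
  shows "brk w [x, y] = cm w (cm x y) * brk w [y, x]"
  using eqm_top[OF H triv eqm_jacobi[OF assms]] by simp

lemma brk_gen_slot:
  assumes v: "v \<in> gam H i" "i \<ge> 1" and as: "set as \<subseteq> H" "set bs \<subseteq> H" and S: "S \<subseteq> H"
    and n: "n \<le> Suc (Suc (i + length as + length bs))"
    and one: "\<And>s. s \<in> S \<Longrightarrow> brk v (as @ s # bs) = 1" and a: "a \<in> gen S"
  shows "brk v (as @ a # bs) = 1"
  using a
proof induction
  case (gen_mult a b)
  have "a \<in> H" "b \<in> H" using gen_least[OF H S] gen_mult by auto
  thus ?case using brk_mult[OF H triv v(1) as _ _ v(2) n] gen_mult by simp
next
  case (gen_iv a)
  have "a \<in> H" using gen_least[OF H S] gen_iv by auto
  thus ?case using brk_iv[OF H triv v(1) as _ v(2) n] gen_iv by simp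
qed (use one in simp_all)

lemma brk_gen_left:
  assumes S: "S \<subseteq> gam H i" "i \<ge> 1" and as: "set as \<subseteq> H" and n: "n \<le> Suc (i + length as)"
    and one: "\<And>s. s \<in> S \<Longrightarrow> brk s as = 1" and a: "a \<in> gen S"
  shows "brk a as = 1"
  using a
proof induction
  case (gen_mult a b)
  have "a \<in> gam H i" "b \<in> gam H i" using gen_least[OF subgrp_gam[OF H] S(1)] gen_mult by auto
  thus ?case using brk_mult_left[OF H triv _ _ as S(2) n] gen_mult by simp
next
  case (gen_iv a)
  have "a \<in> gam H i" using gen_least[OF subgrp_gam[OF H] S(1)] gen_iv by auto
  thus ?case using brk_iv_left[OF H triv _ as S(2) n] gen_iv by simp
qed (use one in simp_all)

lemma brk_gam_Suc:
  assumes i: "i \<ge> 1" and as: "set as \<subseteq> H" and n: "n \<le> Suc (Suc i + length as)"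
    and one: "\<And>v a. v \<in> gam H i \<Longrightarrow> a \<in> H \<Longrightarrow> brk v (a # as) = 1" and w: "w \<in> gam H (Suc i)"
  shows "brk w as = 1"
proof (rule brk_gen_left[of _ "Suc i"])
  show "w \<in> gen {cm x g | x g. x \<in> gam H i \<and> g \<in> H}" using w i by (simp add: gam_Suc)
  show "{cm x g | x g. x \<in> gam H i \<and> g \<in> H} \<subseteq> gam H (Suc i)" using gam_cm_H[OF H] by auto
qed (use assms in auto)

end

end

text \<open>With u = [y, x], expanding \<open>eng\<close> at x and at x y^-1 gives additively b + c
  + d = 0 and -b - c + d = 0 for the terms of degree 1 (b, c) and degree 2 (d) in y. Since gamma_4
  has exponent 3, division by 2 is possible, so d = 0 and b + c = 0; the Jacobi identity supplies b
  = c.\<close>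

lemma two_generator_class_four:
  fixes H :: "'a::mult_group set"
  assumes H: "subgrp H" and triv: "gam H 5 = {1}" and cube: "\<And>v. v \<in> gam H 4 \<Longrightarrow> v ^ 3 = 1"
    and eng: "\<And>x y. x \<in> H \<Longrightarrow> y \<in> H \<Longrightarrow> brk (cm y (x * y)) [x * y, x * y] = brk (cm y x) [x, x]"
    and gen: "H = gen {x0, y0}"
  shows "gam H 4 = {1}"
proof -
  note sub = gam_sub[OF H] and Hm = subgrpD(2)[OF H] and Hi = subgrpD(3)[OF H]
  have comm: "a * b = b * a" if "a \<in> gam H 4" "b \<in> gam H 4" for a b
    using gam_commute[OF H triv that] by simp
  have sq: "v = 1" if "v \<in> gam H 4" "v * v = 1" for v
    using cube[OF that(1)] that(2) by (simp add: numeral_eq_Suc)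
  have u2: "cm y x \<in> gam H 2" if "x \<in> H" "y \<in> H" for x y
    using gam_cm[OF H, of y 1 x 1 2] that by simp
  have mem: "brk (cm y x) [a, b] \<in> gam H 4" if "x \<in> H" "y \<in> H" "a \<in> H" "b \<in> H" for x y a b
    using brk_mem[OF H u2[OF that(1,2)], of "[a, b]"] that by simp
  have cjb: "brk (cj (cm y x) z) [a, b] = brk (cm y x) [a, b]"
    if "x \<in> H" "y \<in> H" "z \<in> H" "a \<in> H" "b \<in> H" for x y z a b
  proof -
    have "eqm H 3 (cm y x) (cj (cm y x) z)"
      using gam_cm_H[OF H u2[OF that(1,2)] that(3)] by (auto simp: eqm_alt cj_eq_mult_cm numeral_eq_Suc)
    hence "brk (cm y x) [a, b] = brk (cj (cm y x) z) [a, b]"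
      by (rule brk_cong[OF H triv]) (use that subgrp_cm[OF H] subgrp_cj[OF H] in auto)
    thus ?thesis ..
  qed
  have exp: "brk (cm y x) [a * b, c] = brk (cm y x) [a, c] * brk (cm y x) [b, c]"
       "brk (cm y x) [c, a * b] = brk (cm y x) [c, a] * brk (cm y x) [c, b]"
       "brk (cm y x) [iv a, c] = iv (brk (cm y x) [a, c])"
       "brk (cm y x) [c, iv a] = iv (brk (cm y x) [c, a])"
    if "x \<in> H" "y \<in> H" "a \<in> H" "b \<in> H" "c \<in> H" for x y a b c
    using brk_mult[OF H triv u2[OF that(1,2)], of "[]" "[c]" a b]
      brk_mult[OF H triv u2[OF that(1,2)], of "[c]" "[]" a b]
      brk_iv[OF H triv u2[OF that(1,2)], of "[]" "[c]" a]
      brk_iv[OF H triv u2[OF that(1,2)], of "[c]" "[]" a] that by simp_all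
  have key: "brk (cm y x) [y, y] = 1 \<and> brk (cm y x) [x, y] = 1 \<and> brk (cm y x) [y, x] = 1"
    if x: "x \<in> H" and y: "y \<in> H" for x y
  proof -
    let ?u = "cm y x"
    define a b c d where "a = brk ?u [x, x]" "b = brk ?u [y, x]" "c = brk ?u [x, y]" "d = brk ?u [y, y]"
    note D = this
    have m: "a \<in> gam H 4" "b \<in> gam H 4" "c \<in> gam H 4" "d \<in> gam H 4"
      using mem[OF x y] x y by (auto simp: D)
    have "cm y (x * y) = cj ?u y" by (simp add: cm_mult_right_cj)
    hence "brk ?u [x * y, x * y] = a" using eng[OF x y] cjb[OF x y y] x y Hm by (simp add: D)
    moreover have "brk ?u [x * y, x * y] = a * (b * (c * d))"
      using x y Hm exp[OF x y] by (simp add: D mult.assoc)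
    ultimately have "a * (b * (c * d)) = a * 1" by simp
    hence e1: "b * (c * d) = 1" by (simp only: mult_left_cancel)
    let ?z = "x * iv y"
    have z: "?z \<in> H" using x y Hm Hi by blast
    have "cm y ?z = cj ?u (iv y)"
      using cm_eq_one_iff[of y "iv y"] by (simp add: cm_mult_right_cj)
    moreover have "?z * y = x" by (simp add: mult.assoc)
    ultimately have "a = brk (cj ?u (iv y)) [?z, ?z]" using eng[OF z y] by (simp add: D)
    also have "\<dots> = brk ?u [?z, ?z]" using cjb[OF x y _ z z] y Hi by simp
    also have "\<dots> = a * (iv b * (iv c * d))"
      using x y Hm Hi exp[OF x y] commute_iv_right[OF comm[OF m(4,3)]] by (simp add: D mult.assoc)
    finally have "a * 1 = a * (iv b * (iv c * d))" by simp
    hence "iv b * (iv c * d) = 1" by (simp only: mult_left_cancel)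
    hence e2: "d = c * b" by (metis eq_iff_iv_mult iv_mult mult.assoc)
    have "c * b = b * c" using comm m by blast
    hence "d * d = 1" using e1 e2 by (simp add: mult.assoc)
    hence d1: "d = 1" using sq m by blast
    \<comment> \<open>The correction term of the Jacobi identity is [u, u^-1].\<close>
    have "cm ?u (cm x y) = 1" using commute_iv_right[of ?u ?u] by (simp add: iv_cm[symmetric, of y x] cm_eq_one_iff)
    hence "b = c"
      using jacobi_top[OF H triv u2[OF x y], of x 1 y 1] x y by (simp add: D)
    moreover from this have "b * b = 1" using e1 d1 by simp
    hence "b = 1" using sq m by blast
    ultimately show ?thesis using d1 by (simp add: D)
  qed
  have x0: "x0 \<in> H" "y0 \<in> H" using gen by auto
  have flip: "brk (cm x y) [a, b] = iv (brk (cm y x) [a, b])" if "x \<in> H" "y \<in> H" "a \<in> H" "b \<in> H" for x y a b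
    using brk_iv_left[OF H triv u2[OF that(1,2)], of "[a, b]"] that by (simp add: iv_cm)
  let ?X = "{x0, y0}"
  have base: "brk s [t, a, b] = 1" if "s \<in> ?X" "t \<in> ?X" "a \<in> ?X" "b \<in> ?X" for s t a b
  proof -
    \<comment> \<open>\<open>key\<close> leaves out one of the four brackets, the one ending in
      \<open>x0\<close>, \<open>x0\<close>. It is obtained with the two generators
      exchanged.\<close>
    have "brk (cm y0 x0) [a, b] = 1"
      using that(3,4) key[OF x0] key[OF x0(2,1)] flip[OF x0 x0(1) x0(1)]
      by auto
    thus ?thesis using that(1,2) flip[of x0 y0 a b] that(3,4) x0 by auto
  qed
  have X: "?X \<subseteq> H" using x0 by simp
  \<comment> \<open>Multilinearity carries the vanishing from the generators to \<open>H\<close>,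
    one entry at a time.\<close>
  have 1: "brk s [t, a, b] = 1" if "s \<in> ?X" "t \<in> ?X" "a \<in> ?X" "b \<in> H" for s t a b
    using brk_gen_slot[OF H triv, of s 1 "[t, a]" "[]" ?X b] base[OF that(1-3)] that X gen by auto
  have 2: "brk s [t, a, b] = 1" if "s \<in> ?X" "t \<in> ?X" "a \<in> H" "b \<in> H" for s t a b
    using brk_gen_slot[OF H triv, of s 1 "[t]" "[b]" ?X a] 1[OF that(1,2) _ that(4)] that X gen by auto
  have 3: "brk s [t, a, b] = 1" if "s \<in> ?X" "t \<in> H" "a \<in> H" "b \<in> H" for s t a b
    using brk_gen_slot[OF H triv, of s 1 "[]" "[a, b]" ?X t] 2[OF that(1) _ that(3,4)] that X gen by auto
  have 4: "brk s [t, a, b] = 1" if "s \<in> H" "t \<in> H" "a \<in> H" "b \<in> H" for s t a b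
    using brk_gen_left[OF H triv, of ?X 1 "[t, a, b]" s] 3[OF _ that(2-4)] that X gen by auto
  \<comment> \<open>The first entries are absorbed into generators of the next lower central term
    until a single element of gamma_4 remains.\<close>
  have 5: "brk v [a, b] = 1" if "v \<in> gam H 2" "a \<in> H" "b \<in> H" for v a b
    using brk_gam_Suc[OF H triv, of 1 "[a, b]" v] 4 that by (simp add: numeral_2_eq_2)
  have 6: "brk v [b] = 1" if "v \<in> gam H 3" "b \<in> H" for v b
    using brk_gam_Suc[OF H triv, of 2 "[b]" v] 5 that by (simp add: numeral_3_eq_3)
  have 7: "brk v [] = 1" if "v \<in> gam H 4" for v
    using brk_gam_Suc[OF H triv, of 3 "[]" v] 6 that by (simp add: numeral_eq_Suc)
  show ?thesis using 7 gam_1[OF H, of 4] by auto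
qed

text \<open>Heineken's theorem in class 5. Expanding \<open>[y, z, z, z] = 1\<close> for \<open>z = x * b\<close> with \<open>b\<close> in the
  derived subgroup gives \<open>[b, x, x, y] = 1\<close>, and two applications of the Jacobi identity then make all
  commutators of weight 5 vanish.\<close>

lemma three_engel_class_five:
  fixes H :: "'a::mult_group set"
  assumes H: "subgrp H" and triv: "gam H 6 = {1}" and cube: "\<And>v. v \<in> gam H 4 \<Longrightarrow> v ^ 3 = 1"
    and eng: "\<And>x y. x \<in> H \<Longrightarrow> y \<in> H \<Longrightarrow> brk y [x, x, x] = 1"
  shows "gam H 5 = {1}"
proof -
  note sub = gam_sub[OF H] and Hm = subgrpD(2)[OF H] and Hi = subgrpD(3)[OF H] and Hc = subgrp_cm[OF H]
  have comm: "a * b = b * a" if "a \<in> gam H i" "b \<in> gam H j" "6 \<le> i + j" for a b i j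
    using gam_commute[OF H triv that] .
  have cube5: "v * (v * v) = 1" if "v \<in> gam H 5" for v
    using cube[OF gam_antimono[OF H _ that, of 4]] by (simp add: numeral_3_eq_3)
  have sq: "v = 1" if "v \<in> gam H 5" "v * v = 1" for v
    using cube5[OF that(1)] that(2) by simp
  have mem: "brk v as \<in> gam H k" if "v \<in> gam H i" "set as \<subseteq> H" "k = i + length as" for v as i k
    using brk_mem[OF H that(1,2)] that(3) by simp
  have H1: "x \<in> gam H 1" if "x \<in> H" for x using that by simp
  have u2: "cm y x \<in> gam H 2" if "x \<in> H" "y \<in> H" for x y
    using gam_cm[OF H, of y 1 x 1 2] that by simp
  \<comment> \<open>This is the part of [y, z, z, z] that is linear in \<open>b\<close>; a term
    containing \<open>b\<close> twice has weight at least 6.\<close>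
  have E: "brk y [b, x, x] * (brk y [x, b, x] * brk y [x, x, b]) = 1"
    if b: "b \<in> gam H 2" and x: "x \<in> H" and y: "y \<in> H" for b x y
  proof -
    have bH: "b \<in> H" using b sub by blast
    let ?z = "x * b"
    have z: "?z \<in> H" using x bH Hm by blast
    define A where "A = cm y b"
    define B where "B = cm y x"
    define C where "C = cm B b"
    have A: "A \<in> gam H 3" and B: "B \<in> gam H 2"
      using gam_cm[OF H H1[OF y] b, of 3] u2[OF x y] by (simp_all add: A_def B_def)
    have C: "C \<in> gam H 4" using gam_cm[OF H B b] by (simp add: C_def)
    define D where "D = cm A ?z"
    define G where "G = cm B b"
    define K where "K = cm B x"
    define L where "L = cm K b"
    have D: "D \<in> gam H 4" and K: "K \<in> gam H 3"
      using gam_cm[OF H A H1[OF z], of 4] gam_cm[OF H B H1[OF x], of 3] by (simp_all add: D_def K_def)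
    have G: "G \<in> gam H 4" using C by (simp add: C_def G_def)
    have L: "L \<in> gam H 5" using gam_cm[OF H K b] by (simp add: L_def)
    have s1: "cm y ?z = A * (B * C)" by (simp add: A_def B_def C_def cm_mult_right_cj cj_eq_mult_cm mult.assoc)
    have BC: "B * C \<in> gam H 2" using gam_mult[OF H B gam_antimono[OF H _ C]] by simp
    have Cz: "cm C ?z \<in> gam H 5" using gam_cm[OF H C H1[OF z]] by simp
    have Bz: "cm B ?z \<in> gam H 3" using gam_cm[OF H B H1[OF z]] by simp
    have "cm (A * (B * C)) ?z = D * cm (B * C) ?z"
      unfolding D_def by (rule cm_mult_left, rule comm[OF D[unfolded D_def] BC]) simp
    also have "cm (B * C) ?z = cm B ?z * cm C ?z"
      by (rule cm_mult_left, rule comm[OF Bz C]) simp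
    also have "cm B ?z = G * (K * L)"
      by (simp add: G_def K_def L_def cm_mult_right_cj cj_eq_mult_cm mult.assoc)
    finally have s2: "brk y [?z, ?z] = D * (G * (K * L) * cm C ?z)" by (simp add: s1)
    have LC: "L * cm C ?z \<in> gam H 5" by (rule gam_mult[OF H L Cz])
    have KLC: "K * (L * cm C ?z) \<in> gam H 3"
      using gam_mult[OF H K gam_antimono[OF H _ LC, of 3]] by simp
    have top: "cm v w = 1" if "v \<in> gam H i" "w \<in> gam H j" "6 \<le> i + j" for v w i j
      using comm[OF that] by (simp add: cm_eq_one_iff)
    have "brk y [?z, ?z, ?z] = cm (D * (G * (K * (L * cm C ?z)))) ?z"
      using s2 by (simp add: mult.assoc)
    also have "\<dots> = cm D ?z * cm (G * (K * (L * cm C ?z))) ?z"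
      by (rule cm_mult_left, rule comm[OF gam_cm[OF H D H1[OF z], of 5] gam_mult[OF H gam_antimono[OF H _ G, of 3] KLC]]) simp_all
    also have "cm (G * (K * (L * cm C ?z))) ?z = cm G ?z * cm (K * (L * cm C ?z)) ?z"
      by (rule cm_mult_left, rule comm[OF gam_cm[OF H G H1[OF z], of 5] KLC]) simp_all
    also have "cm (K * (L * cm C ?z)) ?z = cm K ?z * cm (L * cm C ?z) ?z"
      by (rule cm_mult_left, rule comm[OF gam_cm[OF H K H1[OF z], of 4] LC]) simp_all
    also have "cm (L * cm C ?z) ?z = 1" by (rule top[OF LC H1[OF z]]) simp
    also have "cm K ?z = cm K b * cm K x"
      unfolding cm_mult_right_cj[of K x b] using comm[OF gam_cm[OF H K H1[OF x], of 4] b]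
      by (simp add: cj_eq_self_iff)
    also have "cm K x = 1" using eng[OF x y] by (simp add: K_def B_def)
    also have "cm G ?z = cm G x"
      unfolding cm_mult_right_cj[of G x b] using comm[OF gam_cm[OF H G H1[OF x], of 5] b] top[OF G b]
      by (simp add: cj_eq_self_iff)
    also have "cm D ?z = brk A [x, x]"
    proof -
      have A1: "cm A b \<in> gam H 5" and A2: "cm A x \<in> gam H 4"
        using gam_cm[OF H A b] gam_cm[OF H A H1[OF x]] by auto
      have "D = cm A b * cm A x"
        unfolding D_def cm_mult_right_cj[of A x b] using comm[OF A2 b] by (simp add: cj_eq_self_iff)
      hence "cm D ?z = cm (cm A b) ?z * cm (cm A x) ?z"
        using comm[OF gam_cm[OF H A1 H1[OF z], of 6] A2] by (simp add: cm_mult_left)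
      also have "cm (cm A b) ?z = 1" by (rule top[OF A1 H1[OF z]]) simp
      also have "cm (cm A x) ?z = cm (cm A x) x"
        unfolding cm_mult_right_cj[of "cm A x" x b]
        using comm[OF gam_cm[OF H A2 H1[OF x], of 5] b] top[OF A2 b] by (simp add: cj_eq_self_iff)
      finally show ?thesis by simp
    qed
    finally show ?thesis using eng[OF z y] by (simp add: A_def G_def B_def K_def)
  qed
  \<comment> \<open>By the Jacobi identity all three factors in \<open>E\<close> become brackets
    starting with \<open>b\<close>. Additively the result is 3p - 3s + t = 0, and exponent 3 leaves
    t = 0.\<close>
  have T: "brk b [x, x, y] = 1" if b: "b \<in> gam H 2" and x: "x \<in> H" and y: "y \<in> H" for b x y
  proof -
    have bH: "b \<in> H" using b sub by blast
    define p s t where "p = brk b [y, x, x]" "s = brk b [x, y, x]" "t = brk b [x, x, y]"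
    note D = this
    have m: "p \<in> gam H 5" "s \<in> gam H 5" "t \<in> gam H 5"
      using mem[OF b, of "[y, x, x]" 5] mem[OF b, of "[x, y, x]" 5] mem[OF b, of "[x, x, y]" 5] x y
      by (simp_all add: D)
    note c = comm[OF m(1,2)] comm[OF m(1,3)] comm[OF m(2,3)]
    let ?u = "cm y x"
    have u: "?u \<in> gam H 2" by (rule u2[OF x y])
    have by3: "cm b y \<in> gam H 3" and bx3: "cm b x \<in> gam H 3"
      using gam_cm[OF H b H1[OF y]] gam_cm[OF H b H1[OF x]] by auto
    have bu: "cm b ?u \<in> gam H 4" using gam_cm[OF H b u] by simp
    have 1: "brk y [b, x, x] = iv p"
      using brk_iv_left[OF H triv by3, of "[x, x]"] x by (simp add: D iv_cm)
    have J: "brk (cm b ?u) [x] = p * iv s"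
    proof -
      have "eqm H 5 (brk b [y, x]) (cm b ?u * brk b [x, y])"
        by (rule eqm_jacobi[OF H b H1[OF y] H1[OF x]]) auto
      moreover have byx: "brk b [y, x] \<in> gam H 4" "brk b [x, y] \<in> gam H 4" using mem[OF b, of "[y, x]" 4] mem[OF b, of "[x, y]" 4] x y by simp_all
      ultimately have "brk (brk b [y, x]) [x] = brk (cm b ?u * brk b [x, y]) [x]"
        using x gam_mult[OF H bu byx(2)] by (intro brk_cong[OF H triv, of 5]) (auto dest: sub)
      also have "\<dots> = brk (cm b ?u) [x] * brk (brk b [x, y]) [x]"
        using x byx by (intro brk_mult_left[OF H triv bu]) auto
      finally have "p = brk (cm b ?u) [x] * s" by (simp add: D)
      thus ?thesis by (simp add: mult.assoc)
    qed
    have "brk (iv (cm b ?u)) [x] = iv (brk (cm b ?u) [x])"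
      by (rule brk_iv_left[OF H triv bu]) (use x in auto)
    hence "brk (cm ?u b) [x] = iv (p * iv s)" by (simp only: iv_cm[of b] J)
    hence 2: "brk y [x, b, x] = iv (p * iv s)" by simp
    have w1: "brk (cm b x) [?u] = s * iv t"
    proof -
      have "brk (cm b x) [y, x] = cm (cm b x) (cm y x) * brk (cm b x) [x, y]"
        by (rule jacobi_top[OF H triv bx3 H1[OF y] H1[OF x]]) auto
      thus ?thesis by (simp add: D mult.assoc)
    qed
    have "brk b [?u, x] = cm b (cm ?u x) * brk b [x, ?u]"
      by (rule jacobi_top[OF H triv b u H1[OF x]]) auto
    hence "p * iv s = cm b (cm ?u x) * (s * iv t)" using J w1 by simp
    hence "cm b (cm ?u x) = p * iv s * iv (s * iv t)" by (simp add: mult.assoc)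
    hence 3: "brk y [x, x, b] = iv (p * iv s * iv (s * iv t))"
      using iv_cm[of b "cm ?u x"] by simp
    have "iv p * (iv (p * iv s) * iv (p * iv s * iv (s * iv t))) = 1"
      using E[OF b x y] 1 2 3 by simp
    hence "(p * iv s * iv (s * iv t)) * ((p * iv s) * p) = 1"
      by (rule iv_product_eq_one)
    moreover have "(p * iv s * iv (s * iv t)) * ((p * iv s) * p) = (p * (p * p)) * iv (s * (s * s)) * t"
    proof -
      have m': "iv s \<in> gam H 5" using gam_iv[OF H m(2)] .
      have c1: "iv s * (p * z) = p * (iv s * z)" "iv s * p = p * iv s" for z
      proof -
        show "iv s * p = p * iv s" using comm[OF m' m(1)] by simp
        thus "iv s * (p * z) = p * (iv s * z)" by (rule commute_left_commute)
      qed
      have c2: "t * (p * z) = p * (t * z)" "t * p = p * t" for z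
      proof -
        show "t * p = p * t" using c by simp
        thus "t * (p * z) = p * (t * z)" by (rule commute_left_commute)
      qed
      have c3: "t * (iv s * z) = iv s * (t * z)" "t * iv s = iv s * t" for z
      proof -
        show "t * iv s = iv s * t" using comm[OF m(3) m'] by simp
        thus "t * (iv s * z) = iv s * (t * z)" by (rule commute_left_commute)
      qed
      show ?thesis by (simp add: mult.assoc c1 c2 c3)
    qed
    ultimately have "t = 1" using cube5 m by simp
    thus ?thesis by (simp add: D)
  qed
  \<comment> \<open>Polarisation of \<open>T\<close> in the repeated entry.\<close>
  have anti: "brk b [x, z, y] * brk b [z, x, y] = 1"
    if b: "b \<in> gam H 2" and x: "x \<in> H" and y: "y \<in> H" and z: "z \<in> H" for b x y z
  proof -
    have xz: "x * z \<in> H" using x z Hm by blast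
    have "1 = brk b [x * z, x * z, y]" using T[OF b xz y] by simp
    also have "\<dots> = brk b [x, x * z, y] * brk b [z, x * z, y]"
      using brk_mult[OF H triv b, of "[]" "[x * z, y]" x z] x y z xz by simp
    also have "brk b [x, x * z, y] = brk b [x, x, y] * brk b [x, z, y]"
      using brk_mult[OF H triv b, of "[x]" "[y]" x z] x y z by simp
    also have "brk b [z, x * z, y] = brk b [z, x, y] * brk b [z, z, y]"
      using brk_mult[OF H triv b, of "[z]" "[y]" x z] x y z by simp
    finally show ?thesis using T[OF b x y] T[OF b z y] by simp
  qed
  have vanish: "brk s [t, x, y, z] = 1"
    if s: "s \<in> H" and t: "t \<in> H" and x: "x \<in> H" and y: "y \<in> H" and z: "z \<in> H" for s t x y z
  proof -
    define w where "w a b c d = brk a [b, c, d, z]" for a b c d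
    have wm: "w a b c d \<in> gam H 5" if "a \<in> H" "b \<in> H" "c \<in> H" "d \<in> H" for a b c d
      using mem[OF H1[OF that(1)], of "[b, c, d, z]" 5] that z by (simp add: w_def)
    have w12: "w b a c d = iv (w a b c d)" if "a \<in> H" "b \<in> H" "c \<in> H" "d \<in> H" for a b c d
      using brk_iv_left[OF H triv u2[of b a], of "[c, d, z]"] that z by (simp add: w_def iv_cm)
    have w34: "w a b d c = iv (w a b c d)" if "a \<in> H" "b \<in> H" "c \<in> H" "d \<in> H" for a b c d
      using anti[OF u2[of b a] that(3) z that(4)] that by (simp add: w_def iv_unique)
    \<comment> \<open>By Jacobi and \<open>w34\<close>, [[a, b], [c, d], z] is twice w(a, b, c, d)
      in additive notation. It changes sign when the two pairs are exchanged, and 2 is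
      invertible.\<close>
    have wswap: "w c d a b = iv (w a b c d)" if "a \<in> H" "b \<in> H" "c \<in> H" "d \<in> H" for a b c d
    proof -
      have half: "cm (cm (cm a b) (cm c d)) z = w a b c d * w a b c d"
        if "a \<in> H" "b \<in> H" "c \<in> H" "d \<in> H" for a b c d
      proof -
        have ab: "cm a b \<in> gam H 2" using u2 that by blast
        have cd: "cm c d \<in> gam H 2" using u2 that by blast
        have m4: "brk (cm a b) [c, d] \<in> gam H 4" "brk (cm a b) [d, c] \<in> gam H 4" "cm (cm a b) (cm c d) \<in> gam H 4"
          using mem[OF ab, of "[c, d]" 4] mem[OF ab, of "[d, c]" 4] gam_cm[OF H ab cd] that by auto
        have "eqm H 5 (brk (cm a b) [c, d]) (cm (cm a b) (cm c d) * brk (cm a b) [d, c])"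
          by (rule eqm_jacobi[OF H ab H1[OF that(3)] H1[OF that(4)]]) auto
        hence "brk (brk (cm a b) [c, d]) [z] = brk (cm (cm a b) (cm c d) * brk (cm a b) [d, c]) [z]"
          using z m4 gam_mult[OF H m4(3,2)] by (intro brk_cong[OF H triv, of 5]) (auto dest: sub)
        also have "\<dots> = brk (cm (cm a b) (cm c d)) [z] * brk (brk (cm a b) [d, c]) [z]"
          using z m4 by (intro brk_mult_left[OF H triv m4(3)]) auto
        finally have "w a b c d = cm (cm (cm a b) (cm c d)) z * w a b d c" by (simp add: w_def)
        hence "w a b c d = cm (cm (cm a b) (cm c d)) z * iv (w a b c d)"
          unfolding w34[OF that] .
        from arg_cong[OF this, of "\<lambda>v. v * w a b c d"] show ?thesis
          by (simp only: mult.assoc iv_left mult_1_right)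
      qed
      have m4: "cm (cm a b) (cm c d) \<in> gam H 4"
        using gam_cm[OF H u2[of b a] u2[of d c]] that by simp
      have "brk (iv (cm (cm a b) (cm c d))) [z] = iv (brk (cm (cm a b) (cm c d)) [z])"
        by (rule brk_iv_left[OF H triv m4]) (use z in auto)
      hence "cm (cm (cm c d) (cm a b)) z = iv (cm (cm (cm a b) (cm c d)) z)"
        by (simp only: iv_cm[of "cm a b" "cm c d"] foldl.simps)
      hence e: "w c d a b * w c d a b = iv (w a b c d) * iv (w a b c d)"
        by (simp only: half[OF that] half[OF that(3,4,1,2)] iv_mult)
      let ?v = "w a b c d * w c d a b"
      have v: "?v \<in> gam H 5" by (rule gam_mult[OF H wm[OF that] wm[OF that(3,4,1,2)]])
      have cc: "w a b c d * w c d a b = w c d a b * w a b c d" by (rule comm[OF wm[OF that] wm[OF that(3,4,1,2)]]) simp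
      have "?v * ?v = w a b c d * (w c d a b * w a b c d) * w c d a b" by (simp add: mult.assoc)
      also have "\<dots> = w a b c d * w a b c d * (w c d a b * w c d a b)" unfolding cc[symmetric] by (simp add: mult.assoc)
      also have "\<dots> = 1" by (simp add: e mult.assoc)
      finally have "?v = 1" by (rule sq[OF v])
      from iv_unique[OF this] show ?thesis by (rule HOL.sym)
    qed
    have jac: "w a b c d * (w b c a d * w c a b d) = 1"
      if "a \<in> H" "b \<in> H" "c \<in> H" "d \<in> H" for a b c d
    proof -
      have ab: "cm a b \<in> gam H 2" using u2 that by blast
      have m3: "brk c [a, b] \<in> gam H 3" "brk c [b, a] \<in> gam H 3" "cm c (cm a b) \<in> gam H 3"
        using mem[OF H1[OF that(3)], of "[a, b]" 3] mem[OF H1[OF that(3)], of "[b, a]" 3]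
          gam_cm[OF H H1[OF that(3)] ab] that by auto
      have "eqm H 4 (brk c [a, b]) (cm c (cm a b) * brk c [b, a])"
        by (rule eqm_jacobi[OF H H1[OF that(3)] H1[OF that(1)] H1[OF that(2)]]) auto
      hence "brk (brk c [a, b]) [d, z] = brk (cm c (cm a b) * brk c [b, a]) [d, z]"
        using z m3 gam_mult[OF H m3(3,2)] that by (intro brk_cong[OF H triv, of 4]) (auto dest: sub)
      also have "\<dots> = brk (cm c (cm a b)) [d, z] * brk (brk c [b, a]) [d, z]"
        using z m3 that by (intro brk_mult_left[OF H triv m3(3)]) auto
      also have "brk (cm c (cm a b)) [d, z] = iv (brk (cm (cm a b) c) [d, z])"
        using brk_iv_left[OF H triv gam_cm[OF H ab H1[OF that(3)], of 3], of "[d, z]"] z that by (simp add: iv_cm)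
      finally have "w c a b d = iv (w a b c d) * w c b a d" by (simp add: w_def)
      moreover have "w c b a d = iv (w b c a d)" using w12 that by blast
      ultimately have "w c a b d = iv (w b c a d * w a b c d)" by simp
      moreover have "w b c a d * w a b c d = w a b c d * w b c a d" by (rule comm[OF wm[OF that(2,3,1,4)] wm[OF that]]) simp
      ultimately show ?thesis by (simp add: mult.assoc)
    qed
    \<comment> \<open>Additively, \<open>jac\<close> for (s, t, x) with y in fourth place reads
      \<alpha> + \<beta> + \<gamma> = 0. For (s, t, y) with x in fourth place it becomes -\<alpha> +
      \<beta> + \<gamma> = 0 after using the symmetries of \<open>w\<close>. Hence 2\<alpha> =
      0.\<close>
    let ?\<alpha> = "w s t x y" and ?\<beta> = "w t x s y" and ?\<gamma> = "w x s t y"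
    have j1: "?\<alpha> * (?\<beta> * ?\<gamma>) = 1" by (rule jac[OF s t x y])
    have "w s t y x * (w t y s x * w y s t x) = 1" by (rule jac[OF s t y x])
    moreover have "w s t y x = iv ?\<alpha>" by (rule w34[OF s t x y])
    moreover have "w t y s x = ?\<gamma>"
      using wswap[OF s x t y] w12[OF s x t y] by simp
    moreover have "w y s t x = ?\<beta>"
      using wswap[OF t x y s] w34[OF t x s y] by simp
    ultimately have "iv ?\<alpha> * (?\<gamma> * ?\<beta>) = 1" by simp
    moreover have "?\<gamma> * ?\<beta> = ?\<beta> * ?\<gamma>" by (rule comm[OF wm[OF x s t y] wm[OF t x s y]]) simp
    ultimately have "?\<alpha> = ?\<beta> * ?\<gamma>" using eq_iff_iv_mult[of ?\<alpha> "?\<beta> * ?\<gamma>"] by simp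
    hence "?\<alpha> * ?\<alpha> = 1" using j1 by simp
    hence "?\<alpha> = 1" by (rule sq[OF wm[OF s t x y]])
    thus ?thesis by (simp add: w_def)
  qed
  have 1: "brk v [x, y, z] = 1" if "v \<in> gam H 2" "x \<in> H" "y \<in> H" "z \<in> H" for v x y z
    using brk_gam_Suc[OF H triv, of 1 "[x, y, z]" v] vanish that by (simp add: numeral_2_eq_2)
  have 2: "brk v [y, z] = 1" if "v \<in> gam H 3" "y \<in> H" "z \<in> H" for v y z
    using brk_gam_Suc[OF H triv, of 2 "[y, z]" v] 1 that by (simp add: numeral_3_eq_3)
  have 3: "brk v [z] = 1" if "v \<in> gam H 4" "z \<in> H" for v z
    using brk_gam_Suc[OF H triv, of 3 "[z]" v] 2 that by (simp add: numeral_eq_Suc)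
  have 4: "brk v [] = 1" if "v \<in> gam H 5" for v
    using brk_gam_Suc[OF H triv, of 4 "[]" v] 3 that by (simp add: numeral_eq_Suc)
  show ?thesis using 4 gam_1[OF H, of 5] by auto
qed

section \<open>Powers of lower central terms\<close>

lemma mult_eq_mult_cross: "a * b = c * d \<Longrightarrow> iv c * a = d * iv b"
  for a :: "'a::mult_group"
proof -
  assume "a * b = c * d"
  hence "iv c * (a * b) * iv b = iv c * (c * d) * iv b" by simp
  thus ?thesis by (simp add: mult.assoc)
qed

context class_six
begin

lemma power_q_mult: "v \<in> gam H 4 \<Longrightarrow> w \<in> gam H 4 \<Longrightarrow> (v * w) ^ q = v ^ q * w ^ q"
  using commute[of v 4 w 4] by (intro power_mult_commute) simp

text \<open>Where the quotient by \<open>Kq j\<close> has trivial \<open>gam 4\<close>, the map \<open>v \<mapsto> v ^ q\<close> sends \<open>gam H 4\<close> into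
  the image of \<open>gam H j\<close>.\<close>

definition Kq :: "nat \<Rightarrow> 'a set" where
  "Kq j = {v \<in> gam H 4. \<exists>w\<in>gam H j. v ^ q = w ^ q}"

lemma Kq_normal:
  assumes j: "4 \<le> j"
  shows "subgrp (Kq j)" "Kq j \<subseteq> H" "\<And>k x. k \<in> Kq j \<Longrightarrow> x \<in> H \<Longrightarrow> cj k x \<in> Kq j" "gam H j \<subseteq> Kq j"
proof -
  have j4: "w \<in> gam H 4" if "w \<in> gam H j" for w using gam_le[OF that j] .
  show "subgrp (Kq j)"
    unfolding subgrp_def
  proof (intro conjI ballI)
    show "1 \<in> Kq j" using gam1 by (auto simp: Kq_def intro!: bexI[of _ 1])
  next
    fix x y assume "x \<in> Kq j" "y \<in> Kq j"
    then obtain v w where m: "x \<in> gam H 4" "y \<in> gam H 4" "v \<in> gam H j" "w \<in> gam H j"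
      "x ^ q = v ^ q" "y ^ q = w ^ q" by (auto simp: Kq_def)
    hence "(x * y) ^ q = (v * w) ^ q" using power_q_mult j4 by simp
    moreover have "x * y \<in> gam H 4" "v * w \<in> gam H j" using m gammult by auto
    ultimately show "x * y \<in> Kq j" by (auto simp: Kq_def)
  next
    fix x assume "x \<in> Kq j"
    then obtain v where m: "x \<in> gam H 4" "v \<in> gam H j" "x ^ q = v ^ q" by (auto simp: Kq_def)
    hence "iv x ^ q = iv v ^ q" by (simp add: iv_power[symmetric])
    moreover have "iv x \<in> gam H 4" "iv v \<in> gam H j" using m gamiv by auto
    ultimately show "iv x \<in> Kq j" by (auto simp: Kq_def)
  qed
  show "Kq j \<subseteq> H" using sub by (auto simp: Kq_def)
  show "gam H j \<subseteq> Kq j" using j4 by (auto simp: Kq_def)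
  fix k x assume "k \<in> Kq j" and x: "x \<in> H"
  then obtain v where m: "k \<in> gam H 4" "v \<in> gam H j" "k ^ q = v ^ q" by (auto simp: Kq_def)
  hence "cj k x ^ q = cj v x ^ q" by (simp add: cj_power[symmetric])
  moreover have "cj k x \<in> gam H 4" "cj v x \<in> gam H j" using m x gam_cj[OF H] by auto
  ultimately show "cj k x \<in> Kq j" by (auto simp: Kq_def)
qed

lemma quotient_Kq:
  assumes j: "4 \<le> j"
  obtains \<phi> :: "'a \<Rightarrow> 'a set bperm" where "grp_hom H \<phi>" "\<And>x. x \<in> H \<Longrightarrow> \<phi> x = 1 \<longleftrightarrow> x \<in> Kq j"
    "subgrp (\<phi> ` H)" "gam (\<phi> ` H) j = {1}" "\<And>v. v \<in> gam (\<phi> ` H) 4 \<Longrightarrow> v ^ 3 = 1"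
proof -
  obtain \<phi> :: "'a \<Rightarrow> 'a set bperm" where \<phi>: "\<And>x y. x \<in> H \<Longrightarrow> y \<in> H \<Longrightarrow> \<phi> (x * y) = \<phi> x * \<phi> y"
    "\<And>x. x \<in> H \<Longrightarrow> \<phi> x = 1 \<longleftrightarrow> x \<in> Kq j"
    using quotient_map[OF H Kq_normal(1-3)[OF j]] by metis
  interpret h: grp_hom H \<phi> by unfold_locales (use H \<phi> in auto)
  show thesis
  proof
    show "grp_hom H \<phi>" by unfold_locales
    show "subgrp (\<phi> ` H)" using h.subgrp_image H by simp
    show "gam (\<phi> ` H) j = {1}"
      using Kq_normal(4)[OF j] \<phi>(2) sub gam1[of j] by (force simp: h.image_gam[symmetric])
    fix v assume "v \<in> gam (\<phi> ` H) 4"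
    then obtain x where x: "x \<in> gam H 4" "v = \<phi> x" by (auto simp: h.image_gam[symmetric])
    \<comment> \<open>A cube from gamma_4 has trivial q-th power, so it lies in \<open>Kq j\<close>
      with witness 1.\<close>
    have "x ^ 3 \<in> gam H 4" using x subgrp_power[OF subgrp_gam[OF H]] by blast
    moreover have "(x ^ 3) ^ q = 1 ^ q"
      using cube_kills[OF gam_le[OF x(1)]] by (simp add: power_mult[symmetric] mult.commute)
    ultimately have "x ^ 3 \<in> Kq j" using gam1[of j] unfolding Kq_def by blast
    hence "\<phi> (x ^ 3) = 1" using \<phi>(2) Kq_normal(2)[OF j] by blast
    thus "v ^ 3 = 1" using x sub by (simp add: h.hom_power)
  qed (use \<phi> in auto)
qed

text \<open>If x^q = w^q with \<open>w\<close> one weight deeper, then [x, g]^q = [x^q, g] =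
  [w^q, g] = [w, g]^q. One inclusion of this kind thus propagates down the series, until the terms
  are trivial.\<close>

lemma power_q_descend:
  assumes i: "4 \<le> i" and D: "\<And>v. v \<in> gam H i \<Longrightarrow> \<exists>w\<in>gam H (Suc i). v ^ q = w ^ q"
    and v: "v \<in> gam H (Suc i)"
  shows "\<exists>w\<in>gam H (Suc (Suc i)). v ^ q = w ^ q"
proof -
  have K: "subgrp (Kq (Suc (Suc i)))" using Kq_normal(1)[of "Suc (Suc i)"] i by simp
  have "{cm x g | x g. x \<in> gam H i \<and> g \<in> H} \<subseteq> Kq (Suc (Suc i))"
  proof
    fix z assume "z \<in> {cm x g | x g. x \<in> gam H i \<and> g \<in> H}"
    then obtain x g where z: "z = cm x g" "x \<in> gam H i" "g \<in> H" by auto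
    obtain w where w: "w \<in> gam H (Suc i)" "x ^ q = w ^ q" using D z by blast
    have zi: "z \<in> gam H (Suc i)" and wg: "cm w g \<in> gam H (Suc (Suc i))"
      using gam_cm_H[OF H] z w by auto
    have "z ^ q = cm (x ^ q) g"
      using commute[OF zi z(2)] i z by (simp add: cm_power_left)
    also have "\<dots> = cm w g ^ q"
      using commute[OF wg w(1)] i w by (simp add: cm_power_left)
    finally show "z \<in> Kq (Suc (Suc i))"
      using gam_le[OF zi, of 4] wg i by (auto simp: Kq_def)
  qed
  hence "gam H (Suc i) \<subseteq> Kq (Suc (Suc i))"
    using gen_least[OF K] gam_Suc[of i H] i by simp
  thus ?thesis using v by (auto simp: Kq_def)
qed

lemma power_q_gam_5:
  assumes D: "\<And>v. v \<in> gam H 5 \<Longrightarrow> \<exists>w\<in>gam H 6. v ^ q = w ^ q" and v: "v \<in> gam H 5"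
  shows "v ^ q = 1"
proof -
  have six: "w ^ q = 1" if w: "w \<in> gam H 6" for w
    using power_q_descend[of 5 w] D w triv by (simp add: numeral_eq_Suc)
  show ?thesis using D[OF v] six by metis
qed

text \<open>In \<open>power_cm_q\<close> for x and for x y the e-th powers agree, being powers of
  conjugate elements, and the factors with [u, x, u] come from gamma_5. So modulo
  \<open>Kq 5\<close> the two brackets [u, x, x] agree, which is the hypothesis of the class 4
  result.\<close>

lemma two_generator_power_q:
  assumes gen: "H = gen {x0, y0}" and v: "v \<in> gam H 4"
  shows "v ^ q = 1"
proof -
  obtain \<phi> :: "'a \<Rightarrow> 'a set bperm" where \<phi>: "grp_hom H \<phi>" "\<And>x. x \<in> H \<Longrightarrow> \<phi> x = 1 \<longleftrightarrow> x \<in> Kq 5"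
    "subgrp (\<phi> ` H)" "gam (\<phi> ` H) 5 = {1}" "\<And>v. v \<in> gam (\<phi> ` H) 4 \<Longrightarrow> v ^ 3 = 1"
    using quotient_Kq[of 5] by auto
  interpret h: grp_hom H \<phi> by (rule \<phi>(1))
  have eng: "brk (cm y (x * y)) [x * y, x * y] = brk (cm y x) [x, x]"
    if xy: "x \<in> \<phi> ` H" "y \<in> \<phi> ` H" for x y
  proof -
    from xy obtain a b where ab: "a \<in> H" "b \<in> H" "x = \<phi> a" "y = \<phi> b" by auto
    let ?u = "cm b a" and ?v = "cm b (a * b)"
    let ?d = "brk ?u [a, a]" and ?d' = "brk ?v [a * b, a * b]"
    let ?f = "cm (cm ?u a) ?u" and ?f' = "cm (cm ?v (a * b)) ?v"
    have abH: "a * b \<in> H" using ab Hmult by blast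
    have u: "?u \<in> gam H 2" and v: "?v \<in> gam H 2"
      using gam_cm[OF H, of b 1 a 1 2] gam_cm[OF H, of b 1 "a * b" 1 2] ab abH by auto
    have m: "?d \<in> gam H 4" "?d' \<in> gam H 4"
      using brk_mem[OF H u, of "[a, a]"] brk_mem[OF H v, of "[a * b, a * b]"] ab abH by auto
    have f: "?f \<in> gam H 5" "?f' \<in> gam H 5"
      using gam_cm[OF H gam_cm[OF H u, of a 1 3] u, of 5] gam_cm[OF H gam_cm[OF H v, of "a * b" 1 3] v, of 5] ab abH
      by auto
    have f4: "?f \<in> gam H 4" "?f' \<in> gam H 4" using gam_le[OF f(1), of 4] gam_le[OF f(2), of 4] by auto
    have "?v = cj ?u b" by (simp add: cm_mult_right_cj)
    hence "?v ^ e = ?u ^ e"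
      using central[OF sub[OF u] ab(2)] by (simp add: cj_power[symmetric] cj_eq_self_iff)
    hence "?u ^ e * (?d ^ q * ?f ^ q) = ?u ^ e * (?d' ^ q * ?f' ^ q)"
      using power_cm_q[OF ab(1,2)] power_cm_q[OF abH ab(2)] by (simp add: mult.assoc)
    hence "?d ^ q * ?f ^ q = ?d' ^ q * ?f' ^ q" by (simp only: mult_left_cancel)
    hence eq: "iv (?d' ^ q) * ?d ^ q = ?f' ^ q * iv (?f ^ q)" by (rule mult_eq_mult_cross)
    have "(iv ?d' * ?d) ^ q = iv (?d' ^ q) * ?d ^ q"
      using power_q_mult[OF gamiv[OF m(2)] m(1)] by (simp only: iv_power)
    also have "\<dots> = ?f' ^ q * iv (?f ^ q)" by (rule eq)
    also have "\<dots> = (?f' * iv ?f) ^ q"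
      using power_q_mult[OF f4(2) gamiv[OF f4(1)]] by (simp only: iv_power)
    finally have "(iv ?d' * ?d) ^ q = (?f' * iv ?f) ^ q" .
    moreover have "?f' * iv ?f \<in> gam H 5" "iv ?d' * ?d \<in> gam H 4"
      by (rule gammult[OF f(2) gamiv[OF f(1)]], rule gammult[OF gamiv[OF m(2)] m(1)])
    ultimately have k: "iv ?d' * ?d \<in> Kq 5" unfolding Kq_def by blast
    have dH: "?d \<in> H" "?d' \<in> H" using m sub by blast+
    have "\<phi> (iv ?d' * ?d) = 1" using k \<phi>(2) Kq_normal(2)[of 5] by auto
    hence "iv (\<phi> ?d') * \<phi> ?d = 1" using dH Hiv by (simp add: h.hom h.hom_iv)
    hence "\<phi> ?d' = \<phi> ?d" by (rule eq_iff_iv_mult[THEN iffD2])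
    thus ?thesis using ab abH u v sub by (simp add: h.hom h.hom_cm cm_H)
  qed
  have "{x0, y0} \<subseteq> H" unfolding gen by auto
  hence gen': "\<phi> ` H = gen {\<phi> x0, \<phi> y0}" using h.image_gen[of "{x0, y0}"] gen by simp
  have g4: "gam (\<phi> ` H) 4 = {1}"
    by (rule two_generator_class_four[OF \<phi>(3,4,5) eng gen'])
  have D: "\<exists>w\<in>gam H (Suc 4). v ^ q = w ^ q" if "v \<in> gam H 4" for v
  proof -
    have "\<phi> v = 1" using g4 that h.image_gam[of 4] by blast
    thus ?thesis using \<phi>(2) sub that by (auto simp: Kq_def)
  qed
  have "w ^ q = 1" if "w \<in> gam H 5" for w
    using power_q_gam_5[OF _ that] power_q_descend[OF _ D] by simp
  thus ?thesis using D[OF v] by auto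
qed

lemma class_six_subgroup:
  assumes "subgrp H0" "H0 \<subseteq> H"
  shows "class_six H0 e"
proof
  show "gam H0 7 = {1}" using gam_mono[OF assms, of 7] triv gam_1[OF assms(1), of 7] by auto
qed (use assms central e in auto)

text \<open>Both claims involve only \<open>x\<close> and \<open>y\<close>, so they can be proved in
  the subgroup generated by these two elements.\<close>

lemma engel_power_q:
  assumes x: "x \<in> H" and y: "y \<in> H"
  shows "brk y [x, x, x] ^ q = 1" and "cm y x ^ e = 1"
proof -
  let ?H = "gen {x, y}"
  have sub0: "?H \<subseteq> H" using x y by (intro gen_least H) auto
  interpret s: class_six ?H e by (rule class_six_subgroup[OF subgrp_gen sub0])
  have xy: "x \<in> ?H" "y \<in> ?H" by auto
  have u: "cm y x \<in> gam ?H 2" using gam_cm[OF s.H, of y 1 x 1 2] xy by simp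
  have d: "brk (cm y x) [x, x] \<in> gam ?H 4" using brk_mem[OF s.H u, of "[x, x]"] xy by simp
  have "cm (cm (cm y x) x) (cm y x) \<in> gam ?H 4"
    using gam_cm[OF s.H gam_cm[OF s.H u, of x 1 3] u, of 4] xy by simp
  hence f: "cm (cm (cm y x) x) (cm y x) ^ q = 1" by (rule s.two_generator_power_q[OF HOL.refl])
  have d1: "brk (cm y x) [x, x] ^ q = 1" by (rule s.two_generator_power_q[OF HOL.refl d])
  thus "brk y [x, x, x] ^ q = 1" by simp
  show "cm y x ^ e = 1" using s.power_cm_q[OF xy] f d1 by simp
qed

text \<open>By \<open>engel_power_q\<close> the quotient by \<open>Kq 6\<close> satisfies the
  3-Engel law. That its gamma_5 vanishes means that q-th powers from gamma_5 are q-th powers from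
  gamma_6, where the descent starts.\<close>

lemma gam_5_power_q:
  assumes v: "v \<in> gam H 5"
  shows "v ^ q = 1"
proof -
  obtain \<phi> :: "'a \<Rightarrow> 'a set bperm" where \<phi>: "grp_hom H \<phi>" "\<And>x. x \<in> H \<Longrightarrow> \<phi> x = 1 \<longleftrightarrow> x \<in> Kq 6"
    "subgrp (\<phi> ` H)" "gam (\<phi> ` H) 6 = {1}" "\<And>v. v \<in> gam (\<phi> ` H) 4 \<Longrightarrow> v ^ 3 = 1"
    using quotient_Kq[of 6] by auto
  interpret h: grp_hom H \<phi> by (rule \<phi>(1))
  have g5: "gam (\<phi> ` H) 5 = {1}"
  proof (rule three_engel_class_five[OF \<phi>(3,4,5)])
    fix x y assume "x \<in> \<phi> ` H" "y \<in> \<phi> ` H"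
    then obtain a b where ab: "a \<in> H" "b \<in> H" "x = \<phi> a" "y = \<phi> b" by auto
    have m: "brk b [a, a, a] \<in> gam H 4" using brk_mem[OF H, of b 1 "[a, a, a]"] ab by (simp add: numeral_eq_Suc)
    hence "brk b [a, a, a] \<in> Kq 6" using engel_power_q(1)[OF ab(1,2)] gam1[of 6]
      unfolding Kq_def by (intro CollectI conjI bexI[of _ 1]) simp_all
    hence "\<phi> (brk b [a, a, a]) = 1" using \<phi>(2) m sub by blast
    thus "brk y [x, x, x] = 1" using h.hom_brk[of b "[a, a, a]"] ab by simp
  qed
  have "\<exists>w\<in>gam H 6. v ^ q = w ^ q" if "v \<in> gam H 5" for v
  proof -
    have "\<phi> v = 1" using g5 that h.image_gam[of 5] by blast
    thus ?thesis using \<phi>(2) sub that by (auto simp: Kq_def)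
  qed
  thus ?thesis using power_q_gam_5 v by blast
qed

lemma exponent_gam_2:
  assumes u: "u \<in> gam H 2"
  shows "u ^ e = 1"
proof -
  have "u \<in> gen {cm x g | x g. x \<in> gam H 1 \<and> g \<in> H}"
    using u gam_Suc[of 1 H] by (simp add: numeral_2_eq_2)
  hence "u \<in> gam H 2 \<and> u ^ e = 1"
  proof induction
    case (gen_base u)
    then obtain x g where "u = cm x g" "x \<in> H" "g \<in> H" by auto
    thus ?case using engel_power_q(2) gam_cm[OF H, of x 1 g 1 2] by simp
  next
    case (gen_mult a b)
    \<comment> \<open>With x = b^-1 the collection formula compares (ab)^e b^-e with a^e. Its
      q-factors come from gamma_5, and its r-factor involves a bracket beyond gamma_7.\<close>
    have ib: "iv b \<in> gam H 2" using gen_mult gamiv by blast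
    have a: "a \<in> gam H 2" using gen_mult by blast
    have d: "cm a (iv b) \<in> gam H 4" using gam_cm[OF H a ib] by simp
    have d2: "brk a [iv b, iv b] \<in> gam H 5" and f: "cm (cm a (iv b)) a \<in> gam H 5"
      using gam_cm[OF H d ib, of 5] gam_cm[OF H d a, of 5] by simp_all
    have "brk a [iv b, iv b, iv b] \<in> gam H 7" using gam_cm[OF H d2 ib, of 7] by simp
    hence "brk a [iv b, iv b, iv b, iv b] = 1" using triv by simp
    moreover have "brk a [iv b, iv b] ^ q = 1" "cm (cm a (iv b)) a ^ q = 1"
      using gam_5_power_q d2 f by auto
    ultimately have "(a * iv (iv b)) ^ e * iv b ^ e = a ^ e"
      using power_formula[OF a sub[OF ib]] by simp
    thus ?case using gen_mult gammult by (simp add: iv_power[symmetric])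
  next
    case (gen_iv a)
    thus ?case using gamiv by (simp add: iv_power[symmetric])
  qed (simp add: gam1)
  thus ?thesis by simp
qed

end

section \<open>Power inclusions in arbitrary class, and transfer to central extensions\<close>

lemma gam_quotient:
  fixes H :: "'a::mult_group set"
  assumes H: "subgrp H"
  obtains \<phi> :: "'a \<Rightarrow> 'a set bperm" where "grp_hom H \<phi>" "\<And>x. x \<in> H \<Longrightarrow> \<phi> x = 1 \<longleftrightarrow> x \<in> gam H j"
    "subgrp (\<phi> ` H)" "gam (\<phi> ` H) j = {1}"
proof -
  obtain \<phi> :: "'a \<Rightarrow> 'a set bperm" where \<phi>: "\<And>x y. x \<in> H \<Longrightarrow> y \<in> H \<Longrightarrow> \<phi> (x * y) = \<phi> x * \<phi> y"
    "\<And>x. x \<in> H \<Longrightarrow> \<phi> x = 1 \<longleftrightarrow> x \<in> gam H j"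
    using quotient_map[OF H subgrp_gam[OF H] _ gam_cj[OF H], of j] gam_sub[OF H] by (metis subsetI)
  interpret h: grp_hom H \<phi> by unfold_locales (use H \<phi> in auto)
  show thesis
  proof
    show "grp_hom H \<phi>" by unfold_locales
    show "subgrp (\<phi> ` H)" using h.subgrp_image H by simp
    show "gam (\<phi> ` H) j = {1}"
      using \<phi>(2) gam_sub[OF H] gam_1[OF H, of j] by (force simp: h.image_gam[symmetric])
  qed (use \<phi> in auto)
qed

context
  fixes H :: "'a::mult_group set" and e :: nat
  assumes H: "subgrp H" and e: "odd e"
    and central: "\<And>x y. x \<in> H \<Longrightarrow> y \<in> H \<Longrightarrow> x ^ e * y = y * x ^ e"
begin

lemma gam_power_step:
  assumes m: "m \<ge> 1" and v: "v \<in> gam H (m + 1)"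
  shows "v ^ e \<in> gam H (3 * m + 1)"
proof -
  obtain \<phi> :: "'a \<Rightarrow> 'a set bperm" where \<phi>: "grp_hom H \<phi>" "\<And>x. x \<in> H \<Longrightarrow> \<phi> x = 1 \<longleftrightarrow> x \<in> gam H (3 * m + 1)"
    "subgrp (\<phi> ` H)" "gam (\<phi> ` H) (3 * m + 1) = {1}"
    using gam_quotient[OF H, of "3 * m + 1"] by metis
  interpret h: grp_hom H \<phi> by (rule \<phi>(1))
  have c: "x ^ e * y = y * x ^ e" if xy: "x \<in> \<phi> ` H" "y \<in> \<phi> ` H" for x y
  proof -
    from xy obtain a b where ab: "a \<in> H" "b \<in> H" "x = \<phi> a" "y = \<phi> b" by auto
    have "\<phi> (a ^ e * b) = \<phi> (b * a ^ e)" using central[OF ab(1,2)] by simp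
    thus ?thesis using ab subgrp_power[OF H] by (simp add: h.hom h.hom_power)
  qed
  have vH: "v \<in> H" using v gam_sub[OF H] by blast
  have vm: "\<phi> v \<in> gam (\<phi> ` H) (m + 1)" using v by (simp only: h.image_gam[symmetric] imageI)
  have "\<phi> v ^ e = 1" by (rule gam_power_eq_one[OF \<phi>(3) _ e m \<phi>(4) vm]) (rule c)
  hence "\<phi> (v ^ e) = 1" using vH by (simp add: h.hom_power)
  thus ?thesis using \<phi>(2) vH subgrp_power[OF H] by blast
qed

lemma gam_2_power:
  assumes v: "v \<in> gam H 2"
  shows "v ^ e \<in> gam H 7"
proof -
  obtain \<phi> :: "'a \<Rightarrow> 'a set bperm" where \<phi>: "grp_hom H \<phi>" "\<And>x. x \<in> H \<Longrightarrow> \<phi> x = 1 \<longleftrightarrow> x \<in> gam H 7"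
    "subgrp (\<phi> ` H)" "gam (\<phi> ` H) 7 = {1}"
    using gam_quotient[OF H, of 7] by metis
  interpret h: grp_hom H \<phi> by (rule \<phi>(1))
  have c: "x ^ e * y = y * x ^ e" if xy: "x \<in> \<phi> ` H" "y \<in> \<phi> ` H" for x y
  proof -
    from xy obtain a b where ab: "a \<in> H" "b \<in> H" "x = \<phi> a" "y = \<phi> b" by auto
    have "\<phi> (a ^ e * b) = \<phi> (b * a ^ e)" using central[OF ab(1,2)] by simp
    thus ?thesis using ab subgrp_power[OF H] by (simp add: h.hom h.hom_power)
  qed
  interpret c6: class_six "\<phi> ` H" e by unfold_locales (use \<phi> c e in auto)
  have vH: "v \<in> H" using v gam_sub[OF H] by blast
  have "\<phi> v \<in> gam (\<phi> ` H) 2" using v by (simp only: h.image_gam[symmetric] imageI)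
  hence "\<phi> v ^ e = 1" by (rule c6.exponent_gam_2)
  hence "\<phi> (v ^ e) = 1" using vH by (simp add: h.hom_power)
  thus ?thesis using \<phi>(2) vH subgrp_power[OF H] by blast
qed

text \<open>The start 7 = 2 * 3 + 1 already has the form m + 1 with m = 2 * 3, and each further
  round replaces m by 3m.\<close>

theorem gam_2_power_power:
  assumes v: "v \<in> gam H 2"
  shows "v ^ (e ^ Suc n) \<in> gam H (2 * 3 ^ Suc n + 1)"
proof (induction n)
  case 0
  show ?case using gam_2_power[OF v] by simp
next
  case (Suc n)
  have "(v ^ (e ^ Suc n)) ^ e \<in> gam H (3 * (2 * 3 ^ Suc n) + 1)"
    by (rule gam_power_step[OF _ Suc]) simp
  thus ?case by (simp add: power_mult[symmetric] mult.commute mult.left_commute)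
qed

end

text \<open>\<open>R\<close> plays the role of a homomorphism with central kernel from \<open>H\<close> to \<open>G\<close>.\<close>

locale central_relation = group G for G :: "('a, 'b) monoid_scheme" (structure) +
  fixes H :: "'h::mult_group set" and R :: "'h \<Rightarrow> 'a \<Rightarrow> bool"
  assumes subH: "subgrp H"
    and total: "h \<in> H \<Longrightarrow> \<exists>g\<in>carrier G. R h g"
    and R_mult: "h \<in> H \<Longrightarrow> h' \<in> H \<Longrightarrow> g \<in> carrier G \<Longrightarrow> g' \<in> carrier G \<Longrightarrow> R h g \<Longrightarrow> R h' g' \<Longrightarrow> R (h * h') (g \<otimes> g')"
    and R_iv: "h \<in> H \<Longrightarrow> g \<in> carrier G \<Longrightarrow> R h g \<Longrightarrow> R (iv h) (inv g)"
    and R_central: "h \<in> H \<Longrightarrow> R h \<one> \<Longrightarrow> h' \<in> H \<Longrightarrow> h * h' = h' * h"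
begin

lemma R_one: "R 1 \<one>"
proof -
  obtain g where g: "g \<in> carrier G" "R 1 g" using total[of 1] subgrpD(1)[OF subH] by blast
  hence "R (1 * iv 1) (g \<otimes> inv g)" using R_iv[OF _ g] subgrpD(1)[OF subH] by (intro R_mult) auto
  thus ?thesis using g by simp
qed

lemma lower_central_subgroup: "subgroup (lower_central G i) G"
proof (induction i)
  case 0
  show ?case by (simp add: subgroup_self)
next
  case (Suc i)
  have "lower_central G i \<subseteq> carrier G" using subgroup.subset[OF Suc] .
  thus ?case by (auto intro!: generate_is_subgroup)
qed

lemma lc_related: "h \<in> lc H i \<Longrightarrow> \<exists>g\<in>lower_central G i. R h g"
proof (induction i arbitrary: h)
  case 0
  thus ?case using total by simp
next
  case (Suc i)
  note sub = lower_central_subgroup[of i] lower_central_subgroup[of "Suc i"]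
  have inH: "gen {cm x g | x g. x \<in> lc H i \<and> g \<in> H} \<subseteq> H"
    using lc_sub[OF subH, of "Suc i"] by (simp add: lc.simps)
  have "h \<in> gen {cm x g | x g. x \<in> lc H i \<and> g \<in> H}" using Suc.prems by (simp add: lc.simps)
  thus ?case
  proof induction
    case gen_one
    thus ?case using R_one subgroup.one_closed[OF sub(2)] by blast
  next
    case (gen_base h)
    then obtain x y where xy: "h = cm x y" "x \<in> lc H i" "y \<in> H" by auto
    then obtain a b where ab: "a \<in> lower_central G i" "R x a" "b \<in> carrier G" "R y b"
      using Suc.IH total by meson
    have xH: "x \<in> H" using xy lc_sub[OF subH] by blast
    have aG: "a \<in> carrier G" using ab(1) subgroup.subset[OF sub(1)] by blast
    have "R h (inv a \<otimes> inv b \<otimes> a \<otimes> b)"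
      unfolding xy(1) cm_def using xH xy(3) ab aG subgrpD[OF subH]
      by (intro R_mult R_iv m_closed inv_closed) auto
    \<comment> \<open>The commutator of \<open>cm\<close> is a^-1 b^-1 a b, that of
      \<open>lower_central\<close> is x g x^-1 g^-1; inverting both entries converts one into the
      other.\<close>
    moreover have "inv a \<otimes> inv b \<otimes> a \<otimes> b \<in> lower_central G (Suc i)"
    proof -
      have "inv a \<otimes> inv b \<otimes> inv (inv a) \<otimes> inv (inv b) \<in> lower_central G (Suc i)"
        unfolding lower_central.simps using subgroup.m_inv_closed[OF sub(1) ab(1)] inv_closed[OF ab(3)]
        by (intro generate.incl) blast
      thus ?thesis using aG ab(3) by simp
    qed
    ultimately show ?case by blast
  next
    case (gen_mult x y)
    then obtain a b where ab: "a \<in> lower_central G (Suc i)" "R x a" "b \<in> lower_central G (Suc i)" "R y b"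
      by blast
    hence "R (x * y) (a \<otimes> b)"
      using gen_mult inH subgroup.subset[OF sub(2)] by (intro R_mult) blast+
    thus ?case using ab subgroup.m_closed[OF sub(2)] by blast
  next
    case (gen_iv x)
    then obtain a where a: "a \<in> lower_central G (Suc i)" "R x a" by blast
    hence "R (iv x) (inv a)"
      using gen_iv inH subgroup.subset[OF sub(2)] by (intro R_iv) blast+
    thus ?case using a subgroup.m_inv_closed[OF sub(2)] by blast
  qed
qed

lemma power_related: "h \<in> H \<Longrightarrow> g \<in> carrier G \<Longrightarrow> R h g \<Longrightarrow> R (h ^ n) (g [^] n)"
proof (induction n)
  case (Suc n)
  hence "R (h ^ n * h) (g [^] n \<otimes> g)" by (intro R_mult subgrp_power[OF subH]) auto
  thus ?case by (simp only: power_Suc2 nat_pow_Suc)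
qed (simp add: R_one)

theorem gam_2_exponent:
  assumes e: "odd e" "\<And>x. x \<in> carrier G \<Longrightarrow> x [^] e = \<one>"
    and c: "lower_central G c = {\<one>}" "c + 1 \<le> 2 * 3 ^ n" "n \<ge> 1" and u: "u \<in> gam H 2"
  shows "u ^ (e ^ n) = 1"
proof -
  have central: "x ^ e * y = y * x ^ e" if xy: "x \<in> H" "y \<in> H" for x y
  proof -
    obtain g where g: "g \<in> carrier G" "R x g" using total xy by blast
    have "R (x ^ e) \<one>" using power_related[OF xy(1) g, of e] e(2)[OF g(1)] by simp
    thus ?thesis using xy subgrp_power[OF subH] by (intro R_central) auto
  qed
  \<comment> \<open>Elements of \<open>lc H c\<close> are related to the identity of
    \<open>G\<close> and hence central, so the class grows by at most one. With the index shift,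
    \<open>gam H (c + 2)\<close> is \<open>lc H (c + 1)\<close>.\<close>
  have "gam H (c + 2) = {1}"
  proof -
    have "cm x g = 1" if "x \<in> lc H c" "g \<in> H" for x g
    proof -
      have "R x \<one>" using lc_related[OF that(1)] c(1) by simp
      moreover have "x \<in> H" using that(1) lc_sub[OF subH] by blast
      ultimately show ?thesis using R_central that(2) by (simp add: cm_eq_one_iff)
    qed
    hence "{cm x g | x g. x \<in> lc H c \<and> g \<in> H} \<subseteq> {1}" by auto
    hence "gen {cm x g | x g. x \<in> lc H c \<and> g \<in> H} \<subseteq> {1}"
      by (intro gen_least) (auto simp: subgrp_def)
    thus ?thesis using gen_one[of "{cm x g | x g. x \<in> lc H c \<and> g \<in> H}"]
      by (auto simp: gam_def lc.simps)
  qed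
  moreover obtain k where k: "n = Suc k" using c(3) by (cases n) auto
  have "u ^ (e ^ Suc k) \<in> gam H (2 * 3 ^ Suc k + 1)"
    by (rule gam_2_power_power[OF subH e(1) central u])
  hence m: "u ^ (e ^ n) \<in> gam H (2 * 3 ^ n + 1)" by (simp only: k)
  have "u ^ (e ^ n) \<in> gam H (c + 2)"
    by (rule gam_antimono[OF subH _ m]) (use c(2) in simp)
  ultimately show ?thesis by simp
qed

end

section \<open>Universal properties of presented groups and of the exterior square\<close>

fun eval_word :: "('m, 'n) monoid_scheme \<Rightarrow> ('s \<Rightarrow> 'm) \<Rightarrow> 's word \<Rightarrow> 'm" where
  "eval_word M f [] = \<one>\<^bsub>M\<^esub>"
| "eval_word M f ((b, s) # u) = (if b then f s else inv\<^bsub>M\<^esub> f s) \<otimes>\<^bsub>M\<^esub> eval_word M f u"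

lemma (in group) presented_group_universal:
  assumes f: "\<And>s. s \<in> S \<Longrightarrow> f s \<in> carrier G"
    and rel: "\<And>u v. (u, v) \<in> R \<Longrightarrow> u \<in> words S \<Longrightarrow> v \<in> words S \<Longrightarrow> eval_word G f u = eval_word G f v"
  obtains h where "h \<in> hom (presented_group S R) G"
    "\<And>s. s \<in> S \<Longrightarrow> h (word_class S R [(True, s)]) = f s"
proof -
  have closed: "eval_word G f u \<in> carrier G" if "u \<in> words S" for u
    using that by (induction u) (auto simp: f split: if_splits)
  have app: "eval_word G f (u @ v) = eval_word G f u \<otimes> eval_word G f v"
    if "u \<in> words S" "v \<in> words S" for u v
    using that(1)
  proof (induction u)
    case Nil
    thus ?case using closed[OF that(2)] by simp
  next
    case (Cons a u)
    obtain b s where "a = (b, s)" by (cases a)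
    thus ?case using Cons closed[OF that(2)] closed[of u] f by (auto simp: m_assoc)
  qed
  have eq: "eval_word G f u = eval_word G f v" if "word_eq S R u v" for u v
    using that
  proof induction
    case (append u u' v v')
    thus ?case using word_eq_words[OF append.hyps(1)] word_eq_words[OF append.hyps(2)] by (simp only: app)
  next
    case (cancel s b)
    thus ?case using f by (cases b) auto
  qed (use rel in auto)
  define h where "h X = eval_word G f (SOME u. u \<in> X)" for X
  have h: "h (word_class S R u) = eval_word G f u" if "u \<in> words S" for u
  proof -
    have "u \<in> word_class S R u" using that by (auto simp: word_class_def intro: word_eq.refl)
    hence "(SOME v. v \<in> word_class S R u) \<in> word_class S R u" by (rule someI)
    hence "word_eq S R u (SOME v. v \<in> word_class S R u)" by (simp add: word_class_def)
    thus ?thesis using eq unfolding h_def by simp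
  qed
  show thesis
  proof
    show "h \<in> hom (presented_group S R) G"
    proof (rule homI)
      fix X assume "X \<in> carrier (presented_group S R)"
      then obtain u where "u \<in> words S" "X = word_class S R u"
        unfolding carrier_presented_group by blast
      thus "h X \<in> carrier G" using h closed by simp
    next
      fix X Y assume "X \<in> carrier (presented_group S R)" "Y \<in> carrier (presented_group S R)"
      then obtain u v where uv: "u \<in> words S" "X = word_class S R u" "v \<in> words S" "Y = word_class S R v"
        unfolding carrier_presented_group by blast
      have "u @ v \<in> words S" using uv(1,3) by (simp del: in_lists_conv_set)
      thus "h (X \<otimes>\<^bsub>presented_group S R\<^esub> Y) = h X \<otimes> h Y"
        using h app[OF uv(1,3)] uv(1,3) by (simp only: uv(2,4) mult_word_class)
    qed
    fix s assume "s \<in> S"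
    thus "h (word_class S R [(True, s)]) = f s" using h[of "[(True, s)]"] f by simp
  qed
qed

lemma presented_group_induct [consumes 1, case_names one mult inv_mult]:
  assumes X: "X \<in> carrier (presented_group S R)"
    and one: "P \<one>\<^bsub>presented_group S R\<^esub>"
    and pos: "\<And>s X. s \<in> S \<Longrightarrow> X \<in> carrier (presented_group S R) \<Longrightarrow> P X \<Longrightarrow>
      P (word_class S R [(True, s)] \<otimes>\<^bsub>presented_group S R\<^esub> X)"
    and neg: "\<And>s X. s \<in> S \<Longrightarrow> X \<in> carrier (presented_group S R) \<Longrightarrow> P X \<Longrightarrow>
      P (inv\<^bsub>presented_group S R\<^esub> word_class S R [(True, s)] \<otimes>\<^bsub>presented_group S R\<^esub> X)"
  shows "P X"
proof -
  interpret P: group "presented_group S R" by (rule group_presented_group)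
  obtain u where u: "u \<in> words S" "X = word_class S R u"
    using X unfolding carrier_presented_group by blast
  have "P (word_class S R u)" using u(1)
  proof (induction u rule: list.induct)
    case Nil
    thus ?case using one by (simp add: one_presented_group)
  next
    case (Cons a u)
    obtain b s where a: "a = (b, s)" by (cases a)
    have s: "s \<in> S" and u: "u \<in> words S" using Cons.prems a by (simp_all add: mem_Times_iff del: in_lists_conv_set)
    have w: "[(b, s)] \<in> words S" for b using s by simp
    have c: "word_class S R [(b, s)] \<in> carrier (presented_group S R)" "word_class S R u \<in> carrier (presented_group S R)" for b
      using w u unfolding carrier_presented_group by blast+
    have "word_class S R (a # u) = word_class S R [(b, s)] \<otimes>\<^bsub>presented_group S R\<^esub> word_class S R u"
      using mult_word_class[OF w u, of R] a by simp
    moreover have "word_class S R [(False, s)] = inv\<^bsub>presented_group S R\<^esub> word_class S R [(True, s)]"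
      using P.inv_equality[OF letter_inverse[OF s, of R False]] c by simp
    ultimately show ?case
      using pos[OF s c(2) Cons.IH[OF u]] neg[OF s c(2) Cons.IH[OF u]] by (cases b) simp_all
  qed
  thus ?thesis using u by simp
qed

section \<open>The exterior square and the action of G on it\<close>

definition wedge :: "('a, 'b) monoid_scheme \<Rightarrow> 'a \<Rightarrow> 'a \<Rightarrow> ('a \<times> 'a) word set set" where
  "wedge G g h = nabla G #>\<^bsub>tensor_square G\<^esub> tensor G g h"

context group
begin

abbreviation "L \<equiv> exterior_square G"

interpretation T: group "tensor_square G" by (rule group_tensor_square)
interpretation L: group L by (rule group_exterior_square)
interpretation N: normal "nabla G" "tensor_square G" by (rule nabla_normal)

lemma coset_hom: "(\<lambda>a. nabla G #>\<^bsub>tensor_square G\<^esub> a) \<in> hom (tensor_square G) L"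
  unfolding exterior_square_def by (rule N.r_coset_hom_Mod)

lemma wedge_closed [simp]: "g \<in> carrier G \<Longrightarrow> h \<in> carrier G \<Longrightarrow> wedge G g h \<in> carrier L"
  unfolding wedge_def by (rule hom_in_carrier[OF coset_hom tensor_closed])

lemma coset_mult:
  "x \<in> carrier (tensor_square G) \<Longrightarrow> y \<in> carrier (tensor_square G) \<Longrightarrow>
   nabla G #>\<^bsub>tensor_square G\<^esub> (x \<otimes>\<^bsub>tensor_square G\<^esub> y) =
   (nabla G #>\<^bsub>tensor_square G\<^esub> x) \<otimes>\<^bsub>L\<^esub> (nabla G #>\<^bsub>tensor_square G\<^esub> y)"
  using hom_mult[OF coset_hom] .

lemma wedge_mult_left:
  assumes "g \<in> carrier G" "g' \<in> carrier G" "h \<in> carrier G"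
  shows "wedge G (g \<otimes> g') h = wedge G (conj_by G g g') (conj_by G g h) \<otimes>\<^bsub>L\<^esub> wedge G g h"
  unfolding wedge_def tensor_mult_left[OF assms]
  by (rule coset_mult; intro tensor_closed conj_by_closed assms)

lemma wedge_mult_right:
  assumes "g \<in> carrier G" "h \<in> carrier G" "h' \<in> carrier G"
  shows "wedge G g (h \<otimes> h') = wedge G g h \<otimes>\<^bsub>L\<^esub> wedge G (conj_by G h g) (conj_by G h h')"
  unfolding wedge_def tensor_mult_right[OF assms]
  by (rule coset_mult; intro tensor_closed conj_by_closed assms)

lemma wedge_commute:
  assumes "g \<in> carrier G" "h \<in> carrier G" "a \<in> carrier G" "b \<in> carrier G"
  shows "wedge G (conj_by G (g \<otimes> h) a) (conj_by G (g \<otimes> h) b) \<otimes>\<^bsub>L\<^esub> wedge G g h =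
         wedge G g h \<otimes>\<^bsub>L\<^esub> wedge G (conj_by G (h \<otimes> g) a) (conj_by G (h \<otimes> g) b)"
    (is "?gh \<otimes>\<^bsub>L\<^esub> ?w = ?w \<otimes>\<^bsub>L\<^esub> ?hg")
proof -
  let ?q = "\<lambda>a. nabla G #>\<^bsub>tensor_square G\<^esub> a"
  let ?t = "tensor G (conj_by G (g \<otimes> h) a) (conj_by G (g \<otimes> h) b)"
  let ?t' = "tensor G (conj_by G (h \<otimes> g) a) (conj_by G (h \<otimes> g) b)"
  have c: "?t \<in> carrier (tensor_square G)" "?t' \<in> carrier (tensor_square G)" "tensor G g h \<in> carrier (tensor_square G)"
    by (intro tensor_closed conj_by_closed m_closed assms)+
  have "?gh \<otimes>\<^bsub>L\<^esub> ?w = ?q (?t \<otimes>\<^bsub>tensor_square G\<^esub> tensor G g h)"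
    unfolding wedge_def by (rule coset_mult[OF c(1,3), symmetric])
  also have "\<dots> = ?q (tensor G g h \<otimes>\<^bsub>tensor_square G\<^esub> ?t')"
    unfolding tensor_commute[OF assms] ..
  also have "\<dots> = ?w \<otimes>\<^bsub>L\<^esub> ?hg"
    unfolding wedge_def by (rule coset_mult[OF c(3,2)])
  finally show ?thesis .
qed

lemma wedge_self:
  assumes "x \<in> carrier G" shows "wedge G x x = \<one>\<^bsub>L\<^esub>"
proof -
  have "tensor G x x \<in> nabla G" using assms unfolding nabla_def by (auto intro: generate.incl)
  hence "wedge G x x = nabla G"
    unfolding wedge_def by (rule T.coset_join2[OF tensor_closed[OF assms assms] N.subgroup_axioms])
  thus ?thesis by (simp add: exterior_square_def)
qed

lemma exterior_induct [consumes 1, case_names one mult inv_mult]: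
  assumes l: "l \<in> carrier L" and P_one: "P \<one>\<^bsub>L\<^esub>"
    and pos: "\<And>g h l. g \<in> carrier G \<Longrightarrow> h \<in> carrier G \<Longrightarrow> l \<in> carrier L \<Longrightarrow> P l \<Longrightarrow> P (wedge G g h \<otimes>\<^bsub>L\<^esub> l)"
    and neg: "\<And>g h l. g \<in> carrier G \<Longrightarrow> h \<in> carrier G \<Longrightarrow> l \<in> carrier L \<Longrightarrow> P l \<Longrightarrow> P (inv\<^bsub>L\<^esub> wedge G g h \<otimes>\<^bsub>L\<^esub> l)"
  shows "P l"
proof -
  let ?q = "\<lambda>a. nabla G #>\<^bsub>tensor_square G\<^esub> a"
  interpret q: group_hom "tensor_square G" L ?q
    by unfold_locales (rule coset_hom)
  obtain X where X: "X \<in> carrier (tensor_square G)" "l = ?q X"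
    using l unfolding exterior_square_def carrier_FactGroup by blast
  have "P (?q X)"
    using X(1) unfolding tensor_square_def
  proof (induction X rule: presented_group_induct)
    case one
    show ?case using P_one q.hom_one[unfolded tensor_square_def] by simp
  next
    case (mult s X)
    obtain g h where s: "s = (g, h)" "g \<in> carrier G" "h \<in> carrier G" using mult(1) by auto
    have "?q (tensor G g h \<otimes>\<^bsub>tensor_square G\<^esub> X) = wedge G g h \<otimes>\<^bsub>L\<^esub> ?q X"
      using mult s by (simp add: wedge_def tensor_closed tensor_square_def[symmetric])
    thus ?case using pos[OF s(2,3), of "?q X"] mult s
      by (simp add: tensor_square_def[symmetric] tensor_def)
  next
    case (inv_mult s X)
    obtain g h where s: "s = (g, h)" "g \<in> carrier G" "h \<in> carrier G" using inv_mult(1) by auto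
    have "?q (inv\<^bsub>tensor_square G\<^esub> tensor G g h \<otimes>\<^bsub>tensor_square G\<^esub> X) = inv\<^bsub>L\<^esub> wedge G g h \<otimes>\<^bsub>L\<^esub> ?q X"
      using inv_mult s by (simp add: wedge_def tensor_closed tensor_square_def[symmetric])
    thus ?case using neg[OF s(2,3), of "?q X"] inv_mult s
      by (simp add: tensor_square_def[symmetric] tensor_def)
  qed
  thus ?thesis using X by simp
qed

lemma exterior_hom_eq:
  assumes "group M" "\<theta> \<in> hom L M" "\<theta>' \<in> hom L M"
    and eq: "\<And>g h. g \<in> carrier G \<Longrightarrow> h \<in> carrier G \<Longrightarrow> \<theta> (wedge G g h) = \<theta>' (wedge G g h)"
    and l: "l \<in> carrier L"
  shows "\<theta> l = \<theta>' l"
proof -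
  interpret t: group_hom L M \<theta> using assms by (simp add: group_hom_def group_hom_axioms_def)
  interpret t': group_hom L M \<theta>' using assms by (simp add: group_hom_def group_hom_axioms_def)
  show ?thesis using l by (induction rule: exterior_induct) (simp_all add: eq)
qed

lemma exterior_universal:
  assumes M: "group M" and f: "\<And>g h. g \<in> carrier G \<Longrightarrow> h \<in> carrier G \<Longrightarrow> f g h \<in> carrier M"
    and left: "\<And>g g' h. g \<in> carrier G \<Longrightarrow> g' \<in> carrier G \<Longrightarrow> h \<in> carrier G \<Longrightarrow>
      f (g \<otimes> g') h = f (conj_by G g g') (conj_by G g h) \<otimes>\<^bsub>M\<^esub> f g h"
    and right: "\<And>g h h'. g \<in> carrier G \<Longrightarrow> h \<in> carrier G \<Longrightarrow> h' \<in> carrier G \<Longrightarrow>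
      f g (h \<otimes> h') = f g h \<otimes>\<^bsub>M\<^esub> f (conj_by G h g) (conj_by G h h')"
    and self: "\<And>x. x \<in> carrier G \<Longrightarrow> f x x = \<one>\<^bsub>M\<^esub>"
  obtains \<theta> where "\<theta> \<in> hom L M"
    "\<And>g h. g \<in> carrier G \<Longrightarrow> h \<in> carrier G \<Longrightarrow> \<theta> (wedge G g h) = f g h"
proof -
  interpret M: group M by (rule M)
  obtain t where t: "t \<in> hom (tensor_square G) M"
    "\<And>s. s \<in> carrier G \<times> carrier G \<Longrightarrow> t (word_class (carrier G \<times> carrier G) (tensor_relations G) [(True, s)]) = (case s of (g, h) \<Rightarrow> f g h)"
  proof (rule M.presented_group_universal[of "carrier G \<times> carrier G" "\<lambda>(g, h). f g h" "tensor_relations G"])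
    fix u v assume "(u, v) \<in> tensor_relations G"
    thus "eval_word M (\<lambda>(g, h). f g h) u = eval_word M (\<lambda>(g, h). f g h) v"
      unfolding tensor_relations_def using f left right by (auto simp: conj_by_closed)
  qed (use f in \<open>auto simp: tensor_square_def\<close>)
  have tt: "t (tensor G g h) = f g h" if "g \<in> carrier G" "h \<in> carrier G" for g h
    using t(2)[of "(g, h)"] that by (simp add: tensor_def)
  interpret t: group_hom "tensor_square G" M t by unfold_locales (rule t(1))
  have "nabla G \<subseteq> kernel (tensor_square G) M t"
    unfolding nabla_def
    by (rule T.generate_subgroup_incl[OF _ t.subgroup_kernel]) (auto simp: kernel_def tensor_closed tt self)
  then obtain \<theta> where \<theta>: "\<theta> \<in> hom (tensor_square G Mod nabla G) M"
    "\<And>x. x \<in> carrier (tensor_square G) \<Longrightarrow> \<theta> (nabla G #>\<^bsub>tensor_square G\<^esub> x) = t x"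
    using t.FactGroup_universal_kernel[OF nabla_normal] by metis
  show thesis
  proof
    show "\<theta> \<in> hom L M" using \<theta>(1) by (simp add: exterior_square_def)
    fix g h assume gh: "g \<in> carrier G" "h \<in> carrier G"
    show "\<theta> (wedge G g h) = f g h"
      unfolding wedge_def using \<theta>(2)[OF tensor_closed[OF gh]] tt[OF gh] by simp
  qed
qed

lemma conj_by_conj: "g \<in> carrier G \<Longrightarrow> x \<in> carrier G \<Longrightarrow> y \<in> carrier G \<Longrightarrow>
  conj_by G g (conj_by G x y) = conj_by G (conj_by G g x) (conj_by G g y)"
  by (simp add: conj_by_def m_assoc inv_mult_group) (simp add: m_assoc[symmetric])

text \<open>The diagonal conjugation action. The universal property provides such an endomorphism,
  and \<open>exterior_hom_eq\<close> shows that it is determined by its values on the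
  generators.\<close>

definition act :: "'a \<Rightarrow> ('a \<times> 'a) word set set \<Rightarrow> ('a \<times> 'a) word set set" where
  "act g = (SOME \<theta>. \<theta> \<in> hom L L \<and>
    (\<forall>a\<in>carrier G. \<forall>b\<in>carrier G. \<theta> (wedge G a b) = wedge G (conj_by G g a) (conj_by G g b)))"

lemma act:
  assumes g: "g \<in> carrier G"
  shows "act g \<in> hom L L"
    "a \<in> carrier G \<Longrightarrow> b \<in> carrier G \<Longrightarrow> act g (wedge G a b) = wedge G (conj_by G g a) (conj_by G g b)"
proof -
  have "\<exists>\<theta>. \<theta> \<in> hom L L \<and>
    (\<forall>a\<in>carrier G. \<forall>b\<in>carrier G. \<theta> (wedge G a b) = wedge G (conj_by G g a) (conj_by G g b))"
  proof (rule exterior_universal[of L "\<lambda>a b. wedge G (conj_by G g a) (conj_by G g b)"])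
    show "group L" by unfold_locales
  qed (use g in \<open>auto simp: conj_by_mult conj_by_conj[symmetric] wedge_mult_left wedge_mult_right wedge_self\<close>)
  hence "act g \<in> hom L L \<and>
    (\<forall>a\<in>carrier G. \<forall>b\<in>carrier G. act g (wedge G a b) = wedge G (conj_by G g a) (conj_by G g b))"
    unfolding act_def by (rule someI_ex)
  thus "act g \<in> hom L L"
    "a \<in> carrier G \<Longrightarrow> b \<in> carrier G \<Longrightarrow> act g (wedge G a b) = wedge G (conj_by G g a) (conj_by G g b)"
    by auto
qed

lemma act_closed [simp]: "g \<in> carrier G \<Longrightarrow> l \<in> carrier L \<Longrightarrow> act g l \<in> carrier L"
  by (rule hom_in_carrier[OF act(1)])

lemma act_mult: "g \<in> carrier G \<Longrightarrow> l \<in> carrier L \<Longrightarrow> m \<in> carrier L \<Longrightarrow> act g (l \<otimes>\<^bsub>L\<^esub> m) = act g l \<otimes>\<^bsub>L\<^esub> act g m"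
  by (rule hom_mult[OF act(1)])

lemma act_group_hom: "g \<in> carrier G \<Longrightarrow> group_hom L L (act g)"
  using act(1) by (simp add: group_hom_def group_hom_axioms_def L.is_group)

lemma act_act:
  assumes "g \<in> carrier G" "h \<in> carrier G" "l \<in> carrier L"
  shows "act g (act h l) = act (g \<otimes> h) l"
proof -
  have hom: "(\<lambda>l. act g (act h l)) \<in> hom L L"
    by (rule homI) (simp_all add: assms act_mult)
  show ?thesis
    by (rule exterior_hom_eq[OF L.is_group hom act(1)[OF m_closed[OF assms(1,2)]] _ assms(3)])
       (simp add: assms act(2) conj_by_conj_by)
qed

lemma act_one: "l \<in> carrier L \<Longrightarrow> act \<one> l = l"
  using exterior_hom_eq[OF L.is_group act(1)[OF one_closed] id_iso[of L, THEN iso_imp_homomorphism]]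
  by (simp add: act(2) conj_by_one)

lemma act_inv_act: "g \<in> carrier G \<Longrightarrow> l \<in> carrier L \<Longrightarrow> act (inv g) (act g l) = l"
  "g \<in> carrier G \<Longrightarrow> l \<in> carrier L \<Longrightarrow> act g (act (inv g) l) = l"
  by (simp_all add: act_act act_one)

text \<open>In terms of the action the defining relations are derivation rules in the two variables;
  all later computations use them in this form.\<close>

lemma wedge_left: "g \<in> carrier G \<Longrightarrow> g' \<in> carrier G \<Longrightarrow> h \<in> carrier G \<Longrightarrow>
  wedge G (g \<otimes> g') h = act g (wedge G g' h) \<otimes>\<^bsub>L\<^esub> wedge G g h"
  by (simp add: wedge_mult_left act(2))

lemma wedge_right: "g \<in> carrier G \<Longrightarrow> h \<in> carrier G \<Longrightarrow> h' \<in> carrier G \<Longrightarrow>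
  wedge G g (h \<otimes> h') = wedge G g h \<otimes>\<^bsub>L\<^esub> act h (wedge G g h')"
  by (simp add: wedge_mult_right act(2))

lemma wedge_one_left: "h \<in> carrier G \<Longrightarrow> wedge G \<one> h = \<one>\<^bsub>L\<^esub>"
  using wedge_left[of \<one> \<one> h] by (simp add: act_one)

lemma wedge_swap:
  assumes x: "x \<in> carrier G" and y: "y \<in> carrier G"
  shows "wedge G x y = inv\<^bsub>L\<^esub> wedge G y x"
proof -
  interpret a: group_hom L L "act x" by (rule act_group_hom[OF x])
  have "\<one>\<^bsub>L\<^esub> = act x (wedge G y (x \<otimes> y)) \<otimes>\<^bsub>L\<^esub> wedge G x (x \<otimes> y)"
    using wedge_self[of "x \<otimes> y"] wedge_left[of x y "x \<otimes> y"] x y by simp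
  also have "wedge G x (x \<otimes> y) = act x (wedge G x y)"
    using wedge_right[of x x y] x y by (simp add: wedge_self)
  also have "wedge G y (x \<otimes> y) = wedge G y x"
    using wedge_right[of y x y] x y by (simp add: wedge_self)
  finally have "act x (wedge G y x \<otimes>\<^bsub>L\<^esub> wedge G x y) = \<one>\<^bsub>L\<^esub>" using x y by simp
  hence "act (inv x) (act x (wedge G y x \<otimes>\<^bsub>L\<^esub> wedge G x y)) = \<one>\<^bsub>L\<^esub>"
    using group_hom.hom_one[OF act_group_hom[of "inv x"]] x by simp
  hence "wedge G y x \<otimes>\<^bsub>L\<^esub> wedge G x y = \<one>\<^bsub>L\<^esub>"
    by (subst (asm) act_inv_act(1)) (use x y in simp_all)
  thus ?thesis using x y by (metis L.inv_equality L.inv_inv wedge_closed)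
qed

lemma wedge_inv_left:
  assumes x: "x \<in> carrier G" and y: "y \<in> carrier G"
  shows "wedge G (inv x) y = inv\<^bsub>L\<^esub> act (inv x) (wedge G x y)"
proof -
  have "act (inv x) (wedge G x y) \<otimes>\<^bsub>L\<^esub> wedge G (inv x) y = \<one>\<^bsub>L\<^esub>"
    using wedge_left[of "inv x" x y] x y by (simp add: wedge_one_left)
  thus ?thesis using x y by (metis L.inv_equality L.inv_inv wedge_closed act_closed inv_closed)
qed

lemma wedge_act_commute:
  assumes g: "g \<in> carrier G" and h: "h \<in> carrier G" and l: "l \<in> carrier L"
  shows "act (g \<otimes> h) l \<otimes>\<^bsub>L\<^esub> wedge G g h = wedge G g h \<otimes>\<^bsub>L\<^esub> act (h \<otimes> g) l"
proof -
  let ?w = "wedge G g h"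
  interpret a: group_hom L L "act (g \<otimes> h)" by (rule act_group_hom) (use g h in simp)
  interpret b: group_hom L L "act (h \<otimes> g)" by (rule act_group_hom) (use g h in simp)
  have w: "?w \<in> carrier L" using g h by simp
  have key: "act (g \<otimes> h) (wedge G a b) = ?w \<otimes>\<^bsub>L\<^esub> act (h \<otimes> g) (wedge G a b) \<otimes>\<^bsub>L\<^esub> inv\<^bsub>L\<^esub> ?w"
    if "a \<in> carrier G" "b \<in> carrier G" for a b
    using wedge_commute[OF g h that] g h that by (simp add: act(2) L.inv_solve_right)
  have "act (g \<otimes> h) l = (\<lambda>x. ?w \<otimes>\<^bsub>L\<^esub> act (h \<otimes> g) x \<otimes>\<^bsub>L\<^esub> inv\<^bsub>L\<^esub> ?w) l"
  proof (rule exterior_hom_eq[OF L.is_group a.homh _ key l])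
    show "(\<lambda>x. ?w \<otimes>\<^bsub>L\<^esub> act (h \<otimes> g) x \<otimes>\<^bsub>L\<^esub> inv\<^bsub>L\<^esub> ?w) \<in> hom L L"
    proof (rule homI)
      fix x y assume "x \<in> carrier L" "y \<in> carrier L"
      moreover have "inv\<^bsub>L\<^esub> ?w \<otimes>\<^bsub>L\<^esub> (?w \<otimes>\<^bsub>L\<^esub> z) = z" if "z \<in> carrier L" for z
        using w that by (simp add: L.m_assoc[symmetric])
      ultimately show "?w \<otimes>\<^bsub>L\<^esub> act (h \<otimes> g) (x \<otimes>\<^bsub>L\<^esub> y) \<otimes>\<^bsub>L\<^esub> inv\<^bsub>L\<^esub> ?w =
        ?w \<otimes>\<^bsub>L\<^esub> act (h \<otimes> g) x \<otimes>\<^bsub>L\<^esub> inv\<^bsub>L\<^esub> ?w \<otimes>\<^bsub>L\<^esub> (?w \<otimes>\<^bsub>L\<^esub> act (h \<otimes> g) y \<otimes>\<^bsub>L\<^esub> inv\<^bsub>L\<^esub> ?w)"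
        using w g h by (simp add: L.m_assoc)
    qed (use w g h in simp)
  qed
  thus ?thesis using w g h l by (simp add: L.m_assoc)
qed

lemma wedge_conj_exchange:
  assumes [simp]: "k \<in> carrier G" "j \<in> carrier G" "A \<in> carrier G" "a \<in> carrier G"
  shows "act k (wedge G j A) \<otimes>\<^bsub>L\<^esub> wedge G k (conj_by G A j \<otimes> a) =
    wedge G k j \<otimes>\<^bsub>L\<^esub> act j (wedge G k a) \<otimes>\<^bsub>L\<^esub> wedge G j A"
proof -
  interpret k: group_hom L L "act k" by (rule act_group_hom) simp
  let ?j = "conj_by G A j"
  have "act A (wedge G (conj_by G (inv A) k) j) = wedge G k ?j"
    by (simp add: act(2) conj_by_conj_by conj_by_one)
  moreover have "A \<otimes> conj_by G (inv A) k = k \<otimes> A" by (simp add: conj_by_def m_assoc[symmetric])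
  ultimately have "wedge G (k \<otimes> A) j = wedge G k ?j \<otimes>\<^bsub>L\<^esub> wedge G A j"
    using wedge_left[of A "conj_by G (inv A) k" j] by simp
  hence K: "wedge G k ?j \<otimes>\<^bsub>L\<^esub> wedge G A j = act k (wedge G A j) \<otimes>\<^bsub>L\<^esub> wedge G k j"
    using wedge_left[of k A j] by simp
  have swap: "wedge G A j = inv\<^bsub>L\<^esub> wedge G j A" by (rule wedge_swap) simp_all
  have K': "act k (wedge G j A) \<otimes>\<^bsub>L\<^esub> wedge G k ?j = wedge G k j \<otimes>\<^bsub>L\<^esub> wedge G j A"
  proof -
    have "wedge G k ?j \<otimes>\<^bsub>L\<^esub> inv\<^bsub>L\<^esub> wedge G j A = inv\<^bsub>L\<^esub> act k (wedge G j A) \<otimes>\<^bsub>L\<^esub> wedge G k j"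
      using K unfolding swap by simp
    hence "act k (wedge G j A) \<otimes>\<^bsub>L\<^esub> (wedge G k ?j \<otimes>\<^bsub>L\<^esub> inv\<^bsub>L\<^esub> wedge G j A) \<otimes>\<^bsub>L\<^esub> wedge G j A =
      act k (wedge G j A) \<otimes>\<^bsub>L\<^esub> (inv\<^bsub>L\<^esub> act k (wedge G j A) \<otimes>\<^bsub>L\<^esub> wedge G k j) \<otimes>\<^bsub>L\<^esub> wedge G j A"
      by simp
    moreover have "act k (wedge G j A) \<otimes>\<^bsub>L\<^esub> (inv\<^bsub>L\<^esub> act k (wedge G j A) \<otimes>\<^bsub>L\<^esub> wedge G k j) = wedge G k j"
      by (simp add: L.m_assoc[symmetric])
    ultimately show ?thesis by (simp add: L.m_assoc)
  qed
  have e: "j \<otimes> A \<otimes> inv A = j" "A \<otimes> j \<otimes> inv A = ?j" by (simp_all add: m_assoc conj_by_def)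
  have C: "act j (wedge G k a) \<otimes>\<^bsub>L\<^esub> wedge G j A = wedge G j A \<otimes>\<^bsub>L\<^esub> act ?j (wedge G k a)"
    using wedge_act_commute[of j A "act (inv A) (wedge G k a)"] by (simp add: act_act e)
  have "act k (wedge G j A) \<otimes>\<^bsub>L\<^esub> wedge G k (?j \<otimes> a) =
    (act k (wedge G j A) \<otimes>\<^bsub>L\<^esub> wedge G k ?j) \<otimes>\<^bsub>L\<^esub> act ?j (wedge G k a)"
    by (simp add: wedge_right L.m_assoc)
  also have "\<dots> = wedge G k j \<otimes>\<^bsub>L\<^esub> (wedge G j A \<otimes>\<^bsub>L\<^esub> act ?j (wedge G k a))"
    unfolding K' by (simp add: L.m_assoc)
  finally show ?thesis unfolding C[symmetric] by (simp add: L.m_assoc)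
qed

end

section \<open>Embedding the exterior square\<close>

lemma perm_pair_eqI: "(\<And>x y. Rep_bperm a (x, y) = Rep_bperm b (x, y)) \<Longrightarrow> a = b"
  by (rule perm_eqI) (auto simp: split_paired_all)

text \<open>Left translation in the first coordinate, made a bijection of the whole type by fixing
  all points outside the given sets.\<close>

definition lam :: "('l, 'k) monoid_scheme \<Rightarrow> 'x set \<Rightarrow> 'l \<Rightarrow> ('l \<times> 'x) bperm" where
  "lam M D m = Abs_bperm (\<lambda>(l, x). if l \<in> carrier M \<and> x \<in> D then (m \<otimes>\<^bsub>M\<^esub> l, x) else (l, x))"

context group
begin

lemma Rep_lam:
  assumes m: "m \<in> carrier G"
  shows "Rep_bperm (lam G D m) (l, x) = (if l \<in> carrier G \<and> x \<in> D then (m \<otimes> l, x) else (l, x))"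
proof -
  define f where "f m = (\<lambda>(l, x). if l \<in> carrier G \<and> x \<in> D then (m \<otimes> l, x) else (l, x))" for m
  have comp: "f a \<circ> f b = id" if "a \<in> carrier G" "b \<in> carrier G" "a \<otimes> b = \<one>" for a b
    using that by (auto simp: f_def fun_eq_iff m_assoc[symmetric])
  have "bij (f m)"
    by (rule o_bij[of "f (inv m)"]) (rule comp; use m in simp)+
  thus ?thesis by (simp add: lam_def f_def Abs_bperm_inverse)
qed

lemma lam_mult: "m \<in> carrier G \<Longrightarrow> m' \<in> carrier G \<Longrightarrow> lam G D m * lam G D m' = lam G D (m \<otimes> m')"
  by (rule perm_pair_eqI) (auto simp: Rep_lam m_assoc)

lemma lam_one: "lam G D \<one> = 1"
  by (rule perm_pair_eqI) (auto simp: Rep_lam)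

lemma lam_eq_one:
  assumes "m \<in> carrier G" "lam G D m = 1" "x \<in> D" shows "m = \<one>"
  using Rep_lam[OF assms(1), of D \<one> x] assms by simp

lemma lam_iv: "m \<in> carrier G \<Longrightarrow> iv (lam G D m) = lam G D (inv m)"
  by (rule iv_unique) (simp add: lam_mult lam_one)

lemma lam_power: "m \<in> carrier G \<Longrightarrow> lam G D m ^ k = lam G D (m [^] k)"
proof (induction k)
  case (Suc k)
  hence "lam G D m ^ k * lam G D m = lam G D (m [^] k \<otimes> m)" by (simp add: lam_mult)
  thus ?case by (simp only: power_Suc2 nat_pow_Suc)
qed (simp add: lam_one)

end

text \<open>A group \<open>ext_group\<close> of permutations of \<open>L \<times> (nat \<Rightarrow> int)\<close>, which is an extension of \<open>L\<close> by a
  free abelian group: \<open>(l, n)\<close> stands for the product of \<open>l\<close> and the powers of the lifts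
  of the \<open>gs i\<close> with exponents \<open>n i\<close>, in increasing order of \<open>i\<close>; \<open>lift k\<close> is left
  multiplication by the lift of \<open>gs k\<close>, collected into this normal form.\<close>

locale enumerated_group = group +
  fixes gs :: "nat \<Rightarrow> 'a"
  assumes range_gs: "range gs = carrier G"
begin

interpretation L: group L by (rule group_exterior_square)

lemma gs_closed [simp]: "gs k \<in> carrier G"
  using range_gs by blast

text \<open>The image in \<open>G\<close> of that part of the normal form whose indices are below
  \<open>k\<close>. Repetitions in \<open>gs\<close> do no harm, as every index has its own
  exponent.\<close>

primrec mon :: "nat \<Rightarrow> (nat \<Rightarrow> int) \<Rightarrow> 'a" where
  "mon 0 n = \<one>"
| "mon (Suc k) n = mon k n \<otimes> gs k [^] n k"

lemma mon_closed [simp]: "mon k n \<in> carrier G"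
  by (induction k) auto

lemma mon_upd: "k \<le> j \<Longrightarrow> mon k (n(j := x)) = mon k n"
  by (induction k) auto

lemma mon_upd_less:
  assumes "j < k" shows "mon k (n(j := n j + 1)) = conj_by G (mon j n) (gs j) \<otimes> mon k n"
  using assms
proof (induction k)
  case (Suc k)
  show ?case
  proof (cases "k = j")
    case True
    have "gs j [^] (n j + 1) = gs j \<otimes> gs j [^] n j"
      using int_pow_mult[of "gs j" 1 "n j"] by (simp add: add.commute)
    moreover have "mon j (n(j := n j + 1)) = mon j n" by (rule mon_upd) simp
    ultimately have "mon (Suc j) (n(j := n j + 1)) = mon j n \<otimes> (gs j \<otimes> gs j [^] n j)"
      by (simp only: mon.simps fun_upd_same)
    also have "inv mon j n \<otimes> (mon j n \<otimes> z) = z" if "z \<in> carrier G" for z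
      using that by (simp add: m_assoc[symmetric])
    hence "mon j n \<otimes> (gs j \<otimes> gs j [^] n j) = conj_by G (mon j n) (gs j) \<otimes> mon (Suc j) n"
      by (simp add: conj_by_def m_assoc)
    finally show ?thesis unfolding True .
  qed (use Suc in \<open>simp add: m_assoc\<close>)
qed simp

text \<open>Moving the new factor past \<open>l\<close> applies the action to \<open>l\<close>.
  Moving it further, past the lifts of smaller index, costs the commutator with their product,
  namely the wedge of \<open>gs k\<close> and \<open>mon k n\<close>.\<close>

definition lift :: "nat \<Rightarrow> (('a \<times> 'a) word set set \<times> (nat \<Rightarrow> int)) bperm" where
  "lift k = Abs_bperm (\<lambda>(l, n). if l \<in> carrier L
    then (act (gs k) l \<otimes>\<^bsub>L\<^esub> wedge G (gs k) (mon k n), n(k := n k + 1)) else (l, n))"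

lemma Rep_lift:
  "Rep_bperm (lift k) (l, n) = (if l \<in> carrier L
    then (act (gs k) l \<otimes>\<^bsub>L\<^esub> wedge G (gs k) (mon k n), n(k := n k + 1)) else (l, n))"
proof -
  let ?w = "\<lambda>n. wedge G (gs k) (mon k n)"
  define f where "f = (\<lambda>(l, n). if l \<in> carrier L then (act (gs k) l \<otimes>\<^bsub>L\<^esub> ?w n, n(k := n k + 1)) else (l, n))"
  \<comment> \<open>The inverse can use the same wedge, because \<open>mon k n\<close> does not
    depend on the k-th exponent.\<close>
  define f' where "f' = (\<lambda>(l, n). if l \<in> carrier L then (act (inv (gs k)) (l \<otimes>\<^bsub>L\<^esub> inv\<^bsub>L\<^esub> ?w n), n(k := n k - 1)) else (l, n))"
  have "f' \<circ> f = id"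
    by (auto simp: fun_eq_iff f_def f'_def mon_upd L.m_assoc act_inv_act)
  moreover have "f \<circ> f' = id"
    by (auto simp: fun_eq_iff f_def f'_def mon_upd L.m_assoc act_inv_act)
  ultimately have "bij f" by (rule o_bij)
  thus ?thesis by (simp add: lift_def f_def[symmetric] Abs_bperm_inverse) (simp add: f_def)
qed

abbreviation Lam :: "('a \<times> 'a) word set set \<Rightarrow> (('a \<times> 'a) word set set \<times> (nat \<Rightarrow> int)) bperm" where
  "Lam \<equiv> lam L UNIV"

lemma lift_Lam:
  assumes "m \<in> carrier L" shows "lift k * Lam m = Lam (act (gs k) m) * lift k"
  by (rule perm_pair_eqI) (use assms in \<open>auto simp: L.Rep_lam Rep_lift act_mult L.m_assoc\<close>)

lemma lift_lift_less:
  assumes "j < k" shows "lift k * lift j = Lam (wedge G (gs k) (gs j)) * (lift j * lift k)"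
proof (rule perm_pair_eqI)
  fix l n
  show "Rep_bperm (lift k * lift j) (l, n) = Rep_bperm (Lam (wedge G (gs k) (gs j)) * (lift j * lift k)) (l, n)"
  proof (cases "l \<in> carrier L")
    case True
    let ?k = "gs k" and ?j = "gs j" and ?A = "mon j n" and ?a = "mon k n"
    \<comment> \<open>On the left \<open>lift k\<close> meets a normal form whose exponent at
      \<open>j\<close> is already raised, so it sees \<open>conj_by G ?A ?j\<close> times
      \<open>?a\<close>; on the right \<open>lift j\<close> is not affected by the exponent at
      \<open>k\<close>.\<close>
    have "act ?k (act ?j l \<otimes>\<^bsub>L\<^esub> wedge G ?j ?A) \<otimes>\<^bsub>L\<^esub> wedge G ?k (conj_by G ?A ?j \<otimes> ?a) =
      act (?k \<otimes> ?j) l \<otimes>\<^bsub>L\<^esub> (act ?k (wedge G ?j ?A) \<otimes>\<^bsub>L\<^esub> wedge G ?k (conj_by G ?A ?j \<otimes> ?a))"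
      using True by (simp add: act_mult act_act L.m_assoc)
    also have "\<dots> = (act (?k \<otimes> ?j) l \<otimes>\<^bsub>L\<^esub> wedge G ?k ?j) \<otimes>\<^bsub>L\<^esub> (act ?j (wedge G ?k ?a) \<otimes>\<^bsub>L\<^esub> wedge G ?j ?A)"
      using True by (simp add: wedge_conj_exchange L.m_assoc)
    also have "\<dots> = wedge G ?k ?j \<otimes>\<^bsub>L\<^esub> (act ?j (act ?k l \<otimes>\<^bsub>L\<^esub> wedge G ?k ?a) \<otimes>\<^bsub>L\<^esub> wedge G ?j ?A)"
      using True by (simp add: wedge_act_commute act_mult act_act L.m_assoc)
    finally show ?thesis
      using True assms by (simp add: Rep_lift L.Rep_lam mon_upd mon_upd_less fun_upd_twist)
  qed (simp add: Rep_lift L.Rep_lam)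
qed

definition normalises where
  "normalises h g \<longleftrightarrow> (\<forall>m\<in>carrier L. h * Lam m = Lam (act g m) * h)"

definition commutes where
  "commutes h g h' g' \<longleftrightarrow> h * h' = Lam (wedge G g g') * (h' * h)"

lemma normalisesD:
  assumes "normalises h g" "m \<in> carrier L"
  shows "h * Lam m = Lam (act g m) * h" "h * (Lam m * z) = Lam (act g m) * (h * z)"
proof -
  show 1: "h * Lam m = Lam (act g m) * h" using assms by (simp add: normalises_def)
  show "h * (Lam m * z) = Lam (act g m) * (h * z)" by (simp only: mult.assoc[symmetric] 1)
qed

lemma commutesD:
  assumes "commutes h g h' g'"
  shows "h * (h' * z) = Lam (wedge G g g') * (h' * (h * z))"
  using assms by (simp only: commutes_def mult.assoc[symmetric])

lemma normalises_mult:
  assumes "normalises h g" "normalises h' g'" "g \<in> carrier G" "g' \<in> carrier G"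
  shows "normalises (h * h') (g \<otimes> g')"
  unfolding normalises_def
proof
  fix m assume m: "m \<in> carrier L"
  show "h * h' * Lam m = Lam (act (g \<otimes> g') m) * (h * h')"
    using assms m by (simp add: mult.assoc normalisesD act_act)
qed

lemma normalises_iv:
  assumes "normalises h g" "g \<in> carrier G"
  shows "normalises (iv h) (inv g)"
  unfolding normalises_def
proof
  fix m assume m: "m \<in> carrier L"
  have "h * Lam (act (inv g) m) = Lam m * h"
    using normalisesD(1)[OF assms(1), of "act (inv g) m"] assms(2) m by (simp add: act_inv_act)
  hence "iv h * (h * Lam (act (inv g) m)) * iv h = iv h * (Lam m * h) * iv h" by simp
  thus "iv h * Lam m = Lam (act (inv g) m) * iv h" by (simp add: mult.assoc)
qed

lemma commutes_mult:
  assumes "commutes h1 g1 x a" "commutes h2 g2 x a" "normalises h1 g1"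
    "g1 \<in> carrier G" "g2 \<in> carrier G" "a \<in> carrier G"
  shows "commutes (h1 * h2) (g1 \<otimes> g2) x a"
proof -
  have "h1 * h2 * x = h1 * (Lam (wedge G g2 a) * (x * h2))"
    using assms(2) by (simp add: commutes_def mult.assoc)
  also have "\<dots> = Lam (act g1 (wedge G g2 a)) * (h1 * (x * h2))"
    by (rule normalisesD(2)[OF assms(3)]) (use assms in simp)
  also have "\<dots> = Lam (act g1 (wedge G g2 a)) * Lam (wedge G g1 a) * (x * (h1 * h2))"
    by (simp only: commutesD[OF assms(1)] mult.assoc)
  finally show ?thesis using assms by (simp add: commutes_def L.lam_mult wedge_left)
qed

lemma commutes_iv:
  assumes "commutes h g x a" "normalises h g" "g \<in> carrier G" "a \<in> carrier G"
  shows "commutes (iv h) (inv g) x a"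
proof -
  let ?w = "act (inv g) (wedge G g a)"
  have w: "?w \<in> carrier L" using assms by simp
  have "x * h = iv (Lam (wedge G g a)) * (h * x)" using assms by (simp add: commutes_def)
  also have "\<dots> = Lam (act g (inv\<^bsub>L\<^esub> ?w)) * h * x"
    using assms group_hom.hom_inv[OF act_group_hom[OF assms(3)] w] by (simp add: L.lam_iv act_inv_act mult.assoc)
  also have "Lam (act g (inv\<^bsub>L\<^esub> ?w)) * h = h * Lam (inv\<^bsub>L\<^esub> ?w)"
    using normalisesD(1)[OF assms(2), of "inv\<^bsub>L\<^esub> ?w"] w by simp
  finally have "iv h * (x * h) * iv h = iv h * (h * Lam (inv\<^bsub>L\<^esub> ?w) * x) * iv h" by simp
  thus ?thesis using assms by (simp add: commutes_def wedge_inv_left mult.assoc)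
qed

lemma commutes_sym:
  assumes "commutes h g h' g'" "g \<in> carrier G" "g' \<in> carrier G"
  shows "commutes h' g' h g"
proof -
  have "h' * h = iv (Lam (wedge G g g')) * (h * h')" using assms by (simp add: commutes_def)
  thus ?thesis using assms wedge_swap[of g' g] by (simp add: commutes_def L.lam_iv)
qed

lemma normalises_lift: "normalises (lift k) (gs k)"
  by (simp add: normalises_def lift_Lam)

lemma commutes_lift: "commutes (lift k) (gs k) (lift j) (gs j)"
proof (cases k j rule: linorder_cases)
  case less
  have "commutes (lift j) (gs j) (lift k) (gs k)" using lift_lift_less[OF less] by (simp add: commutes_def)
  thus ?thesis by (rule commutes_sym) simp_all
next
  case equal
  thus ?thesis by (simp add: commutes_def wedge_self L.lam_one)
next
  case greater
  thus ?thesis using lift_lift_less by (simp add: commutes_def)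
qed

text \<open>A word in the lifts is recorded together with its image in \<open>G\<close>. In this way
  no map from permutations to \<open>G\<close> has to be shown well defined.\<close>

inductive ext where
  ext_one: "ext 1 \<one>"
| ext_lift: "ext (lift k) (gs k)"
| ext_mult: "ext h g \<Longrightarrow> ext h' g' \<Longrightarrow> ext (h * h') (g \<otimes> g')"
| ext_iv: "ext h g \<Longrightarrow> ext (iv h) (inv g)"

lemma ext_closed: "ext h g \<Longrightarrow> g \<in> carrier G"
  by (induction rule: ext.induct) auto

lemma ext_normalises: "ext h g \<Longrightarrow> normalises h g"
proof (induction rule: ext.induct)
  case ext_one
  show ?case by (simp add: normalises_def act_one)
qed (auto intro: normalises_lift normalises_mult normalises_iv ext_closed)

lemma ext_commutes_step:
  assumes "\<And>k. commutes (lift k) (gs k) x a" "a \<in> carrier G"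
  shows "ext h g \<Longrightarrow> commutes h g x a"
proof (induction rule: ext.induct)
  case ext_one
  show ?case using assms by (simp add: commutes_def wedge_one_left L.lam_one)
next
  case (ext_mult h g h' g')
  show ?case
    by (rule commutes_mult[OF ext_mult.IH ext_normalises[OF ext_mult.hyps(1)]
          ext_closed[OF ext_mult.hyps(1)] ext_closed[OF ext_mult.hyps(2)] assms(2)])
next
  case (ext_iv h g)
  show ?case
    by (rule commutes_iv[OF ext_iv.IH ext_normalises[OF ext_iv.hyps] ext_closed[OF ext_iv.hyps] assms(2)])
qed (rule assms)

text \<open>Extended from lifts to words in one argument at a time, with \<open>commutes_sym\<close>
  exchanging the arguments in between.\<close>

lemma ext_commutes: "ext h g \<Longrightarrow> ext h' g' \<Longrightarrow> commutes h g h' g'"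
proof -
  assume h: "ext h g" and h': "ext h' g'"
  have "commutes h g (lift k) (gs k)" for k
    by (rule ext_commutes_step[OF commutes_lift gs_closed h])
  hence "commutes (lift k) (gs k) h g" for k
    by (rule commutes_sym) (rule ext_closed[OF h], simp)
  hence "commutes h' g' h g" by (rule ext_commutes_step[OF _ ext_closed[OF h] h'])
  thus ?thesis by (rule commutes_sym[OF _ ext_closed[OF h'] ext_closed[OF h]])
qed

definition ext_group where "ext_group = {h. \<exists>g. ext h g}"

lemma central_relation_ext: "central_relation G ext_group ext"
proof
  show "subgrp ext_group"
    unfolding subgrp_def ext_group_def using ext.intros by blast
  fix h h' assume "h \<in> ext_group" "ext h \<one>" "h' \<in> ext_group"
  then obtain g' where "ext h' g'" "commutes h \<one> h' g'" "g' \<in> carrier G"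
    using ext_commutes ext_closed unfolding ext_group_def by blast
  thus "h * h' = h' * h" by (simp add: commutes_def wedge_one_left L.lam_one)
next
  fix h assume "h \<in> ext_group"
  thus "\<exists>g\<in>carrier G. ext h g" using ext_closed unfolding ext_group_def by blast
next
  fix h h' g g' assume "ext h g" "ext h' g'"
  thus "ext (h * h') (g \<otimes> g')" by (rule ext_mult)
next
  fix h g assume "ext h g"
  thus "ext (iv h) (inv g)" by (rule ext_iv)
qed

lemma Lam_in_gam_2:
  assumes "l \<in> carrier L" shows "Lam l \<in> gam ext_group 2"
proof -
  interpret R: central_relation G ext_group ext by (rule central_relation_ext)
  have w: "Lam (wedge G g h) \<in> gam ext_group 2" if gh: "g \<in> carrier G" "h \<in> carrier G" for g h
  proof -
    obtain i j where ij: "g = gs i" "h = gs j" using gh unfolding range_gs[symmetric] by blast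
    have m: "iv (lift i) \<in> ext_group" "iv (lift j) \<in> ext_group"
      unfolding ext_group_def using ext_iv[OF ext_lift] by blast+
    \<comment> \<open>Inverses again pass from the convention of \<open>cm\<close> to that of
      \<open>commutes\<close>.\<close>
    have "cm (iv (lift i)) (iv (lift j)) = lift i * (lift j * (iv (lift i) * iv (lift j)))"
      by (simp add: cm_def mult.assoc)
    also have "\<dots> = Lam (wedge G g h) * (lift j * (lift i * (iv (lift i) * iv (lift j))))"
      unfolding ij by (rule commutesD[OF commutes_lift])
    finally have "cm (iv (lift i)) (iv (lift j)) = Lam (wedge G g h)" by simp
    thus ?thesis using gam_cm[OF R.subH, of "iv (lift i)" 1 "iv (lift j)" 1 2] m by simp
  qed
  note G2 = subgrpD[OF subgrp_gam[OF R.subH, of 2]]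
  show ?thesis using assms
  proof (induction rule: exterior_induct)
    case one
    show ?case using G2(1) by (simp add: L.lam_one)
  next
    case (mult g h l)
    thus ?case using G2(2)[OF w[OF mult.hyps(1,2)] mult.IH] by (simp add: L.lam_mult)
  next
    case (inv_mult g h l)
    thus ?case using G2(2)[OF G2(3)[OF w[OF inv_mult.hyps(1,2)]] inv_mult.IH]
      by (simp add: L.lam_mult L.lam_iv)
  qed
qed

lemma exterior_square_power:
  fixes e n :: nat
  assumes "odd e" "\<And>x. x \<in> carrier G \<Longrightarrow> x [^] e = \<one>"
    "lower_central G c = {\<one>}" "c + 1 \<le> 2 * 3 ^ n" "n \<ge> 1" and l: "l \<in> carrier L"
  shows "l [^]\<^bsub>L\<^esub> (e ^ n) = \<one>\<^bsub>L\<^esub>"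
proof -
  interpret R: central_relation G ext_group ext by (rule central_relation_ext)
  have "Lam l ^ (e ^ n) = 1"
    by (rule R.gam_2_exponent[OF assms(1-5) Lam_in_gam_2[OF l]])
  thus ?thesis using L.lam_eq_one[of "l [^]\<^bsub>L\<^esub> (e ^ n)" UNIV] l by (simp add: L.lam_power)
qed

end

section \<open>The Schur multiplier\<close>

type_synonym 'a schur_perm = "(('a \<times> 'a \<Rightarrow>\<^sub>0 int) set \<times> 'a) bperm"

lemma free_Abelian_group_hom_eq:
  assumes M: "group M" and hom: "\<theta> \<in> hom (free_Abelian_group S) M" "\<theta>' \<in> hom (free_Abelian_group S) M"
    and eq: "\<And>s. s \<in> S \<Longrightarrow> \<theta> (frag_of s) = \<theta>' (frag_of s)"
    and z: "z \<in> carrier (free_Abelian_group S)"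
  shows "\<theta> z = \<theta>' z"
proof -
  let ?F = "free_Abelian_group S"
  interpret t: group_hom ?F M \<theta> using M hom by (simp add: group_hom_def group_hom_axioms_def)
  interpret t': group_hom ?F M \<theta>' using M hom by (simp add: group_hom_def group_hom_axioms_def)
  have "Poly_Mapping.keys z \<subseteq> S" using z by simp
  hence "z \<in> carrier ?F \<and> \<theta> z = \<theta>' z"
  proof (induction z rule: frag_induction)
    case zero
    show ?case using t.hom_one t'.hom_one by simp
  next
    case (one x)
    thus ?case using eq by simp
  next
    case (diff a b)
    have "a - b = a \<otimes>\<^bsub>?F\<^esub> inv\<^bsub>?F\<^esub> b" using diff by simp
    moreover have "a \<otimes>\<^bsub>?F\<^esub> inv\<^bsub>?F\<^esub> b \<in> carrier ?F"
      using diff t.G.m_closed t.G.inv_closed by blast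
    moreover have "\<theta> (a \<otimes>\<^bsub>?F\<^esub> inv\<^bsub>?F\<^esub> b) = \<theta>' (a \<otimes>\<^bsub>?F\<^esub> inv\<^bsub>?F\<^esub> b)"
      using diff t.G.inv_closed[of b]
      by (simp only: t.hom_mult t.hom_inv t'.hom_mult t'.hom_inv)
    ultimately show ?case by (simp only:)
  qed
  thus ?thesis by simp
qed

context group
begin

abbreviation "C2 \<equiv> free_Abelian_group (carrier G \<times> carrier G)"

text \<open>The chains modulo boundaries are the kernel of the universal central extension of \<open>G\<close> with a
  chosen set-theoretic section; \<open>slift\<close> is that section, acting by left multiplication on
  \<open>Ch \<times> G\<close>.\<close>

definition "Ch = C2 Mod bar_boundaries2 G"

definition chain_class where
  "chain_class z = bar_boundaries2 G #>\<^bsub>C2\<^esub> z"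

definition symb where
  "symb g h = chain_class (frag_of (g, h))"

lemma boundaries_subgroup: "subgroup (bar_boundaries2 G) C2"
proof -
  interpret d3: group_hom "free_Abelian_group (carrier G \<times> carrier G \<times> carrier G)" C2 "bar_boundary3 G"
    by (simp add: group_hom_def group_hom_axioms_def bar_boundary3_hom)
  show ?thesis unfolding bar_boundaries2_def by (rule d3.img_is_subgroup)
qed

lemma boundaries_normal: "bar_boundaries2 G \<lhd> C2"
  by (rule comm_group.subgroup_imp_normal[OF abelian_free_Abelian_group boundaries_subgroup])

interpretation A: comm_group Ch
  unfolding Ch_def by (rule comm_group.abelian_FactGroup[OF abelian_free_Abelian_group boundaries_subgroup])

lemma chain_class_hom: "chain_class \<in> hom C2 Ch"
  using normal.r_coset_hom_Mod[OF boundaries_normal] by (simp add: chain_class_def[abs_def] Ch_def)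

lemma chain_class_closed [simp]: "z \<in> carrier C2 \<Longrightarrow> chain_class z \<in> carrier Ch"
  by (rule hom_in_carrier[OF chain_class_hom])

lemma chain_class_add: "z \<in> carrier C2 \<Longrightarrow> w \<in> carrier C2 \<Longrightarrow>
    chain_class (z + w) = chain_class z \<otimes>\<^bsub>Ch\<^esub> chain_class w"
  using hom_mult[OF chain_class_hom, of z w] by (simp only: mult_free_Abelian_group)

lemma frag_of_closed: "g \<in> carrier G \<Longrightarrow> h \<in> carrier G \<Longrightarrow> frag_of (g, h) \<in> carrier C2"
  by simp

lemma symb_closed [simp]: "g \<in> carrier G \<Longrightarrow> h \<in> carrier G \<Longrightarrow> symb g h \<in> carrier Ch"
  unfolding symb_def by (intro chain_class_closed frag_of_closed)

text \<open>Dividing by the boundary of (g, h, k) imposes exactly the 2-cocycle identity.\<close>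

lemma symb_cocycle:
  assumes g: "g \<in> carrier G" and h: "h \<in> carrier G" and k: "k \<in> carrier G"
  shows "symb h k \<otimes>\<^bsub>Ch\<^esub> symb g (h \<otimes> k) = symb (g \<otimes> h) k \<otimes>\<^bsub>Ch\<^esub> symb g h"
proof -
  let ?b = "bar_boundary3 G (frag_of (g, h, k))"
  have c: "frag_of (g, h, k) \<in> carrier (free_Abelian_group (carrier G \<times> carrier G \<times> carrier G))"
    using assms by simp
  have b: "?b \<in> bar_boundaries2 G" unfolding bar_boundaries2_def using c by (rule imageI)
  have bC: "?b \<in> carrier C2" by (rule hom_in_carrier[OF bar_boundary3_hom c])
  have m: "frag_of (h, k) \<in> carrier C2" "frag_of (g, h \<otimes> k) \<in> carrier C2"
    "frag_of (g \<otimes> h, k) \<in> carrier C2" "frag_of (g, h) \<in> carrier C2"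
    using assms by simp_all
  have m2: "frag_of (g \<otimes> h, k) + frag_of (g, h) \<in> carrier C2"
    using group.is_monoid[OF group_free_Abelian_group, THEN monoid.m_closed, OF m(3,4)] by (simp only: mult_free_Abelian_group)
  have "chain_class ?b = \<one>\<^bsub>Ch\<^esub>"
    unfolding chain_class_def Ch_def one_FactGroup
    by (rule group.coset_join2[OF group_free_Abelian_group bC boundaries_subgroup b])
  moreover have "?b = frag_of (h, k) - frag_of (g \<otimes> h, k) + frag_of (g, h \<otimes> k) - frag_of (g, h)"
    by (simp add: bar_boundary3_def)
  hence "frag_of (h, k) + frag_of (g, h \<otimes> k) = ?b + (frag_of (g \<otimes> h, k) + frag_of (g, h))"
    by (simp add: algebra_simps)
  hence "chain_class (frag_of (h, k)) \<otimes>\<^bsub>Ch\<^esub> chain_class (frag_of (g, h \<otimes> k)) =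
    chain_class ?b \<otimes>\<^bsub>Ch\<^esub> (chain_class (frag_of (g \<otimes> h, k)) \<otimes>\<^bsub>Ch\<^esub> chain_class (frag_of (g, h)))"
    by (simp only: chain_class_add[OF m(1,2), symmetric] chain_class_add[OF m(3,4), symmetric]
        chain_class_add[OF bC m2, symmetric])
  ultimately show ?thesis
    unfolding symb_def using A.l_one[OF A.m_closed[OF chain_class_closed[OF m(3)] chain_class_closed[OF m(4)]]]
    by (simp only:)
qed

lemma symb_one: "h \<in> carrier G \<Longrightarrow> symb \<one> h = symb \<one> \<one>"
  using symb_cocycle[of \<one> \<one> h] by simp

definition slift where
  "slift g = Abs_bperm (\<lambda>(X, h). if X \<in> carrier Ch \<and> h \<in> carrier G
     then (X \<otimes>\<^bsub>Ch\<^esub> symb g h, g \<otimes> h) else (X, h))"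

lemma Rep_slift:
  assumes g: "g \<in> carrier G"
  shows "Rep_bperm (slift g) (X, h) = (if X \<in> carrier Ch \<and> h \<in> carrier G
     then (X \<otimes>\<^bsub>Ch\<^esub> symb g h, g \<otimes> h) else (X, h))"
proof -
  define f where "f = (\<lambda>(X, h). if X \<in> carrier Ch \<and> h \<in> carrier G
     then (X \<otimes>\<^bsub>Ch\<^esub> symb g h, g \<otimes> h) else (X, h))"
  define f' where "f' = (\<lambda>(X, h). if X \<in> carrier Ch \<and> h \<in> carrier G
     then (X \<otimes>\<^bsub>Ch\<^esub> inv\<^bsub>Ch\<^esub> symb g (inv g \<otimes> h), inv g \<otimes> h) else (X, h))"
  have 1: "f' (f (X, h)) = (X, h)" for X h
  proof (cases "X \<in> carrier Ch \<and> h \<in> carrier G")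
    case True
    have "inv g \<otimes> (g \<otimes> h) = h" using g True by (simp add: m_assoc[symmetric])
    thus ?thesis using True g by (simp only: f_def f'_def) (simp add: A.m_assoc)
  next
    case False
    thus ?thesis unfolding f_def f'_def by auto
  qed
  have 2: "f (f' (X, h)) = (X, h)" for X h
  proof (cases "X \<in> carrier Ch \<and> h \<in> carrier G")
    case True
    have "g \<otimes> (inv g \<otimes> h) = h" using g True by (simp add: m_assoc[symmetric])
    thus ?thesis using True g by (simp only: f_def f'_def) (simp add: A.m_assoc)
  next
    case False
    thus ?thesis unfolding f_def f'_def by auto
  qed
  have "bij f" by (rule o_bij[of f']) (use 1 2 in \<open>auto simp: fun_eq_iff\<close>)
  thus ?thesis by (simp add: slift_def f_def[symmetric] Abs_bperm_inverse) (simp add: f_def)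
qed

abbreviation "SLam \<equiv> lam Ch (carrier G)"

lemma slift_SLam:
  assumes "g \<in> carrier G" "X \<in> carrier Ch"
  shows "slift g * SLam X = SLam X * slift g"
proof (rule perm_pair_eqI)
  fix Y h
  show "Rep_bperm (slift g * SLam X) (Y, h) = Rep_bperm (SLam X * slift g) (Y, h)"
    using assms by (simp add: A.Rep_lam Rep_slift A.m_assoc)
qed

lemma slift_slift:
  assumes "g \<in> carrier G" "h \<in> carrier G"
  shows "slift g * slift h = SLam (symb g h) * slift (g \<otimes> h)"
proof (rule perm_pair_eqI)
  fix Y k
  show "Rep_bperm (slift g * slift h) (Y, k) = Rep_bperm (SLam (symb g h) * slift (g \<otimes> h)) (Y, k)"
  proof (cases "Y \<in> carrier Ch \<and> k \<in> carrier G")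
    case True
    have "Y \<otimes>\<^bsub>Ch\<^esub> symb h k \<otimes>\<^bsub>Ch\<^esub> symb g (h \<otimes> k) = Y \<otimes>\<^bsub>Ch\<^esub> (symb (g \<otimes> h) k \<otimes>\<^bsub>Ch\<^esub> symb g h)"
      using True assms symb_cocycle[of g h k] by (simp add: A.m_assoc)
    also have "\<dots> = symb g h \<otimes>\<^bsub>Ch\<^esub> (Y \<otimes>\<^bsub>Ch\<^esub> symb (g \<otimes> h) k)"
      using True assms by (simp add: A.m_ac)
    finally show ?thesis
      using True assms by (simp add: A.Rep_lam Rep_slift m_assoc)
  qed (use assms in \<open>auto simp: A.Rep_lam Rep_slift\<close>)
qed

text \<open>The bar complex is not normalised, so the lift of the identity is a translation that
  need not be trivial; \<open>symb_one\<close> shows that it is the same at every point.\<close>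

lemma slift_one: "slift \<one> = SLam (symb \<one> \<one>)"
proof (rule perm_pair_eqI)
  fix Y k
  show "Rep_bperm (slift \<one>) (Y, k) = Rep_bperm (SLam (symb \<one> \<one>)) (Y, k)"
  proof (cases "Y \<in> carrier Ch \<and> k \<in> carrier G")
    case True
    thus ?thesis using symb_one[of k] by (simp add: A.Rep_lam Rep_slift A.m_comm)
  qed (auto simp: A.Rep_lam Rep_slift)
qed

definition srel where
  "srel x g \<longleftrightarrow> g \<in> carrier G \<and> (\<exists>X\<in>carrier Ch. x = SLam X * slift g)"

definition sgroup where
  "sgroup = {x. \<exists>g. srel x g}"

lemma srel_mult:
  assumes "srel x g" "srel y h" shows "srel (x * y) (g \<otimes> h)"
proof -
  from assms obtain X Y where XY: "X \<in> carrier Ch" "Y \<in> carrier Ch" "x = SLam X * slift g" "y = SLam Y * slift h"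
    and gh: "g \<in> carrier G" "h \<in> carrier G" by (auto simp: srel_def)
  have "x * y = SLam X * (slift g * SLam Y) * slift h" by (simp add: XY mult.assoc)
  also have "\<dots> = SLam X * SLam Y * (slift g * slift h)" by (simp only: slift_SLam[OF gh(1) XY(2)] mult.assoc)
  also have "\<dots> = SLam (X \<otimes>\<^bsub>Ch\<^esub> Y \<otimes>\<^bsub>Ch\<^esub> symb g h) * slift (g \<otimes> h)"
    by (simp only: slift_slift[OF gh] mult.assoc[symmetric] A.lam_mult[OF XY(1,2)]
        A.lam_mult[OF A.m_closed[OF XY(1,2)] symb_closed[OF gh]])
  finally have "x * y = SLam (X \<otimes>\<^bsub>Ch\<^esub> Y \<otimes>\<^bsub>Ch\<^esub> symb g h) * slift (g \<otimes> h)" .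
  moreover have "X \<otimes>\<^bsub>Ch\<^esub> Y \<otimes>\<^bsub>Ch\<^esub> symb g h \<in> carrier Ch"
    by (rule A.m_closed[OF A.m_closed[OF XY(1,2)] symb_closed[OF gh]])
  ultimately show ?thesis using gh unfolding srel_def by blast
qed

lemma srel_slift: "g \<in> carrier G \<Longrightarrow> srel (slift g) g"
  unfolding srel_def using A.one_closed by (auto simp: A.lam_one intro!: bexI[of _ "\<one>\<^bsub>Ch\<^esub>"])

lemma srel_SLam:
  assumes "X \<in> carrier Ch" shows "srel (SLam X) \<one>"
proof -
  have s: "symb \<one> \<one> \<in> carrier Ch" by (rule symb_closed) simp_all
  have "SLam X = SLam (X \<otimes>\<^bsub>Ch\<^esub> inv\<^bsub>Ch\<^esub> symb \<one> \<one>) * slift \<one>"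
    unfolding slift_one A.lam_mult[OF A.m_closed[OF assms A.inv_closed[OF s]] s]
    using assms s by (simp add: A.m_assoc)
  thus ?thesis using A.m_closed[OF assms A.inv_closed[OF s]] unfolding srel_def by blast
qed

lemma srel_iv:
  assumes "srel x g" shows "srel (iv x) (inv g)"
proof -
  from assms obtain X where X: "X \<in> carrier Ch" "x = SLam X * slift g" and g: "g \<in> carrier G"
    by (auto simp: srel_def)
  have ig: "inv g \<in> carrier G" using g by simp
  \<comment> \<open>The translation by which \<open>slift g * slift (inv g)\<close> acts: the
    cocycle value times the correction from \<open>slift_one\<close>.\<close>
  let ?W = "symb g (inv g) \<otimes>\<^bsub>Ch\<^esub> symb \<one> \<one>"
  have W: "?W \<in> carrier Ch" by (intro A.m_closed symb_closed g ig one_closed)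
  have "slift g * slift (inv g) = SLam ?W"
    using slift_slift[OF g ig] A.lam_mult[OF symb_closed[OF g ig] symb_closed[OF one_closed one_closed]] g
    by (simp add: slift_one)
  hence "slift g * (slift (inv g) * SLam (inv\<^bsub>Ch\<^esub> ?W)) = 1"
    unfolding mult.assoc[symmetric] using W by (simp add: A.lam_mult A.lam_one)
  hence "iv (slift g) = slift (inv g) * SLam (inv\<^bsub>Ch\<^esub> ?W)" by (rule iv_unique)
  hence "iv x = slift (inv g) * SLam (inv\<^bsub>Ch\<^esub> ?W) * SLam (inv\<^bsub>Ch\<^esub> X)"
    using X by (simp add: A.lam_iv)
  moreover have "srel (slift (inv g) * SLam (inv\<^bsub>Ch\<^esub> ?W) * SLam (inv\<^bsub>Ch\<^esub> X)) (inv g \<otimes> \<one> \<otimes> \<one>)"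
    by (intro srel_mult srel_slift srel_SLam ig A.inv_closed W X)
  ultimately show ?thesis using ig by simp
qed

lemma central_relation_schur: "central_relation G sgroup srel"
proof
  have "srel 1 \<one>" using srel_SLam[OF A.one_closed] by (simp only: A.lam_one)
  thus "subgrp sgroup"
    unfolding subgrp_def sgroup_def using srel_mult srel_iv by blast
next
  fix x assume "x \<in> sgroup"
  thus "\<exists>g\<in>carrier G. srel x g" by (auto simp: sgroup_def srel_def)
next
  fix x y assume "srel x \<one>" "y \<in> sgroup"
  then obtain X Y g where X: "X \<in> carrier Ch" "x = SLam X * slift \<one>"
    and Y: "Y \<in> carrier Ch" "y = SLam Y * slift g" "g \<in> carrier G"
    by (auto simp: srel_def sgroup_def)
  let ?X = "X \<otimes>\<^bsub>Ch\<^esub> symb \<one> \<one>"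
  have c: "?X \<in> carrier Ch" by (intro A.m_closed X symb_closed one_closed)
  have x: "x = SLam ?X"
    unfolding X(2) slift_one by (rule A.lam_mult[OF X(1) symb_closed[OF one_closed one_closed]])
  have "x * y = SLam (?X \<otimes>\<^bsub>Ch\<^esub> Y) * slift g"
    unfolding x Y(2) mult.assoc[symmetric] A.lam_mult[OF c Y(1)] ..
  also have "\<dots> = SLam Y * (SLam ?X * slift g)"
    unfolding A.m_comm[OF c Y(1)] A.lam_mult[OF Y(1) c, symmetric] by (simp only: mult.assoc)
  also have "\<dots> = y * x"
    unfolding x Y(2) slift_SLam[OF Y(3) c, symmetric] by (simp only: mult.assoc)
  finally show "x * y = y * x" .
qed (rule srel_mult srel_iv, assumption+)+

text \<open>In the abelianisation of \<open>sgroup\<close>, the class of \<open>(g, h)\<close> becomes \<open>g + h - g h\<close>, which is the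
  bar boundary; hence cycles vanish there.\<close>

lemma cycle_in_gam_2:
  assumes z: "z \<in> bar_cycles2 G" shows "SLam (chain_class z) \<in> gam sgroup 2"
proof -
  interpret R: central_relation G sgroup srel by (rule central_relation_schur)
  let ?C1 = "free_Abelian_group (carrier G)"
  obtain \<phi> :: "'a schur_perm \<Rightarrow> 'a schur_perm set bperm" where \<phi>: "grp_hom sgroup \<phi>" "\<And>x. x \<in> sgroup \<Longrightarrow> \<phi> x = 1 \<longleftrightarrow> x \<in> gam sgroup 2"
    "subgrp (\<phi> ` sgroup)" "gam (\<phi> ` sgroup) 2 = {1}"
    using gam_quotient[OF R.subH, of 2] by metis
  interpret h: grp_hom sgroup \<phi> by (rule \<phi>(1))
  note S = subgrpD[OF \<phi>(3)]
  define M :: "'a schur_perm set bperm monoid" where "M = \<lparr>carrier = \<phi> ` sgroup, mult = (*), one = 1\<rparr>"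
  have Msimps [simp]: "carrier M = \<phi> ` sgroup" "mult M = (*)" "one M = 1" by (simp_all add: M_def)
  have abel: "a * b = b * a" if "a \<in> \<phi> ` sgroup" "b \<in> \<phi> ` sgroup" for a b
    using gam_commute[OF \<phi>(3,4), of a 1 b 1] that by simp
  have M: "comm_group M"
  proof (rule comm_groupI)
    fix x assume "x \<in> carrier M"
    hence "iv x \<in> carrier M" using S(3) by (simp only: Msimps)
    thus "\<exists>y\<in>carrier M. y \<otimes>\<^bsub>M\<^esub> x = \<one>\<^bsub>M\<^esub>" by (rule bexI[rotated]) simp
  next
    fix x y assume "x \<in> carrier M" "y \<in> carrier M"
    thus "x \<otimes>\<^bsub>M\<^esub> y = y \<otimes>\<^bsub>M\<^esub> x" "x \<otimes>\<^bsub>M\<^esub> y \<in> carrier M"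
      unfolding Msimps using abel S(2) by blast+
  qed (unfold Msimps, rule S(1), simp_all add: mult.assoc)
  interpret M: comm_group M by (rule M)
  have M_inv: "inv\<^bsub>M\<^esub> x = iv x" if "x \<in> \<phi> ` sgroup" for x
    by (rule M.inv_equality) (use that S(3) in auto)
  have sl: "slift g \<in> sgroup" if "g \<in> carrier G" for g
    using srel_slift[OF that] by (auto simp: sgroup_def)
  have SL: "SLam X \<in> sgroup" if "X \<in> carrier Ch" for X
    using srel_SLam[OF that] by (auto simp: sgroup_def)
  have "(\<lambda>g. \<phi> (slift g)) ` carrier G \<subseteq> carrier M" using sl by auto
  \<comment> \<open>\<open>t\<close> carries g to the class of its lift, extended to 1-chains.
    Composed with the boundary it agrees on generators with the class of the translation, and on
    cycles the boundary is 0.\<close>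
  then obtain t where t: "t \<in> hom ?C1 M" "\<And>g. g \<in> carrier G \<Longrightarrow> t (frag_of g) = \<phi> (slift g)"
    by (rule M.free_Abelian_group_universal) blast
  interpret t: group_hom ?C1 M t by (simp add: group_hom_def group_hom_axioms_def t M.is_group)
  have hom1: "(\<lambda>z. \<phi> (SLam (chain_class z))) \<in> hom C2 M"
  proof (rule homI)
    fix a b assume ab: "a \<in> carrier C2" "b \<in> carrier C2"
    note c = chain_class_closed[OF ab(1)] chain_class_closed[OF ab(2)]
    have "SLam (chain_class (a \<otimes>\<^bsub>C2\<^esub> b)) = SLam (chain_class a) * SLam (chain_class b)"
      unfolding A.lam_mult[OF c] hom_mult[OF chain_class_hom ab] ..
    thus "\<phi> (SLam (chain_class (a \<otimes>\<^bsub>C2\<^esub> b))) = \<phi> (SLam (chain_class a)) \<otimes>\<^bsub>M\<^esub> \<phi> (SLam (chain_class b))"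
      using h.hom[OF SL[OF c(1)] SL[OF c(2)]] by simp
  next
    fix a assume "a \<in> carrier C2"
    thus "\<phi> (SLam (chain_class a)) \<in> carrier M" using SL[OF chain_class_closed] by simp
  qed
  have hom2: "(\<lambda>z. t (bar_boundary2 G z)) \<in> hom C2 M"
    using Group.hom_compose[OF bar_boundary2_hom t(1)] by (simp add: comp_def)
  have zC: "z \<in> carrier C2" and z0: "bar_boundary2 G z = 0"
    using z by (auto simp: bar_cycles2_def kernel_def)
  have "\<phi> (SLam (chain_class z)) = t (bar_boundary2 G z)"
  proof (rule free_Abelian_group_hom_eq[OF M.is_group hom1 hom2 _ zC])
    fix s assume "s \<in> carrier G \<times> carrier G"
    then obtain g k where s: "s = (g, k)" and gk: "g \<in> carrier G" "k \<in> carrier G" by auto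
    have m: "g \<otimes> k \<in> carrier G" using gk by simp
    have F: "frag_of g \<in> carrier ?C1" "frag_of k \<in> carrier ?C1" "frag_of (g \<otimes> k) \<in> carrier ?C1"
      using gk by simp_all
    have "bar_boundary2 G (frag_of s) = frag_of k - frag_of (g \<otimes> k) + frag_of g"
      by (simp add: bar_boundary2_def s)
    also have "\<dots> = frag_of k \<otimes>\<^bsub>?C1\<^esub> inv\<^bsub>?C1\<^esub> frag_of (g \<otimes> k) \<otimes>\<^bsub>?C1\<^esub> frag_of g"
      using m by simp
    finally have "t (bar_boundary2 G (frag_of s)) =
        t (frag_of k \<otimes>\<^bsub>?C1\<^esub> inv\<^bsub>?C1\<^esub> frag_of (g \<otimes> k) \<otimes>\<^bsub>?C1\<^esub> frag_of g)" by simp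
    also have "\<dots> = t (frag_of k) \<otimes>\<^bsub>M\<^esub> inv\<^bsub>M\<^esub> t (frag_of (g \<otimes> k)) \<otimes>\<^bsub>M\<^esub> t (frag_of g)"
      using F t.G.inv_closed t.G.m_closed by (simp only: t.hom_mult t.hom_inv)
    also have "\<dots> = \<phi> (slift k) * iv (\<phi> (slift (g \<otimes> k))) * \<phi> (slift g)"
      using gk m sl by (simp add: t(2) M_inv)
    also have "\<dots> = \<phi> (slift g) * \<phi> (slift k) * iv (\<phi> (slift (g \<otimes> k)))"
    proof -
      have p: "\<phi> (slift g) \<in> \<phi> ` sgroup" "\<phi> (slift k) \<in> \<phi> ` sgroup" "\<phi> (slift (g \<otimes> k)) \<in> \<phi> ` sgroup"
        using sl gk m by auto
      show ?thesis
        using abel[OF S(2)[OF p(2) S(3)[OF p(3)]] p(1)] by (simp only: mult.assoc)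
    qed
    also have "\<dots> = \<phi> (slift g * slift k * iv (slift (g \<otimes> k)))"
      using sl gk m subgrpD[OF R.subH] by (simp add: h.hom h.hom_iv)
    also have "slift g * slift k * iv (slift (g \<otimes> k)) = SLam (symb g k)"
      unfolding slift_slift[OF gk] by (simp add: mult.assoc)
    finally show "\<phi> (SLam (chain_class (frag_of s))) = t (bar_boundary2 G (frag_of s))"
      by (simp add: symb_def s)
  qed
  also have "\<dots> = 1" using z0 t.hom_one by simp
  finally show ?thesis using \<phi>(2) SL[OF chain_class_closed[OF zC]] by blast
qed

lemma schur_multiplier_power:
  fixes e n :: nat
  assumes "odd e" "\<And>x. x \<in> carrier G \<Longrightarrow> x [^] e = \<one>"
    "lower_central G c = {\<one>}" "c + 1 \<le> 2 * 3 ^ n" "n \<ge> 1" and X: "X \<in> carrier (schur_multiplier G)"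
  shows "X [^]\<^bsub>schur_multiplier G\<^esub> (e ^ n) = \<one>\<^bsub>schur_multiplier G\<^esub>"
proof -
  interpret R: central_relation G sgroup srel by (rule central_relation_schur)
  obtain z where z: "z \<in> bar_cycles2 G" "X = chain_class z"
    using X unfolding schur_multiplier_def carrier_FactGroup chain_class_def by (auto simp: r_coset_def)
  have zC: "z \<in> carrier C2" using z by (auto simp: bar_cycles2_def kernel_def)
  have "SLam X ^ (e ^ n) = 1"
    unfolding z(2) by (rule R.gam_2_exponent[OF assms(1-5) cycle_in_gam_2[OF z(1)]])
  moreover have XC: "X \<in> carrier Ch" unfolding z(2) by (rule chain_class_closed[OF zC])
  ultimately have "SLam (X [^]\<^bsub>Ch\<^esub> (e ^ n)) = 1" by (simp only: A.lam_power)
  hence "X [^]\<^bsub>Ch\<^esub> (e ^ n) = \<one>\<^bsub>Ch\<^esub>"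
    by (rule A.lam_eq_one[OF A.nat_pow_closed[OF XC] _ one_closed])
  \<comment> \<open>Both quotients multiply cosets as sets of chains, so restricting to cycles does
    not change powers.\<close>
  moreover have "X [^]\<^bsub>schur_multiplier G\<^esub> k = X [^]\<^bsub>Ch\<^esub> k" for k :: nat
    unfolding schur_multiplier_def Ch_def by (induction k) (simp_all add: set_mult_def)
  ultimately show ?thesis by (simp add: schur_multiplier_def Ch_def)
qed

end

section \<open>Exponents and the final combination\<close>

lemma (in group) group_exponent_dvd:
  assumes m: "m > 0" "\<And>x. x \<in> carrier G \<Longrightarrow> x [^] m = \<one>"
  shows "group_exponent G dvd m"
proof -
  define P where "P n \<longleftrightarrow> n > 0 \<and> (\<forall>x\<in>carrier G. x [^] n = \<one>)" for n :: nat
  define d where "d = (LEAST n. P n)"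
  have Pm: "P m" using m by (simp add: P_def)
  have d: "P d" unfolding d_def by (rule LeastI[of P, OF Pm])
  have "\<exists>n. P n" using Pm by blast
  hence "group_exponent G = d" unfolding group_exponent_def d_def P_def by simp
  moreover have "m mod d = 0"
  proof (rule ccontr)
    assume ne: "m mod d \<noteq> 0"
    have "x [^] (m mod d) = \<one>" if x: "x \<in> carrier G" for x
    proof -
      have "\<one> = x [^] (d * (m div d) + m mod d)" using m(2)[OF x] by simp
      also have "\<dots> = x [^] (d * (m div d)) \<otimes> x [^] (m mod d)" by (rule nat_pow_mult[OF x, symmetric])
      also have "x [^] (d * (m div d)) = (x [^] d) [^] (m div d)" by (rule nat_pow_pow[OF x, symmetric])
      also have "x [^] d = \<one>" using d x unfolding P_def by blast
      finally show ?thesis using x by simp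
    qed
    hence "P (m mod d)" using ne by (simp add: P_def)
    hence "d \<le> m mod d" unfolding d_def by (rule Least_le)
    moreover have "m mod d < d" using d by (simp add: P_def)
    ultimately show False by simp
  qed
  ultimately show ?thesis by (simp add: mod_eq_0_iff_dvd)
qed

lemma pow_group_exponent:
  assumes "group_exponent G \<noteq> 0" "x \<in> carrier G"
  shows "x [^]\<^bsub>G\<^esub> group_exponent G = \<one>\<^bsub>G\<^esub>"
proof -
  define P where "P n \<longleftrightarrow> n > 0 \<and> (\<forall>x\<in>carrier G. x [^]\<^bsub>G\<^esub> n = \<one>\<^bsub>G\<^esub>)" for n :: nat
  have ex: "\<exists>n. P n" using assms(1) unfolding group_exponent_def P_def by (auto split: if_splits)
  hence "group_exponent G = (LEAST n. P n)" unfolding group_exponent_def P_def by simp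
  moreover have "P (LEAST n. P n)" using ex by (rule LeastI_ex)
  ultimately show ?thesis using assms(2) by (simp add: P_def)
qed

theorem theorem6p1:
  fixes G :: "('a, 'b) monoid_scheme" and c n :: nat
  assumes "group G" and "finite (carrier G)"
    and "nilpotent G" and "c = nilpotency_class G" and "c > 1"
    and "n = nat \<lceil>log 3 ((real c + 1) / 2)\<rceil>"
    and "odd (group_exponent G)"
  shows "group_exponent (exterior_square G) dvd group_exponent G ^ n \<and>
         group_exponent (schur_multiplier G) dvd group_exponent G ^ n"
proof -
  interpret group G by (rule assms(1))
  \<comment> \<open>The default value 0 is even, so oddness ensures that the exponent is
    genuine.\<close>
  have e: "group_exponent G \<noteq> 0" using odd_pos[OF assms(7)] by simp
  have pow: "x [^]\<^bsub>G\<^esub> group_exponent G = \<one>\<^bsub>G\<^esub>" if "x \<in> carrier G" for x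
    by (rule pow_group_exponent[OF e that])
  have c: "lower_central G c = {\<one>\<^bsub>G\<^esub>}"
    using assms(3) unfolding assms(4) nilpotent_def nilpotency_class_def by (rule LeastI_ex)
  have le: "log 3 ((real c + 1) / 2) \<le> real n"
    unfolding assms(6) by (rule real_nat_ceiling_ge)
  have "(real c + 1) / 2 = 3 powr log 3 ((real c + 1) / 2)" by simp
  also have "\<dots> \<le> 3 powr real n" using le by (intro powr_mono) auto
  finally have "real (c + 1) \<le> real (2 * 3 ^ n)" by (simp add: powr_realpow)
  hence cn: "c + 1 \<le> 2 * 3 ^ n" by (simp only: of_nat_le_iff)
  \<comment> \<open>For n = 0 the inequality would read c + 1 <= 2, against c > 1. At least one
    round is needed, as the first one has its own argument.\<close>
  have n: "n \<ge> 1"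
  proof (rule ccontr)
    assume "\<not> n \<ge> 1"
    thus False using cn assms(5) by (cases n) auto
  qed
  have "carrier G \<noteq> {}" using one_closed by blast
  \<comment> \<open>A finite carrier is enumerated by all natural numbers, necessarily with
    repetitions.\<close>
  then interpret E: enumerated_group G "from_nat_into (carrier G)"
    by unfold_locales (rule range_from_nat_into[OF _ countable_finite[OF assms(2)]])
  have pos: "group_exponent G ^ n > 0" using e by simp
  show ?thesis
    by (rule conjI[OF
          group.group_exponent_dvd[OF group_exterior_square pos E.exterior_square_power[OF assms(7) pow c cn n]]
          group.group_exponent_dvd[OF group_schur_multiplier pos schur_multiplier_power[OF assms(7) pow c cn n]]])
qed

end
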